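(* Let $K$ be an algebraically closed field of arbitrary characteristic, complete with respect to a non-Archimedean absolute value. Let $X\subseteq\mathbf{P}^N$ be a projective variety over $K$ of dimension $n\ge 1$. Let $D_1,\dots,D_q$ be not necessarily distinct hypersurfaces in $\mathbf{P}^N$ over $K$, none of which contains $X$. With the convention $\dim\emptyset=-1$, for $m\in\{-1,0\}$ let $t_m$ be the smallest integer such that for every subset $I\subseteq\{1,\dots,q\}$ of cardinality $t_m+1$, $$\dim\Big(\bigcap_{i\in I}D_i\cap X\Big)\le m,$$ where $t_m=q$ if $\dim(X\cap D_1\cap\dots\cap D_q)>m$. Let $M$ be the smallest positive integer such that for every subset $I\subseteq\{1,\dots,q\}$ of cardinality $t_0+1$, $$\bigcap_{i\in I}D_i\cap X\subseteq M\,\mathrm{Supp}\Big(\bigcap_{i\in I}D_i\cap X\Big),$$ where $D_1,\dots,D_q$ and $X$ are viewed as closed subschemes of $\mathbf{P}^N$. Let $f:K\to X$ be a nonconstant non-Archimedean analytic map whose image is not completely contained in any of the hypersurfaces $D_j$. Let $$\alpha=\max_{\substack{I\subseteq\{1,\dots,q\}\\ |I|=t_{-1}-t_0}}\ \sum_{i\in I}\min\left\{\frac{M}{\deg D_i},1\right\}.$$ Then, for all $r\ge 1$, $$\sum_{j=1}^q\frac{m_f(r,D_j)}{\deg D_j}\le (t_0+\alpha)\,T_f(r)+O(1),$$ where the $O(1)$ term is bounded by a constant independent of $r$.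
   Context: Entire functions and norms: an entire function on $K$ is a power series $g(z)=\sum_{k\ge0}a_kz^k$ with $a_k\in K$ and infinite radius of convergence; for $r>0$ set $|g|_r=\sup_k|a_k|r^k$. Analytic maps: a non-Archimedean analytic map $f:K\to X\subseteq\mathbf{P}^N$ is a map represented by $f=(f_0,\dots,f_N)$, where $f_0,\dots,f_N$ are entire functions on $K$ without common zeros, with image in $X$. Set $|f|_r=\max_{0\le i\le N}|f_i|_r$. Characteristic function: $T_f(r)=\log|f|_r$ (well defined up to an additive constant independent of $r$). Proximity function: if $D$ is a hypersurface in $\mathbf{P}^N$ defined by a homogeneous polynomial $Q\in K[X_0,\dots,X_N]$ of degree $\deg D$, and the image of $f$ is not contained in $D$, then $$m_f(r,D)=\log\frac{|f|_r^{\deg D}}{|Q\circ f|_r},$$ where $Q\circ f=Q(f_0,\dots,f_N)$ (well defined up to an additive constant independent of $r$). Subschemes: intersections in the definition of $M$ are scheme-theoretic. For a closed subscheme $Y$ of $\mathbf{P}^N$, $\mathrm{Supp}(Y)$ denotes the support of $Y$ with its reduced closed subscheme structure, and for a closed subscheme $Z$ with ideal sheaf $\mathcal{I}_Z$, $MZ$ denotes the closed subscheme with ideal sheaf $\mathcal{I}_Z^M$. The inclusion $Y\subseteq Z$ of closed subschemes means $\mathcal{I}_Z\subseteq\mathcal{I}_Y$. If $t_0=q$, there are no subsets of cardinality $t_0+1$ and $M=1$; if $t_{-1}=t_0$, then $\alpha=0$ (empty sum). *)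

theory Defs
  imports
    Complex_Main
    "HOL-Library.Extended_Real"
    "HOL-Library.Poly_Mapping"
    "HOL-Computational_Algebra.Polynomial"
    "HOL-Computational_Algebra.Formal_Power_Series"
    "HOL-Algebra.Ideal_Product"
begin

section \<open>Complete non-Archimedean fields\<close>

text \<open>
  The absolute value gets a constant of its own, since \<open>norm\<close> is restricted to real normed vector
  spaces. That it is nonnegative and vanishes only at \<open>0\<close> follows from the metric space axioms.
  The trivial absolute value is not excluded.
\<close>

class complete_nonarch_field = field + complete_space +
  fixes absval :: "'a \<Rightarrow> real"
  assumes dist_absval: "dist x y = absval (x - y)"
    and absval_mult: "absval (x * y) = absval x * absval y"
    and absval_add_le_max: "absval (x + y) \<le> max (absval x) (absval y)"

lemma absval_nonneg: "0 \<le> absval x"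
  and absval_eq_0_iff: "absval x = 0 \<longleftrightarrow> x = 0"
  for x :: "'k::complete_nonarch_field"
  using dist_absval[of x 0] zero_le_dist[of x 0] dist_eq_0_iff[of x 0] by auto


section \<open>Entire functions\<close>

text \<open>
  The library constants \<open>conv_radius\<close> and \<open>eval_fps\<close> are restricted to real Banach spaces and
  algebras; the next two definitions are the same formulas over \<open>K\<close>.
\<close>

definition na_conv_radius :: "'k::complete_nonarch_field fps \<Rightarrow> ereal" where
  "na_conv_radius g = inverse (limsup (\<lambda>n. ereal (root n (absval (fps_nth g n)))))"

definition na_eval :: "'k::complete_nonarch_field fps \<Rightarrow> 'k \<Rightarrow> 'k" where
  "na_eval g z = suminf (\<lambda>n. fps_nth g n * z ^ n)"

definition entire :: "'k::complete_nonarch_field fps \<Rightarrow> bool" where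
  "entire g \<longleftrightarrow> na_conv_radius g = \<infinity>"

definition fps_abs :: "real \<Rightarrow> 'k::complete_nonarch_field fps \<Rightarrow> real" where
  "fps_abs r g = (SUP k. absval (fps_nth g k) * r ^ k)"


section \<open>Polynomials in the homogeneous coordinates\<close>

text \<open>
  The homogeneous coordinates of \<open>\<^bold>P\<^sup>N\<close> are indexed by the finite type \<open>'n\<close>, so that
  \<open>N + 1 = CARD('n)\<close>. The type below is the polynomial ring \<open>K[X\<^sub>i | i :: 'n]\<close>.
\<close>

type_synonym ('k, 'n) mpoly = "('n \<Rightarrow>\<^sub>0 nat) \<Rightarrow>\<^sub>0 'k"

definition mon_degree :: "('n::finite \<Rightarrow>\<^sub>0 nat) \<Rightarrow> nat" where
  "mon_degree m = (\<Sum>i\<in>UNIV. Poly_Mapping.lookup m i)"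

definition total_degree :: "('k::zero, 'n::finite) mpoly \<Rightarrow> nat" where
  "total_degree F = Max (insert 0 (mon_degree ` Poly_Mapping.keys F))"

definition homogeneous :: "('k::zero, 'n::finite) mpoly \<Rightarrow> bool" where
  "homogeneous F \<longleftrightarrow> (\<forall>m\<in>Poly_Mapping.keys F. mon_degree m = total_degree F)"

text \<open>
  \<open>msubst c x F\<close> substitutes \<open>x i\<close> for \<open>X\<^sub>i\<close> in \<open>F\<close>, where the target ring is a \<open>K\<close>-algebra by
  means of \<open>c\<close>.
\<close>

definition msubst ::
  "('k::zero \<Rightarrow> 'a) \<Rightarrow> ('n::finite \<Rightarrow> 'a) \<Rightarrow> ('k, 'n) mpoly \<Rightarrow> 'a::comm_ring_1" where
  "msubst c x F = (\<Sum>m\<in>Poly_Mapping.keys F. c (Poly_Mapping.lookup F m) * (\<Prod>i\<in>UNIV. x i ^ Poly_Mapping.lookup m i))"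

definition meval :: "('n::finite \<Rightarrow> 'k) \<Rightarrow> ('k, 'n) mpoly \<Rightarrow> 'k::comm_ring_1" where
  "meval = msubst (\<lambda>a. a)"

definition mcomp :: "('k, 'n) mpoly \<Rightarrow> ('n::finite \<Rightarrow> 'k fps) \<Rightarrow> 'k::comm_ring_1 fps" where
  "mcomp F f = msubst fps_const f F"


section \<open>Projective space, its Zariski topology, and dimension\<close>

text \<open>
  A point of \<open>\<^bold>P\<^sup>N(K)\<close> is the set of all its homogeneous coordinate vectors.
\<close>

definition proj_point :: "('n \<Rightarrow> 'k::field) \<Rightarrow> ('n \<Rightarrow> 'k) set" where
  "proj_point x = {y. \<exists>c. c \<noteq> 0 \<and> y = (\<lambda>i. c * x i)}"

definition proj_space :: "('n \<Rightarrow> 'k::field) set set" where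
  "proj_space = {proj_point x | x. \<exists>i. x i \<noteq> 0}"

definition proj_zeros :: "('k::field, 'n::finite) mpoly set \<Rightarrow> ('n \<Rightarrow> 'k) set set" where
  "proj_zeros T = {P \<in> proj_space. \<forall>F\<in>T. \<forall>x\<in>P. meval x F = 0}"

definition zariski_closed :: "('n::finite \<Rightarrow> 'k::field) set set \<Rightarrow> bool" where
  "zariski_closed Z \<longleftrightarrow> (\<exists>T. (\<forall>F\<in>T. homogeneous F) \<and> Z = proj_zeros T)"

definition irreducible_closed :: "('n::finite \<Rightarrow> 'k::field) set set \<Rightarrow> bool" where
  "irreducible_closed Z \<longleftrightarrow> zariski_closed Z \<and> Z \<noteq> {} \<and>
     (\<forall>A B. zariski_closed A \<and> zariski_closed B \<and> Z = A \<union> B \<longrightarrow> A = Z \<or> B = Z)"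

text \<open>
  Dimension as a topological space: the supremum of the lengths of strict chains of irreducible
  closed subsets. It is only used for closed \<open>Y\<close>, for which the irreducible closed subsets of \<open>Y\<close>
  are those of \<open>\<^bold>P\<^sup>N\<close> contained in \<open>Y\<close>.
\<close>

definition zdim :: "('n::finite \<Rightarrow> 'k::field) set set \<Rightarrow> ereal" where
  "zdim Y = (if Y = {} then -1 else
     Sup {ereal (real l) | l. \<exists>Z :: nat \<Rightarrow> ('n \<Rightarrow> 'k) set set.
            (\<forall>j\<le>l. irreducible_closed (Z j) \<and> Z j \<subseteq> Y) \<and> (\<forall>j<l. Z j \<subset> Z (Suc j))})"


section \<open>Closed subschemes of projective space\<close>

text \<open>
  A closed subscheme is given by its ideal sheaf, and a quasi-coherent ideal sheaf by its ideals of
  sections over the standard affine charts \<open>U\<^sub>i = {X\<^sub>i \<noteq> 0}\<close>. The coordinate ring of \<open>U\<^sub>i\<close>, the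
  polynomial ring in the quotients \<open>X\<^sub>k / X\<^sub>i\<close> with \<open>k \<noteq> i\<close>, is realised as the ring of polynomials
  in which the variable \<open>X\<^sub>i\<close> does not occur, with \<open>X\<^sub>k\<close> standing for \<open>X\<^sub>k / X\<^sub>i\<close>. Sums, powers and
  radicals of ideal sheaves, and inclusions between them, are computed chart by chart.
\<close>

definition chart_ring :: "'n::finite \<Rightarrow> ('k::comm_ring_1, 'n) mpoly ring" where
  "chart_ring i = \<lparr>carrier = {p. \<forall>m\<in>Poly_Mapping.keys p. Poly_Mapping.lookup m i = 0},
     monoid.mult = (*), one = 1, ring.zero = 0, add = (+)\<rparr>"

type_synonym ('k, 'n) subscheme = "'n \<Rightarrow> ('k, 'n) mpoly set"

definition dehomogenize :: "'n::finite \<Rightarrow> ('k::comm_ring_1, 'n) mpoly \<Rightarrow> ('k, 'n) mpoly" where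
  "dehomogenize i =
     msubst (\<lambda>a. Poly_Mapping.single 0 a)
       (\<lambda>k. if k = i then 1 else Poly_Mapping.single (Poly_Mapping.single k 1) 1)"

definition hypersurface_scheme :: "('k::field, 'n::finite) mpoly \<Rightarrow> ('k, 'n) subscheme" where
  "hypersurface_scheme Q = (\<lambda>i. PIdl\<^bsub>chart_ring i\<^esub> (dehomogenize i Q))"

text \<open>A closed set of points with its reduced structure: all functions vanishing on it.\<close>

definition variety_scheme :: "('n::finite \<Rightarrow> 'k::field) set set \<Rightarrow> ('k, 'n) subscheme" where
  "variety_scheme X =
     (\<lambda>i. {p \<in> carrier (chart_ring i). \<forall>x. proj_point x \<in> X \<and> x i = 1 \<longrightarrow> meval x p = 0})"

text \<open>Scheme-theoretic intersection: the ideal sheaf is the sum of the ideal sheaves.\<close>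

definition scheme_Inter :: "('k::field, 'n::finite) subscheme set \<Rightarrow> ('k, 'n) subscheme" where
  "scheme_Inter \<Z> = (\<lambda>i. Idl\<^bsub>chart_ring i\<^esub> (\<Union>Z\<in>\<Z>. Z i))"

text \<open>
  The support with its reduced structure is the quotient of the structure sheaf by its nilradical,
  so its ideal sheaf is the radical.
\<close>

definition scheme_Supp :: "('k::field, 'n::finite) subscheme \<Rightarrow> ('k, 'n) subscheme" where
  "scheme_Supp Y = (\<lambda>i. {p \<in> carrier (chart_ring i). \<exists>k::nat. p ^ k \<in> Y i})"

text \<open>
  \<open>scheme_mult M Z\<close> is \<open>M Z\<close>, with ideal sheaf the \<open>M\<close>-th power; \<open>ideals_set R\<close> is the monoid of
  ideals of \<open>R\<close> under the product of ideals.
\<close>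

definition scheme_mult :: "nat \<Rightarrow> ('k::field, 'n::finite) subscheme \<Rightarrow> ('k, 'n) subscheme" where
  "scheme_mult M Z = (\<lambda>i. Z i [^]\<^bsub>ideals_set (chart_ring i)\<^esub> M)"

definition subscheme_le ::
  "('k::field, 'n::finite) subscheme \<Rightarrow> ('k, 'n) subscheme \<Rightarrow> bool" where
  "subscheme_le Y Z \<longleftrightarrow> (\<forall>i. Z i \<subseteq> Y i)"


section \<open>Varieties, hypersurfaces and analytic maps\<close>

definition projective_variety :: "('n::finite \<Rightarrow> 'k::field) set set \<Rightarrow> bool" where
  "projective_variety X \<longleftrightarrow> irreducible_closed X"

definition hypersurface_poly :: "('k::field, 'n::finite) mpoly \<Rightarrow> bool" where
  "hypersurface_poly Q \<longleftrightarrow> Q \<noteq> 0 \<and> homogeneous Q \<and> 1 \<le> total_degree Q"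

definition hypersurface :: "('k::field, 'n::finite) mpoly \<Rightarrow> ('n \<Rightarrow> 'k) set set" where
  "hypersurface Q = proj_zeros {Q}"

definition map_point :: "('n::finite \<Rightarrow> 'k::complete_nonarch_field fps) \<Rightarrow> 'k \<Rightarrow> ('n \<Rightarrow> 'k) set" where
  "map_point f z = proj_point (\<lambda>i. na_eval (f i) z)"

definition analytic_map ::
  "('n::finite \<Rightarrow> 'k::complete_nonarch_field fps) \<Rightarrow> ('n \<Rightarrow> 'k) set set \<Rightarrow> bool" where
  "analytic_map f X \<longleftrightarrow> (\<forall>i. entire (f i)) \<and> (\<forall>z. \<exists>i. na_eval (f i) z \<noteq> 0) \<and>
     (\<forall>z. map_point f z \<in> X)"

definition map_abs :: "real \<Rightarrow> ('n::finite \<Rightarrow> 'k::complete_nonarch_field fps) \<Rightarrow> real" where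
  "map_abs r f = Max (range (\<lambda>i. fps_abs r (f i)))"

definition characteristic_fun ::
  "('n::finite \<Rightarrow> 'k::complete_nonarch_field fps) \<Rightarrow> real \<Rightarrow> real" where
  "characteristic_fun f r = ln (map_abs r f)"

definition proximity_fun ::
  "('n::finite \<Rightarrow> 'k::complete_nonarch_field fps) \<Rightarrow> real \<Rightarrow> ('k, 'n) mpoly \<Rightarrow> real" where
  "proximity_fun f r Q = ln (map_abs r f ^ total_degree Q / fps_abs r (mcomp Q f))"


section \<open>The invariants of the configuration\<close>

text \<open>The hypersurfaces are \<open>Q 1, \<dots>, Q q\<close>, and \<open>m\<close> is \<open>-1\<close> or \<open>0\<close>.\<close>

definition t_index ::
  "nat \<Rightarrow> (nat \<Rightarrow> ('k::field, 'n::finite) mpoly) \<Rightarrow> ('n \<Rightarrow> 'k) set set \<Rightarrow> ereal \<Rightarrow> nat" where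
  "t_index q Q X m =
     (if zdim (X \<inter> (\<Inter>i\<in>{1..q}. hypersurface (Q i))) > m then q
      else LEAST t. \<forall>I. I \<subseteq> {1..q} \<and> card I = t + 1 \<longrightarrow>
             zdim ((\<Inter>i\<in>I. hypersurface (Q i)) \<inter> X) \<le> m)"

definition scheme_section ::
  "(nat \<Rightarrow> ('k::field, 'n::finite) mpoly) \<Rightarrow> ('n \<Rightarrow> 'k) set set \<Rightarrow> nat set \<Rightarrow> ('k, 'n) subscheme" where
  "scheme_section Q X I =
     scheme_Inter (insert (variety_scheme X) ((\<lambda>i. hypersurface_scheme (Q i)) ` I))"

definition M_index ::
  "nat \<Rightarrow> (nat \<Rightarrow> ('k::field, 'n::finite) mpoly) \<Rightarrow> ('n \<Rightarrow> 'k) set set \<Rightarrow> nat" where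
  "M_index q Q X =
     (LEAST M. 0 < M \<and> (\<forall>I. I \<subseteq> {1..q} \<and> card I = t_index q Q X 0 + 1 \<longrightarrow>
        subscheme_le (scheme_section Q X I) (scheme_mult M (scheme_Supp (scheme_section Q X I)))))"

definition alpha ::
  "nat \<Rightarrow> (nat \<Rightarrow> ('k::field, 'n::finite) mpoly) \<Rightarrow> ('n \<Rightarrow> 'k) set set \<Rightarrow> real" where
  "alpha q Q X =
     Max ((\<lambda>I. \<Sum>i\<in>I. min (real (M_index q Q X) / real (total_degree (Q i))) 1) `
       {I. I \<subseteq> {1..q} \<and> card I = t_index q Q X (-1) - t_index q Q X 0})"

end

theory Submission
  imports Defs "HOL-Computational_Algebra.Formal_Laurent_Series"
begin

text \<open>
  Fix \<open>r\<close>. If the hypersurfaces \<open>D\<^sub>l\<close> with \<open>l \<in> I\<close> have no common point on \<open>X\<close>, the Nullstellensatz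
  bounds \<open>m\<^sub>f(r, D\<^sub>l)\<close> for some \<open>l \<in> I\<close>. If they meet in finitely many points \<open>p\<^sub>1, \<dots>, p\<^sub>s\<close>, let \<open>G\<close> be
  a product of linear forms, one through each point. Then \<open>G ^ M\<close> lies in the ideal of the
  intersection on each chart; evaluating at \<open>f\<close> on the chart where \<open>|f\<^sub>i|\<^sub>r = |f|\<^sub>r\<close> bounds
  \<open>(|G \<circ> f|\<^sub>r / |f|\<^sub>r ^ s) ^ M\<close> by a constant times the largest \<open>|D\<^sub>l \<circ> f|\<^sub>r / |f|\<^sub>r ^ deg D\<^sub>l\<close>. As \<open>f\<close> is
  close to at most one of the points, \<open>G\<close> can be chosen with \<open>|G \<circ> f|\<^sub>r\<close> of size at least
  \<open>|f|\<^sub>r ^ (s - 1)\<close>, hence \<open>m\<^sub>f(r, D\<^sub>l) \<le> M T\<^sub>f(r) + O(1)\<close> for some \<open>l \<in> I\<close>. So at most \<open>t\<^sub>0\<close> of the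
  \<open>m\<^sub>f(r, D\<^sub>j)\<close> exceed \<open>M T\<^sub>f(r) + O(1)\<close>, and at most \<open>t\<^sub>-\<^sub>1\<close> exceed \<open>O(1)\<close>; all are at most
  \<open>deg D\<^sub>j T\<^sub>f(r) + O(1)\<close>.
\<close>

section \<open>Substitution homomorphisms\<close>

text \<open>Membership of \<open>G ^ M\<close> in a chart ideal becomes an estimate because |.|_r is
  multiplicative, hence makes sense for quotients of entire functions, and at a radius where
  \<open>f i\<close> is the largest component every quotient \<open>f k / f i\<close> has size at
  most 1. So the coefficients of any relation on that chart are bounded independently of
  \<open>r\<close>. The largest component changes with \<open>r\<close>, but there are finitely many
  charts, and their constants can be added up. The term M T_f comes from the one point that
  \<open>f\<close> may approach: its linear form is only known to be bounded below by a constant,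
  which loses one of the \<open>s\<close> factors |f|_r, and the exponent \<open>M\<close> turns
  this into a loss of |f|_r ^ M. The bound by deg D_j T_f holds because |D_j o f|_r does not
  decrease in \<open>r\<close>. Two facts carry the algebra: Hilbert's basis theorem, which makes
  the minimum defining \<open>M\<close> exist and gives the descending chain condition that turns
  dimension 0 into finitely many points, and the Nullstellensatz, proved by Noether normalisation
  with weighted powers, which works in every characteristic.\<close>

abbreviation lookup where "lookup \<equiv> Poly_Mapping.lookup"
abbreviation keys where "keys \<equiv> Poly_Mapping.keys"
abbreviation single where "single \<equiv> Poly_Mapping.single"

text \<open>Homomorphisms are plain functions with a predicate, so that substitutions into different
  rings can be composed and compared.\<close>

locale rhom =
  fixes h :: "'a::comm_ring_1 \<Rightarrow> 'b::comm_ring_1"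
  assumes hom_add: "h (x + y) = h x + h y"
    and hom_mult: "h (x * y) = h x * h y"
    and hom_one: "h 1 = 1"
begin

lemma hom_zero: "h 0 = 0"
  using hom_add[of 0 0] by simp

lemma hom_uminus: "h (- x) = - h x"
  using hom_add[of x "- x"] by (simp add: hom_zero eq_neg_iff_add_eq_0 add.commute)

lemma hom_diff: "h (x - y) = h x - h y"
  using hom_add[of x "- y"] by (simp add: hom_uminus)

lemma hom_power: "h (x ^ n) = h x ^ n"
  by (induction n) (simp_all add: hom_one hom_mult)

lemma hom_sum: "h (sum f A) = (\<Sum>a\<in>A. h (f a))"
  by (induction A rule: infinite_finite_induct) (simp_all add: hom_zero hom_add)

lemma hom_prod: "h (prod f A) = (\<Prod>a\<in>A. h (f a))"
  by (induction A rule: infinite_finite_induct) (simp_all add: hom_one hom_mult)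

lemmas hom_simps = hom_zero hom_one hom_add hom_mult hom_uminus hom_diff hom_power hom_sum hom_prod

end

lemma rhom_comp: "rhom g \<Longrightarrow> rhom h \<Longrightarrow> rhom (\<lambda>x. g (h x))"
  unfolding rhom_def by simp

lemma rhom_fps_const: "rhom (fps_const :: 'a::comm_ring_1 \<Rightarrow> 'a fps)"
  by unfold_locales simp_all

lemma rhom_const_poly: "rhom (\<lambda>a::'a::comm_ring_1. [:a:])"
  by unfold_locales auto

lemma rhom_id: "rhom (\<lambda>a. a)"
  by unfold_locales auto

lemma rhom_map_poly:
  assumes "rhom h"
  shows "rhom (map_poly h)"
proof -
  interpret rhom h by fact
  have c: "coeff (map_poly h p) i = h (coeff p i)" for p i
    by (simp add: coeff_map_poly hom_zero)
  show ?thesis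
    by unfold_locales (auto intro!: poly_eqI simp: c coeff_mult hom_simps)
qed

lemma rhom_poly: "rhom (\<lambda>p::'a::comm_ring_1 poly. poly p y)"
  by unfold_locales auto

section \<open>Polynomials as a free algebra\<close>

abbreviation mconst :: "'a::comm_ring_1 \<Rightarrow> ('a, 'n) mpoly" where
  "mconst \<equiv> single 0"

definition mvar :: "'n \<Rightarrow> ('a::comm_ring_1, 'n) mpoly" where
  "mvar k = single (single k 1) 1"

lemma rhom_mconst: "rhom (mconst :: 'a::comm_ring_1 \<Rightarrow> ('a, 'n) mpoly)"
  by unfold_locales (simp_all add: single_add mult_single)

lemma mpoly_sum_single:
  fixes F :: "'b \<Rightarrow>\<^sub>0 'a::comm_monoid_add"
  shows "F = (\<Sum>m\<in>keys F. single m (lookup F m))"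
proof (rule poly_mapping_eqI)
  fix k
  show "lookup F k =
     lookup (\<Sum>m\<in>keys F. single m (lookup F m)) k"
    by (auto simp: lookup_sum lookup_single when_def in_keys_iff)
qed

lemma mpoly_induct_single [case_names zero single add]:
  fixes F :: "'b \<Rightarrow>\<^sub>0 'a::comm_monoid_add"
  assumes "P 0" "\<And>m a. P (single m a)" "\<And>F G. P F \<Longrightarrow> P G \<Longrightarrow> P (F + G)"
  shows "P F"
proof -
  have "P (\<Sum>m\<in>A. single m (lookup F m))" for A
    by (induction A rule: infinite_finite_induct) (use assms in auto)
  then show ?thesis using mpoly_sum_single[of F] by metis
qed

lemma single_as_prod:
  fixes m :: "'n::finite \<Rightarrow>\<^sub>0 nat" and a :: "'a::comm_ring_1"
  shows "single m a = mconst a * (\<Prod>k\<in>UNIV. mvar k ^ lookup m k)"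
proof -
  have pw: "mvar k ^ j = single (single k j) (1::'a)" for k :: 'n and j
    by (induction j) (simp_all add: mvar_def mult_single single_add[symmetric])
  have "(\<Prod>k\<in>A. mvar k ^ lookup m k) =
      single (\<Sum>k\<in>A. single k (lookup m k)) (1::'a)" if "finite A" for A
    using that by induction (simp_all add: pw mult_single)
  moreover have "(\<Sum>k\<in>UNIV. single k (lookup m k)) = m"
    by (rule poly_mapping_eqI) (simp add: lookup_sum lookup_single when_def)
  ultimately show ?thesis by (simp add: mult_single)
qed

lemma mpoly_induct [case_names const var add mult]:
  fixes F :: "('a::comm_ring_1, 'n::finite) mpoly"
  assumes c: "\<And>a. P (mconst a)" and v: "\<And>k. P (mvar k)"
    and a: "\<And>F G. P F \<Longrightarrow> P G \<Longrightarrow> P (F + G)" and m: "\<And>F G. P F \<Longrightarrow> P G \<Longrightarrow> P (F * G)"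
  shows "P F"
proof (induction F rule: mpoly_induct_single)
  case zero
  then show ?case using c[of 0] by simp
next
  case (single e b)
  have one: "P 1" using c[of 1] by simp
  have "P (mvar k ^ j)" for k j by (induction j) (auto intro: one v m)
  then have "P (\<Prod>k\<in>A. mvar k ^ lookup e k)" for A
    by (induction A rule: infinite_finite_induct) (auto intro: one m)
  then show ?case by (subst single_as_prod) (intro m c)
qed (rule a)

text \<open>The set \<open>keys F\<close> shrinks under cancellation. Summing over any larger finite
  set lets two polynomials share an index set, which makes additivity of \<open>msubst\<close>
  termwise.\<close>

lemma msubst_superset:
  assumes "c 0 = 0" "finite S" "keys F \<subseteq> S"
  shows "msubst c x F = (\<Sum>m\<in>S. c (lookup F m) * (\<Prod>i\<in>UNIV. x i ^ lookup m i))"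
  unfolding msubst_def
  by (rule sum.mono_neutral_left) (use assms in \<open>auto simp: in_keys_iff\<close>)

lemma msubst_single:
  assumes "c 0 = 0"
  shows "msubst c x (single m a) = c a * (\<Prod>i\<in>UNIV. x i ^ lookup m i)"
  using msubst_superset[of c "{m}" "single m a" x] assms by simp

lemma rhom_msubst:
  assumes "rhom c"
  shows "rhom (msubst c x)"
proof -
  interpret rhom c by fact
  have add: "msubst c x (F + G) = msubst c x F + msubst c x G" for F G
  proof -
    let ?S = "keys F \<union> keys G"
    have "keys (F + G) \<subseteq> ?S" by (rule keys_add)
    then show ?thesis
      by (simp add: msubst_superset[of c ?S] hom_simps lookup_add ring_distribs sum.distrib)
  qed
  have sing: "msubst c x (single m a * single m' b) =
       msubst c x (single m a) * msubst c x (single m' b)" for m m' a b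
    by (simp add: mult_single msubst_single hom_simps lookup_add power_add prod.distrib)
  have mult1: "msubst c x (single m a * G) = msubst c x (single m a) * msubst c x G" for m a G
    by (induction G rule: mpoly_induct_single)
       (simp_all add: sing add distrib_left, simp_all add: msubst_def)
  have mult: "msubst c x (F * G) = msubst c x F * msubst c x G" for F G
    by (induction F rule: mpoly_induct_single)
       (simp_all add: mult1 add distrib_right, simp_all add: msubst_def)
  have "msubst c x 1 = 1"
    using msubst_single[of c x 0 1] by (simp add: hom_zero hom_one)
  with add mult show ?thesis by unfold_locales
qed

lemma msubst_const: "rhom c \<Longrightarrow> msubst c x (mconst a) = c a"
  by (simp add: msubst_single rhom.hom_zero)

lemma msubst_var:
  assumes "rhom c"
  shows "msubst c x (mvar k) = x k"
proof -
  have "(\<Prod>i\<in>UNIV. x i ^ lookup (single k 1) i) = (\<Prod>i\<in>UNIV. if i = k then x i else 1)"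
    by (intro prod.cong) (auto simp: lookup_single when_def)
  then show ?thesis
    by (simp add: mvar_def msubst_single assms rhom.hom_zero rhom.hom_one del: One_nat_def)
qed

text \<open>This is the uniqueness half of the universal property of polynomial rings: with it, an
  identity between composed substitutions only has to be checked on constants and variables.\<close>

lemma rhom_eq_msubst:
  assumes "rhom h"
  shows "h F = msubst (\<lambda>a. h (mconst a)) (\<lambda>k. h (mvar k)) F"
proof -
  interpret h: rhom h by fact
  have c: "rhom (\<lambda>a. h (mconst a))" by (rule rhom_comp[OF assms rhom_mconst])
  interpret m: rhom "msubst (\<lambda>a. h (mconst a)) (\<lambda>k. h (mvar k))" by (rule rhom_msubst[OF c])
  show ?thesis
    by (induction F rule: mpoly_induct)
       (simp_all only: h.hom_simps m.hom_simps msubst_const[OF c] msubst_var[OF c])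
qed

lemma rhom_msubst_comp:
  assumes "rhom h" "rhom c"
  shows "h (msubst c x F) = msubst (\<lambda>a. h (c a)) (\<lambda>k. h (x k)) F"
  using rhom_eq_msubst[OF rhom_comp[OF assms(1) rhom_msubst[OF assms(2)]], of x F]
  by (simp only: msubst_const[OF assms(2)] msubst_var[OF assms(2)])

lemma msubst_cong: "(\<And>a. c a = c' a) \<Longrightarrow> (\<And>k. x k = x' k) \<Longrightarrow> msubst c x F = msubst c' x' F"
  unfolding msubst_def by simp

lemma msubst_mvar: "msubst mconst mvar F = F"
  using rhom_eq_msubst[OF rhom_id, of F] by simp

lemma rhom_meval: "rhom (meval x)"
  unfolding meval_def by (rule rhom_msubst[OF rhom_id])

lemma rhom_mcomp: "rhom (\<lambda>F. mcomp F f)"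
  unfolding mcomp_def by (rule rhom_msubst[OF rhom_fps_const])

lemma rhom_dehomogenize: "rhom (dehomogenize i)"
  unfolding dehomogenize_def by (rule rhom_msubst[OF rhom_mconst])

section \<open>The Hilbert basis theorem for subrings\<close>

text \<open>These are the \<open>A\<close>-linear combinations of \<open>S\<close>. The coefficients
  come from a subset \<open>A\<close> of the ring rather than from a whole type, since the
  coordinate rings of the charts are subrings of one polynomial type.\<close>

inductive_set ispan :: "'a::comm_ring_1 set \<Rightarrow> 'a set \<Rightarrow> 'a set" for A S where
  ispan_zero: "0 \<in> ispan A S"
| ispan_step: "r \<in> ispan A S \<Longrightarrow> a \<in> A \<Longrightarrow> s \<in> S \<Longrightarrow> a * s + r \<in> ispan A S"

definition subring1 :: "'a::comm_ring_1 set \<Rightarrow> bool" where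
  "subring1 A \<longleftrightarrow> 1 \<in> A \<and> (\<forall>x\<in>A. \<forall>y\<in>A. x + y \<in> A \<and> x * y \<in> A) \<and> (\<forall>x\<in>A. - x \<in> A)"

lemma subring1D:
  assumes "subring1 A"
  shows "1 \<in> A" "0 \<in> A" "x \<in> A \<Longrightarrow> y \<in> A \<Longrightarrow> x + y \<in> A" "x \<in> A \<Longrightarrow> y \<in> A \<Longrightarrow> x * y \<in> A"
    "x \<in> A \<Longrightarrow> - x \<in> A" "x \<in> A \<Longrightarrow> x ^ n \<in> A"
proof -
  show 1: "1 \<in> A" and "x \<in> A \<Longrightarrow> y \<in> A \<Longrightarrow> x + y \<in> A" and m: "x \<in> A \<Longrightarrow> y \<in> A \<Longrightarrow> x * y \<in> A" and "x \<in> A \<Longrightarrow> - x \<in> A" for x y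
    using assms unfolding subring1_def by auto
  show "0 \<in> A"
    using assms unfolding subring1_def by (metis add.right_inverse)
  show "x \<in> A \<Longrightarrow> x ^ n \<in> A" by (induction n) (auto intro: 1 m)
qed

lemma subring1_sum: "subring1 A \<Longrightarrow> (\<And>i. i \<in> I \<Longrightarrow> f i \<in> A) \<Longrightarrow> sum f I \<in> A"
  by (induction I rule: infinite_finite_induct) (auto intro: subring1D)

lemma ispan_base: "1 \<in> A \<Longrightarrow> s \<in> S \<Longrightarrow> s \<in> ispan A S"
  using ispan_step[OF ispan_zero, of 1 A s S] by simp

lemma ispan_closed_subset:
  assumes "S \<subseteq> J" "0 \<in> J" "\<And>x y. x \<in> J \<Longrightarrow> y \<in> J \<Longrightarrow> x + y \<in> J" "\<And>a x. a \<in> A \<Longrightarrow> x \<in> J \<Longrightarrow> a * x \<in> J"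
  shows "ispan A S \<subseteq> J"
proof
  fix x assume "x \<in> ispan A S"
  then show "x \<in> J" by induction (use assms in auto)
qed

lemma ispan_add: "x \<in> ispan A S \<Longrightarrow> y \<in> ispan A S \<Longrightarrow> x + y \<in> ispan A S"
  by (induction rule: ispan.induct) (auto simp: add.assoc intro: ispan_step)

lemma ispan_mult: "subring1 A \<Longrightarrow> a \<in> A \<Longrightarrow> x \<in> ispan A S \<Longrightarrow> a * x \<in> ispan A S"
  by (rotate_tac 2, induction rule: ispan.induct)
     (auto simp: distrib_left mult.assoc[symmetric] intro: ispan_zero ispan_step subring1D)

lemma ispan_diff: "subring1 A \<Longrightarrow> x \<in> ispan A S \<Longrightarrow> y \<in> ispan A S \<Longrightarrow> x - y \<in> ispan A S"
  using ispan_add[of x A S "- 1 * y"] ispan_mult[of A "- 1" y S] by (simp add: subring1D)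

lemma ispan_mono: "S \<subseteq> T \<Longrightarrow> ispan A S \<subseteq> ispan A T"
proof
  fix x assume "S \<subseteq> T" "x \<in> ispan A S"
  from this(2,1) show "x \<in> ispan A T" by induction (auto intro: ispan_zero ispan_step)
qed

lemma ispan_trans: "subring1 A \<Longrightarrow> F \<subseteq> ispan A S \<Longrightarrow> ispan A F \<subseteq> ispan A S"
  by (rule ispan_closed_subset) (auto intro: ispan_zero ispan_add ispan_mult)

lemma ispan_finite:
  assumes "x \<in> ispan A S"
  shows "\<exists>F\<subseteq>S. finite F \<and> x \<in> ispan A F"
  using assms
proof induction
  case ispan_zero
  then show ?case by (intro exI[of _ "{}"]) (auto intro: ispan.ispan_zero)
next
  case (ispan_step r a s)
  then obtain F where "F \<subseteq> S" "finite F" "r \<in> ispan A F" by auto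
  with ispan_step show ?case
    by (intro exI[of _ "insert s F"]) (auto intro!: ispan.ispan_step intro: subsetD[OF ispan_mono[of F]])
qed

lemma ispan_finite_set:
  assumes "finite G" "G \<subseteq> ispan A S"
  shows "\<exists>F\<subseteq>S. finite F \<and> G \<subseteq> ispan A F"
proof -
  have "\<forall>x\<in>G. \<exists>F. F \<subseteq> S \<and> finite F \<and> x \<in> ispan A F" using ispan_finite assms(2) by (meson subsetD)
  then obtain F where F: "\<And>x. x \<in> G \<Longrightarrow> F x \<subseteq> S \<and> finite (F x) \<and> x \<in> ispan A (F x)" by metis
  have "G \<subseteq> ispan A (\<Union>x\<in>G. F x)"
    using F ispan_mono[of "F _" "\<Union>x\<in>G. F x" A] by blast
  then show ?thesis using F assms(1) by (intro exI[of _ "\<Union>x\<in>G. F x"]) auto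
qed

lemma rhom_ispan:
  assumes "rhom h" "x \<in> ispan A S"
  shows "h x \<in> ispan (h ` A) (h ` S)"
proof -
  interpret rhom h by fact
  show ?thesis using assms(2) by induction (auto simp: hom_simps intro: ispan_zero ispan_step)
qed

text \<open>For a subring \<open>A\<close> this is the Noetherian property. It speaks of arbitrary
  subsets and takes the finite generating set from \<open>S\<close> itself, so it applies to a
  sequence or to a union of sets without passing to an ideal first.\<close>

definition noeth :: "'a::comm_ring_1 set \<Rightarrow> bool" where
  "noeth A \<longleftrightarrow> (\<forall>S\<subseteq>A. \<exists>F\<subseteq>S. finite F \<and> S \<subseteq> ispan A F)"

text \<open>A finite generating set chosen inside the range of \<open>s\<close> uses finitely many
  indices, so it lies among the first \<open>n\<close> terms for some \<open>n\<close>, and these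
  generate every term.\<close>

lemma noeth_sequence:
  fixes s :: "nat \<Rightarrow> 'a::comm_ring_1"
  assumes "noeth A" "\<And>n. s n \<in> A"
  shows "\<exists>n. s n \<in> ispan A (s ` {..<n})"
proof -
  obtain F where F: "F \<subseteq> range s" "finite F" "range s \<subseteq> ispan A F"
    using assms unfolding noeth_def by (metis image_subsetI)
  obtain N where N: "finite N" "F = s ` N" using F(1,2) by (metis finite_subset_image)
  obtain n where n: "N \<subseteq> {..<n}" using N(1) by (metis finite_nat_iff_bounded)
  have "ispan A F \<subseteq> ispan A (s ` {..<n})" using N(2) n by (intro ispan_mono) auto
  then show ?thesis using F(3) by blast
qed

abbreviation poly_over :: "'a::comm_ring_1 set \<Rightarrow> 'a poly set" where
  "poly_over A \<equiv> {P. \<forall>i. coeff P i \<in> A}"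

lemma subring1_poly_over:
  assumes "subring1 A"
  shows "subring1 (poly_over A)"
  unfolding subring1_def
  using assms by (auto simp: coeff_mult coeff_1 intro!: subring1_sum intro: subring1D)

text \<open>Hilbert's argument: if finite generation failed, pick successively an element of least
  degree outside the span of the earlier ones. The leading coefficients form a sequence in
  \<open>A\<close>, so one of them is a combination of earlier ones, and subtracting the matching
  combination of polynomials lowers a degree that was minimal.\<close>

lemma noeth_poly_over:
  assumes A: "subring1 A" "noeth A"
  shows "noeth (poly_over A)"
proof (rule ccontr)
  let ?B = "poly_over A"
  note B = subring1_poly_over[OF A(1)]
  assume "\<not> noeth ?B"
  then obtain S where S: "S \<subseteq> ?B" and bad: "\<And>F. F \<subseteq> S \<Longrightarrow> finite F \<Longrightarrow> \<not> S \<subseteq> ispan ?B F"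
    unfolding noeth_def by meson
  define I where "I = ispan ?B S"
  have IB: "I \<subseteq> ?B" unfolding I_def
    by (rule ispan_closed_subset) (use S in \<open>auto intro!: subring1D[OF A(1)] simp: coeff_mult intro!: subring1_sum[OF A(1)]\<close>)
  have SI: "S \<subseteq> I" unfolding I_def using ispan_base[OF subring1D(1)[OF B]] by blast
  have ex: "\<exists>p. p \<in> I \<and> p \<notin> ispan ?B F" if F: "finite F" "F \<subseteq> I" for F
  proof (rule ccontr)
    assume "\<nexists>p. p \<in> I \<and> p \<notin> ispan ?B F"
    moreover obtain F' where "F' \<subseteq> S" "finite F'" "F \<subseteq> ispan ?B F'"
      using ispan_finite_set[OF F(1), of ?B S] F(2) unfolding I_def by blast
    ultimately show False using bad[of F'] ispan_trans[OF B, of F F'] SI by blast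
  qed
  define pick where "pick F = arg_min degree (\<lambda>p. p \<in> I \<and> p \<notin> ispan ?B F)" for F
  have pick: "pick F \<in> I" "pick F \<notin> ispan ?B F" and
    min: "\<And>p. p \<in> I \<Longrightarrow> p \<notin> ispan ?B F \<Longrightarrow> degree (pick F) \<le> degree p" if F: "finite F" "F \<subseteq> I" for F
  proof -
    obtain p where p: "p \<in> I \<and> p \<notin> ispan ?B F" using ex[OF F] by auto
    show "pick F \<in> I" "pick F \<notin> ispan ?B F"
      using arg_min_natI[of "\<lambda>p. p \<in> I \<and> p \<notin> ispan ?B F", OF p] unfolding pick_def by auto
    show "\<And>p. p \<in> I \<Longrightarrow> p \<notin> ispan ?B F \<Longrightarrow> degree (pick F) \<le> degree p"
      unfolding pick_def by (rule arg_min_nat_le) auto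
  qed
  define G where "G = rec_nat {} (\<lambda>_ F. insert (pick F) F)"
  define f where "f n = pick (G n)" for n
  have G0: "G 0 = {}" and GS: "G (Suc n) = insert (f n) (G n)" for n by (auto simp: G_def f_def)
  have Gfin: "finite (G n) \<and> G n \<subseteq> I" for n
    by (induction n) (use pick in \<open>auto simp: G0 GS f_def\<close>)
  have Geq: "G n = f ` {..<n}" for n
    by (induction n) (auto simp: G0 GS lessThan_Suc)
  have fI: "f n \<in> I" and fn: "f n \<notin> ispan ?B (G n)" for n
    using pick[of "G n"] Gfin[of n] by (auto simp: f_def)
  have mono: "degree (f n) \<le> degree (f m)" if "n \<le> m" for n m
  proof -
    have "ispan ?B (G n) \<subseteq> ispan ?B (G m)" by (intro ispan_mono) (use that in \<open>auto simp: Geq\<close>)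
    then have "f m \<notin> ispan ?B (G n)" using fn[of m] by blast
    then show ?thesis using min[of "G n" "f m"] Gfin[of n] fI[of m] by (auto simp: f_def)
  qed
  define a where "a n = lead_coeff (f n)" for n
  have "a n \<in> A" for n using fI[of n] IB by (auto simp: a_def)
  then obtain n where n: "a n \<in> ispan A (a ` {..<n})" using noeth_sequence[OF A(2)] by blast
  let ?d = "degree (f n)"
  \<comment> \<open>The relation among leading coefficients is lifted to polynomials: each earlier
    \<open>f i\<close> is multiplied by a monomial that brings its degree up to that of
    \<open>f n\<close>, which is possible because the degrees do not decrease.\<close>
  have "\<exists>Q\<in>ispan ?B (G n). coeff Q ?d = r \<and> degree Q \<le> ?d" if "r \<in> ispan A (a ` {..<n})" for r
    using that
  proof induction
    case ispan_zero
    then show ?case by (intro bexI[of _ 0]) (auto intro: ispan.ispan_zero)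
  next
    case (ispan_step r b s)
    then obtain Q i where Q: "Q \<in> ispan ?B (G n)" "coeff Q ?d = r" "degree Q \<le> ?d" and i: "i < n" "s = a i" by auto
    let ?e = "?d - degree (f i)"
    have le: "degree (f i) \<le> ?d" using mono i by simp
    have "monom b ?e * f i + Q \<in> ispan ?B (G n)"
      using ispan_step.hyps Q i by (intro ispan.ispan_step) (auto simp: Geq subring1D[OF A(1)] coeff_monom)
    moreover have "coeff (monom b ?e * f i) ?d = b * a i"
      using le by (simp add: coeff_monom_mult a_def)
    moreover have "degree (monom b ?e * f i) \<le> ?d"
      using le degree_mult_le[of "monom b ?e" "f i"] degree_monom_le[of b ?e] by linarith
    ultimately show ?case using Q i by (intro bexI[of _ "monom b ?e * f i + Q"]) (auto intro: degree_add_le)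
  qed
  then obtain Q where Q: "Q \<in> ispan ?B (G n)" "coeff Q ?d = a n" "degree Q \<le> ?d" using n by blast
  let ?g = "f n - Q"
  have c: "coeff ?g ?d = 0" using Q by (simp add: a_def)
  have dg: "degree ?g \<le> ?d" using Q(3) by (simp add: degree_diff_le)
  have gn: "?g \<notin> ispan ?B (G n)" using ispan_add[of ?g ?B "G n" Q] Q(1) fn[of n] by auto
  have "Q \<in> I" using Q(1) ispan_trans[OF B, of "G n" S] Gfin[of n] unfolding I_def by blast
  then have "?g \<in> I" using fI[of n] ispan_diff[OF B] unfolding I_def by blast
  \<comment> \<open>The difference is still outside the span, so minimality forces its degree to be
    \<open>?d\<close>, although its coefficient there is 0.\<close>
  then have "?d \<le> degree ?g" using min[of "G n"] Gfin gn by (auto simp: f_def)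
  then have "?g = 0" using c dg by (metis le_antisym leading_coeff_0_iff)
  then show False using gn ispan_zero by metis
qed

lemma noeth_image:
  assumes "rhom h" "noeth A"
  shows "noeth (h ` A)"
  unfolding noeth_def
proof (intro allI impI)
  fix S assume "S \<subseteq> h ` A"
  then obtain T where T: "T \<subseteq> A" "S = h ` T" by (metis subset_imageE)
  then obtain F where F: "F \<subseteq> T" "finite F" "T \<subseteq> ispan A F" using assms(2) unfolding noeth_def by meson
  show "\<exists>F\<subseteq>S. finite F \<and> S \<subseteq> ispan (h ` A) F"
    using F T rhom_ispan[OF assms(1), of _ A F] by (intro exI[of _ "h ` F"]) auto
qed

text \<open>Polynomial subrings live inside one type, so variables can be adjoined one at a time by
  induction on \<open>V\<close>, and the coordinate ring of the chart \<open>i\<close> is the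
  instance \<open>UNIV - {i}\<close>.\<close>

definition pvars :: "'n set \<Rightarrow> ('a::comm_ring_1, 'n) mpoly set" where
  "pvars V = {p. \<forall>m\<in>keys p. \<forall>k. k \<notin> V \<longrightarrow> lookup m k = 0}"

lemma subring1_pvars: "subring1 (pvars V :: ('a::comm_ring_1, 'n) mpoly set)"
proof -
  have "x + y \<in> pvars V \<and> x * y \<in> pvars V" if "x \<in> pvars V" "y \<in> pvars V" for x y :: "('a, 'n) mpoly"
  proof -
    have "lookup m k = 0" if "m \<in> keys (x + y)" "k \<notin> V" for m k
      using \<open>x \<in> _\<close> \<open>y \<in> _\<close> that subsetD[OF keys_add[of x y], of m] by (auto simp: pvars_def)
    moreover have "lookup m k = 0" if "m \<in> keys (x * y)" "k \<notin> V" for m k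
      using \<open>x \<in> _\<close> \<open>y \<in> _\<close> that subsetD[OF keys_mult[of x y], of m] by (auto simp: pvars_def lookup_add)
    ultimately show ?thesis by (auto simp: pvars_def)
  qed
  moreover have "- x \<in> pvars V" if "x \<in> pvars V" for x :: "('a, 'n) mpoly"
    using that by (simp add: pvars_def in_keys_iff)
  moreover have "1 \<in> (pvars V :: ('a, 'n) mpoly set)"
    by (simp add: pvars_def)
  ultimately show ?thesis by (simp add: subring1_def)
qed

lemma pvars_mono: "V \<subseteq> W \<Longrightarrow> pvars V \<subseteq> pvars W"
  unfolding pvars_def by auto

lemma pvars_UNIV [simp]: "pvars UNIV = UNIV"
  unfolding pvars_def by auto

lemma mvar_in_pvars: "k \<in> V \<Longrightarrow> mvar k \<in> pvars V"
  by (auto simp: pvars_def mvar_def lookup_single when_def)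

lemma mconst_in_pvars: "mconst a \<in> pvars V"
  by (auto simp: pvars_def)

text \<open>Sorting monomials by their exponent of \<open>v\<close> exhibits the larger ring as an
  image of the univariate polynomial ring over \<open>pvars V\<close>. An image is enough to
  transfer the Noetherian property.\<close>

lemma pvars_insert:
  fixes v :: "'n::finite"
  shows "pvars (insert v V) = (\<lambda>P. poly P (mvar v :: ('a::comm_ring_1, 'n) mpoly)) ` poly_over (pvars V)"
proof (intro equalityI subsetI)
  fix p :: "('a, 'n) mpoly" assume p: "p \<in> pvars (insert v V)"
  let ?m0 = "\<lambda>m. m - single v (lookup m v)"
  let ?P = "\<Sum>m\<in>keys p. monom (single (?m0 m) (lookup p m)) (lookup m v)"
  have pw: "mvar v ^ j = single (single v j) (1::'a)" for j
    by (induction j) (simp_all add: mvar_def mult_single single_add[symmetric])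
  have m: "?m0 m + single v (lookup m v) = m" for m :: "'n \<Rightarrow>\<^sub>0 nat"
    by (rule poly_mapping_eqI) (auto simp: lookup_add lookup_minus lookup_single when_def)
  have "poly ?P (mvar v) = (\<Sum>m\<in>keys p. single m (lookup p m))"
    by (simp add: poly_sum poly_monom pw mult_single m)
  then have "poly ?P (mvar v) = p" using mpoly_sum_single[of p] by simp
  moreover have "single (?m0 m) (lookup p m) \<in> pvars V"
    if "m \<in> keys p" for m
    unfolding pvars_def
  proof (intro CollectI ballI allI impI)
    fix m' k assume "m' \<in> keys (single (?m0 m) (lookup p m))" "k \<notin> V"
    then have "m' = ?m0 m" and "k = v \<or> lookup m k = 0"
      using p that by (auto simp: pvars_def split: if_splits) (metis neq0_conv)
    then show "lookup m' k = 0" by (auto simp: lookup_minus lookup_single)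
  qed
  then have "monom (single (?m0 m) (lookup p m)) (lookup m v) \<in> poly_over (pvars V)"
    if "m \<in> keys p" for m
    using that subring1D(2)[OF subring1_pvars, of V] by (auto simp only: coeff_monom mem_Collect_eq split: if_split)
  then have "?P \<in> poly_over (pvars V)"
    by (rule subring1_sum[OF subring1_poly_over[OF subring1_pvars]])
  ultimately show "p \<in> (\<lambda>P. poly P (mvar v)) ` poly_over (pvars V)" by (intro image_eqI[where x = ?P]) simp_all
next
  fix p :: "('a, 'n) mpoly" assume "p \<in> (\<lambda>P. poly P (mvar v)) ` poly_over (pvars V)"
  then obtain P where P: "p = poly P (mvar v)" "\<And>i. coeff P i \<in> pvars V" by auto
  show "p \<in> pvars (insert v V)"
    unfolding P(1) poly_altdef
    using P(2) pvars_mono[of V "insert v V"]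
    by (intro subring1_sum[OF subring1_pvars] subring1D[OF subring1_pvars] mvar_in_pvars) auto
qed

lemma pvars_empty:
  assumes "p \<in> pvars {}"
  shows "p = mconst (lookup p 0)"
proof (rule poly_mapping_eqI)
  fix m
  have "m = 0" if "lookup p m \<noteq> 0"
    using assms that by (intro poly_mapping_eqI) (auto simp: pvars_def in_keys_iff)
  then show "lookup p m = lookup (mconst (lookup p 0)) m"
    by (auto simp: lookup_single when_def)
qed

lemma noeth_pvars: "noeth (pvars V :: ('k::field, 'n::finite) mpoly set)"
proof -
  have "finite V" by simp
  then show ?thesis
  proof induction
    case empty
    show ?case
      unfolding noeth_def
    proof (intro allI impI)
      fix S :: "('k, 'n) mpoly set" assume S: "S \<subseteq> pvars {}"
      show "\<exists>F\<subseteq>S. finite F \<and> S \<subseteq> ispan (pvars {}) F"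
      proof (cases "S \<subseteq> {0}")
        case True
        then show ?thesis by (intro exI[of _ "{}"]) (auto intro: ispan_zero)
      next
        case False
        then obtain s where s: "s \<in> S" "s \<noteq> 0" by auto
        have s0: "s = mconst (lookup s 0)" using pvars_empty S s by blast
        then have nz: "lookup s 0 \<noteq> 0" using s(2) by auto
        have "t \<in> ispan (pvars {}) {s}" if "t \<in> S" for t
        proof -
          have "t = mconst (lookup t 0)" using pvars_empty S that by blast
          also have "\<dots> = mconst (lookup t 0 / lookup s 0) * mconst (lookup s 0)"
            using nz by (simp add: mult_single)
          finally have "t = mconst (lookup t 0 / lookup s 0) * s + 0" using s0 by simp
          then show ?thesis using ispan_step[OF ispan_zero, OF mconst_in_pvars] by (metis insertI1)
        qed
        then show ?thesis using s by (intro exI[of _ "{s}"]) auto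
      qed
    qed
  next
    case (insert v V)
    then show ?case
      unfolding pvars_insert by (intro noeth_image rhom_poly noeth_poly_over subring1_pvars)
  qed
qed

section \<open>Hilbert's Nullstellensatz\<close>

lemma meval_const: "meval x (mconst a) = a"
  unfolding meval_def by (rule msubst_const[OF rhom_id])

lemma meval_var: "meval x (mvar k) = x k"
  unfolding meval_def by (rule msubst_var[OF rhom_id])

text \<open>Ideals of the ring formed by a whole type, in contrast to the record-based ideals of the
  chart rings.\<close>

definition is_ideal :: "'a::comm_ring_1 set \<Rightarrow> bool" where
  "is_ideal I \<longleftrightarrow> 0 \<in> I \<and> (\<forall>x\<in>I. \<forall>y\<in>I. x + y \<in> I) \<and> (\<forall>a. \<forall>x\<in>I. a * x \<in> I)"

lemma is_idealD:
  assumes "is_ideal I"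
  shows "0 \<in> I" "x \<in> I \<Longrightarrow> y \<in> I \<Longrightarrow> x + y \<in> I" "x \<in> I \<Longrightarrow> a * x \<in> I" "x \<in> I \<Longrightarrow> y \<in> I \<Longrightarrow> x - y \<in> I"
proof -
  show "0 \<in> I" and add: "x \<in> I \<Longrightarrow> y \<in> I \<Longrightarrow> x + y \<in> I" and mult: "x \<in> I \<Longrightarrow> a * x \<in> I" for x y a
    using assms unfolding is_ideal_def by auto
  show "x \<in> I \<Longrightarrow> y \<in> I \<Longrightarrow> x - y \<in> I"
    using add[of x "- 1 * y"] mult[of y "- 1"] by simp
qed

lemma is_ideal_sum: "is_ideal I \<Longrightarrow> (\<And>i. i \<in> A \<Longrightarrow> f i \<in> I) \<Longrightarrow> sum f A \<in> I"
  by (induction A rule: infinite_finite_induct) (auto intro: is_idealD)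

text \<open>Division by the monic \<open>G\<close> shows that \<open>S[t]/J\<close> is a finite \<open>S\<close>-module; then Nakayama's lemma
  is proved by removing one generator \<open>t\<^sup>j\<close> at a time.\<close>

lemma lying_over:
  fixes \<chi> :: "'s::comm_ring_1 \<Rightarrow> 'k::comm_ring_1" and J :: "'s poly set"
  assumes J: "is_ideal J" and \<chi>: "rhom \<chi>" and ne: "(1::'k) \<noteq> 0"
    and G: "G \<in> J" "lead_coeff G = 1"
    and contract: "\<And>s. [:s:] \<in> J \<Longrightarrow> \<chi> s = 0"
    and P: "P \<in> J"
  shows "map_poly \<chi> P \<noteq> 1"
proof
  assume P1: "map_poly \<chi> P = 1"
  interpret \<chi>: rhom \<chi> by fact
  note JD = is_idealD[OF J]
  define e where "e = degree G"
  have smJ: "Q \<in> J \<Longrightarrow> smult a Q \<in> J" for Q a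
    using JD(3)[of Q "[:a:]"] by simp
  have division: "\<exists>L. (\<forall>i\<ge>e. coeff L i = 0) \<and> H - L \<in> J" if "\<forall>i\<ge>n. coeff H i = 0" for H n
    using that
  proof (induction n arbitrary: H)
    case 0
    then have "H = 0" by (simp add: poly_eq_iff)
    then show ?case by (intro exI[of _ 0]) (simp add: JD)
  next
    case (Suc n)
    show ?case
    proof (cases "Suc n \<le> e")
      case True
      then show ?thesis using Suc.prems by (intro exI[of _ H]) (simp add: JD)
    next
      case False
      let ?K = "monom (coeff H n) (n - e) * G"
      have "coeff (H - ?K) i = 0" if "i \<ge> n" for i
      proof (cases "i = n")
        case True
        then show ?thesis using False G(2) by (simp add: coeff_monom_mult e_def)
      next
        case False
        then have "coeff G (i - (n - e)) = 0" if "n \<ge> e" using that \<open>i \<ge> n\<close> by (intro coeff_eq_0) (simp add: e_def)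
        then show ?thesis using Suc.prems \<open>i \<ge> n\<close> False \<open>\<not> Suc n \<le> e\<close> by (simp add: coeff_monom_mult)
      qed
      then obtain L where L: "\<forall>i\<ge>e. coeff L i = 0" "H - ?K - L \<in> J" using Suc.IH by blast
      have "H - L \<in> J" using JD(2)[OF L(2) JD(3)[OF G(1), of "monom (coeff H n) (n - e)"]] by simp
      then show ?thesis using L(1) by blast
    qed
  qed
  \<comment> \<open>Modulo \<open>J\<close> the element 1 equals \<open>- N\<close>, and all
    coefficients of \<open>N\<close> lie in the kernel of \<chi>. This is the hypothesis of
    Nakayama's lemma, that the module equals its multiple by the kernel.\<close>
  define N where "N = P - 1"
  have N: "\<chi> (coeff N i) = 0" for i
  proof -
    have "coeff (map_poly \<chi> P) i = coeff 1 i" using P1 by simp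
    then show ?thesis by (simp add: N_def coeff_map_poly \<chi>.hom_zero \<chi>.hom_diff coeff_1 \<chi>.hom_one)
  qed
  \<comment> \<open>For each \<open>j\<close> some \<open>s\<close> with value 1 under \<chi>
    multiplies every polynomial into the span of the powers of \<open>t\<close> below
    \<open>j\<close>, modulo \<open>J\<close>. Division by \<open>G\<close> gives
    \<open>j = e\<close> with \<open>s = 1\<close>; at \<open>j = 0\<close> the constant
    \<open>s\<close> itself lies in \<open>J\<close>.\<close>
  have "\<exists>s. \<chi> s = 1 \<and> (\<forall>H. \<exists>L. (\<forall>i\<ge>j. coeff L i = 0) \<and> smult s H - L \<in> J)" if "j + d = e" for j d
    using that
  proof (induction d arbitrary: j)
    case 0
    have "\<exists>L. (\<forall>i\<ge>j. coeff L i = 0) \<and> smult 1 H - L \<in> J" for H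
      using division[of "Suc (degree H)" H] 0 by (auto simp: coeff_eq_0)
    then show ?case using \<chi>.hom_one by blast
  next
    case (Suc d)
    obtain s where s: "\<chi> s = 1" and sH: "\<And>H. \<exists>L. (\<forall>i\<ge>Suc j. coeff L i = 0) \<and> smult s H - L \<in> J"
      using Suc.IH[of "Suc j"] Suc.prems by auto
    obtain R where R: "\<And>H i. i \<ge> Suc j \<Longrightarrow> coeff (R H) i = 0" "\<And>H. smult s H - R H \<in> J"
      using sH by metis
    define M where "M = monom 1 j * N"
    define L where "L = (\<Sum>i\<le>degree M. smult (coeff M i) (R (monom 1 i)))"
    have "\<chi> (coeff M i) = 0" for i by (simp add: M_def coeff_monom_mult N \<chi>.hom_zero)
    then have L0: "\<chi> (coeff L i) = 0" for i
      by (simp add: L_def coeff_sum \<chi>.hom_sum \<chi>.hom_mult)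
    have L1: "coeff L i = 0" if "i \<ge> Suc j" for i using that by (simp add: L_def coeff_sum R(1))
    have "M = (\<Sum>i\<le>degree M. smult (coeff M i) (monom 1 i))"
      by (simp add: smult_monom poly_as_sum_of_monoms)
    then have "smult s M = smult s (\<Sum>i\<le>degree M. smult (coeff M i) (monom 1 i))"
      by simp
    also have "\<dots> = (\<Sum>i\<le>degree M. smult (coeff M i) (smult s (monom 1 i)))"
      by (rule poly_eqI) (simp only: coeff_sum coeff_smult sum_distrib_left mult.left_commute)
    finally have "smult s M - L = (\<Sum>i\<le>degree M. smult (coeff M i) (smult s (monom 1 i) - R (monom 1 i)))"
      unfolding L_def by (simp only: sum_subtractf[symmetric] smult_diff_right)
    also have "\<dots> \<in> J" by (intro is_ideal_sum[OF J] smJ R(2))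
    finally have "smult s (monom 1 j * P) - (smult s M - L) \<in> J"
      by (rule JD(4)[OF smJ[OF JD(3)[OF P]]])
    \<comment> \<open>Modulo \<open>J\<close> the monomial \<open>t ^ j\<close> equals minus
      \<open>t ^ j * N\<close>. Rewriting the latter through \<open>R\<close> gives a relation in
      which \<open>s + m\<close> multiplies \<open>t ^ j\<close> and all other powers are lower; as
      \<open>m\<close> lies in the kernel of \<chi>, the factor \<open>s + m\<close> keeps the value
      1.\<close>
    then have key: "smult s (monom 1 j) + L \<in> J"
      by (simp add: M_def N_def algebra_simps smult_diff_right)
    define m where "m = coeff L j"
    have "\<exists>L'. (\<forall>i\<ge>j. coeff L' i = 0) \<and> smult ((s + m) * s) H - L' \<in> J" for H
    proof -
      define l where "l = coeff (R H) j"
      define L' where "L' = smult (s + m) (R H - monom l j) - smult l (L - monom m j)"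
      have "coeff L' i = 0" if "i \<ge> j" for i
        using that R(1)[of i H] L1[of i] by (cases "i = j") (auto simp: L'_def l_def m_def coeff_monom)
      moreover have "smult ((s + m) * s) H - L' = smult (s + m) (smult s H - R H) + smult l (smult s (monom 1 j) + L)"
        by (rule poly_eqI) (simp add: L'_def coeff_monom algebra_simps)
      then have "smult ((s + m) * s) H - L' \<in> J" using JD(2)[OF smJ[OF R(2)] smJ[OF key]] by metis
      ultimately show ?thesis by blast
    qed
    moreover have "\<chi> ((s + m) * s) = 1" using L0 s by (simp add: \<chi>.hom_simps m_def)
    ultimately show ?case by blast
  qed
  from this[of 0 e] obtain s where s: "\<chi> s = 1" "\<And>H. \<exists>L. (\<forall>i. coeff L i = 0) \<and> smult s H - L \<in> J" by auto
  obtain L where "\<forall>i. coeff L i = 0" "smult s 1 - L \<in> J" using s(2) by blast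
  moreover from this have "L = 0" by (intro poly_eqI) simp
  ultimately have "[:s:] \<in> J" by simp
  then show False using contract s(1) ne by metis
qed

text \<open>A nonzero element of least degree generates \<open>J\<close>, and it is not constant
  because \<open>J\<close> is proper, so any root of it is a common zero.\<close>

lemma proper_poly_ideal_root:
  fixes J :: "'k::alg_closed_field poly set"
  assumes J: "is_ideal J" and "1 \<notin> J" and "h1 \<in> J" "h1 \<noteq> 0"
  shows "\<exists>b. \<forall>h\<in>J. poly h b = 0"
proof -
  define h0 where "h0 = arg_min degree (\<lambda>h. h \<in> J \<and> h \<noteq> 0)"
  have h0: "h0 \<in> J" "h0 \<noteq> 0"
    using arg_min_natI[of "\<lambda>h. h \<in> J \<and> h \<noteq> 0" h1 degree] assms unfolding h0_def by auto
  have min: "degree h0 \<le> degree h" if "h \<in> J" "h \<noteq> 0" for h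
    using arg_min_nat_le[of "\<lambda>h. h \<in> J \<and> h \<noteq> 0" h degree] that unfolding h0_def by auto
  have dvd: "h0 dvd h" if "h \<in> J" for h
  proof -
    have "h - h div h0 * h0 \<in> J" using is_idealD[OF J] that h0 by blast
    then have "h mod h0 \<in> J" by (simp add: minus_div_mult_eq_mod)
    then have "h mod h0 = 0" using min[of "h mod h0"] degree_mod_less[of h0 h] h0 by fastforce
    then show ?thesis by (simp add: mod_eq_0_iff_dvd)
  qed
  have "degree h0 > 0"
  proof (rule ccontr)
    assume "\<not> degree h0 > 0"
    then obtain a where a: "h0 = [:a:]" using degree_eq_zeroE by blast
    then have "[:inverse a:] * h0 = 1" using h0 by (simp add: one_pCons)
    then show False using is_idealD(3)[OF J h0(1), of "[:inverse a:]"] assms(2) by simp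
  qed
  then obtain b where "poly h0 b = 0" using alg_closed_imp_poly_has_root by blast
  then have "poly h b = 0" if "h \<in> J" for h using dvd[OF that] by (metis dvdE mult_zero_left poly_mult)
  then show ?thesis by blast
qed

section \<open>Monic polynomials and weights for Noether normalisation\<close>

definition monic_deg :: "'a::comm_ring_1 poly \<Rightarrow> nat \<Rightarrow> bool" where
  "monic_deg P d \<longleftrightarrow> coeff P d = 1 \<and> degree P \<le> d"

lemma monic_deg_mult:
  assumes "monic_deg P d" "monic_deg Q e"
  shows "monic_deg (P * Q) (d + e)"
proof -
  have "degree (P * Q) \<le> d + e"
    using degree_mult_le[of P Q] assms unfolding monic_deg_def by linarith
  moreover have "coeff (P * Q) (d + e) = (\<Sum>i\<in>{d}. coeff P i * coeff Q (d + e - i))"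
    unfolding coeff_mult
  proof (rule sum.mono_neutral_right)
    show "\<forall>i\<in>{..d + e} - {d}. coeff P i * coeff Q (d + e - i) = 0"
    proof
      fix i assume "i \<in> {..d + e} - {d}"
      then have "i > d \<or> d + e - i > e" by auto
      then show "coeff P i * coeff Q (d + e - i) = 0"
        using assms unfolding monic_deg_def by (auto simp: coeff_eq_0)
    qed
  qed auto
  ultimately show ?thesis using assms unfolding monic_deg_def by simp
qed

lemma monic_deg_1: "monic_deg 1 0"
  by (simp add: monic_deg_def)

lemma monic_deg_power: "monic_deg P d \<Longrightarrow> monic_deg (P ^ n) (n * d)"
  by (induction n) (auto simp: monic_deg_1 intro: monic_deg_mult)

lemma monic_deg_prod: "(\<And>k. k \<in> A \<Longrightarrow> monic_deg (P k) (d k)) \<Longrightarrow> monic_deg (prod P A) (sum d A)"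
  by (induction A rule: infinite_finite_induct) (auto simp: monic_deg_1 intro: monic_deg_mult)

text \<open>Take \<open>w k = N ^ idx k\<close>. For two distinct monomials the difference of their
  weights is the value at \<open>N\<close> of a nonzero integer polynomial, and \<open>N\<close>
  avoids the finitely many roots of all of these. Index 0 for \<open>v\<close> gives
  \<open>w v = 1\<close>, the degree that the variable \<open>v\<close> gets when it becomes
  \<open>t\<close> in the normalisation.\<close>

lemma separating_weights:
  fixes S :: "('n::finite \<Rightarrow>\<^sub>0 nat) set"
  assumes "finite S"
  shows "\<exists>w. w v = 1 \<and> (\<forall>k. w k \<ge> 1) \<and> inj_on (\<lambda>m. \<Sum>k\<in>UNIV. lookup m k * w k) S"
proof -
  obtain i0 :: "'n \<Rightarrow> nat" where i0: "inj i0" using finite_imp_inj_to_nat_seg[of "UNIV :: 'n set"] by auto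
  define idx where "idx k = (if k = v then 0 else Suc (i0 k))" for k
  have idx: "idx k = idx l \<longleftrightarrow> k = l" for k l using i0 by (auto simp: idx_def inj_eq)
  define q where "q mm = (case mm of (m, m') \<Rightarrow>
     \<Sum>k\<in>UNIV. monom (int (lookup m k) - int (lookup m' k)) (idx k))" for mm
  define T where "T = {mm \<in> S \<times> S. fst mm \<noteq> snd mm}"
  have "q mm \<noteq> 0" if mm: "mm \<in> T" for mm
  proof -
    obtain m m' where m: "mm = (m, m')" "m \<noteq> m'" using mm by (cases mm) (auto simp: T_def)
    then obtain l where l: "lookup m l \<noteq> lookup m' l" by (metis poly_mapping_eqI)
    have "coeff (q mm) (idx l) = int (lookup m l) - int (lookup m' l)"
      by (simp add: q_def m coeff_sum coeff_monom idx)
    with l show ?thesis by auto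
  qed
  then have "finite (\<Union>mm\<in>T. {x. poly (q mm) x = 0})"
    using assms by (intro finite_UN_I poly_roots_finite) (auto simp: T_def)
  then have "finite (insert 0 (int -` (\<Union>mm\<in>T. {x. poly (q mm) x = 0})))"
    by (simp add: finite_vimageI)
  then obtain N :: nat where N: "N \<noteq> 0" "\<And>mm. mm \<in> T \<Longrightarrow> poly (q mm) (int N) \<noteq> 0"
    using ex_new_if_finite[OF infinite_UNIV_nat, of "insert 0 (int -` (\<Union>mm\<in>T. {x. poly (q mm) x = 0}))"] by auto
  have "inj_on (\<lambda>m. \<Sum>k\<in>UNIV. lookup m k * N ^ idx k) S"
  proof (rule inj_onI, rule ccontr)
    fix m m' assume m: "m \<in> S" "m' \<in> S" "m \<noteq> m'"
      and eq: "(\<Sum>k\<in>UNIV. lookup m k * N ^ idx k) = (\<Sum>k\<in>UNIV. lookup m' k * N ^ idx k)"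
    have "int (\<Sum>k\<in>UNIV. lookup m k * N ^ idx k) = int (\<Sum>k\<in>UNIV. lookup m' k * N ^ idx k)"
      using eq by simp
    then have "poly (q (m, m')) (int N) = 0"
      by (simp add: q_def poly_sum poly_monom left_diff_distrib sum_subtractf)
    then show False using N(2)[of "(m, m')"] m by (simp add: T_def)
  qed
  then show ?thesis using N(1) by (intro exI[of _ "\<lambda>k. N ^ idx k"]) (auto simp: idx_def)
qed

lemma msubst_in_subring:
  fixes A :: "'a::comm_ring_1 set" and x :: "'n::finite \<Rightarrow> 'a"
  assumes "subring1 A" "\<And>a. c a \<in> A" "\<And>k. x k \<in> A"
  shows "msubst c x F \<in> A"
proof -
  note A = subring1D[OF assms(1)]
  have pr: "prod g B \<in> A" if "\<And>k. g k \<in> A" for g :: "'n \<Rightarrow> 'a" and B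
    by (induction B rule: infinite_finite_induct) (auto intro: A that)
  have "(\<Prod>i\<in>UNIV. x i ^ lookup m i) \<in> A" for m by (rule pr) (rule A(6)[OF assms(3)])
  then show ?thesis unfolding msubst_def using assms(2) by (intro subring1_sum[OF assms(1)] A(4))
qed

text \<open>When there are no relations the origin serves as the required point: putting 0 for the
  variables outside \<open>V\<close> does not change the value at \<open>y\<close>, and the
  resulting relation is the zero polynomial.\<close>

lemma independent_zero:
  fixes y :: "'n::finite \<Rightarrow> 'a::comm_ring_1" and c :: "'k::comm_ring_1 \<Rightarrow> 'a"
  assumes c: "rhom c" and y: "\<And>k. k \<notin> V \<Longrightarrow> y k = 0"
    and indep: "\<And>p. p \<in> pvars V \<Longrightarrow> msubst c y p \<in> I \<Longrightarrow> p = 0"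
    and p: "msubst c y p \<in> I"
  shows "meval (\<lambda>_. 0) p = 0"
proof -
  let ?x = "\<lambda>k. if k \<in> V then mvar k else (0 :: ('k, 'n) mpoly)"
  let ?q = "msubst mconst ?x p"
  have "?q \<in> pvars V"
    by (rule msubst_in_subring[OF subring1_pvars])
       (auto intro: mconst_in_pvars mvar_in_pvars subring1D[OF subring1_pvars])
  moreover have "msubst c y ?q = msubst c y p"
    unfolding rhom_msubst_comp[OF rhom_msubst[OF c] rhom_mconst]
    by (rule msubst_cong) (auto simp: msubst_const[OF c] msubst_var[OF c] y rhom.hom_zero[OF rhom_msubst[OF c]])
  ultimately have "?q = 0" using indep p by metis
  moreover have "meval (\<lambda>_. 0) ?q = meval (\<lambda>_. 0) p"
    unfolding rhom_msubst_comp[OF rhom_meval rhom_mconst] unfolding meval_def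
    by (rule msubst_cong) (auto simp: msubst_const[OF rhom_id] msubst_var[OF rhom_id] rhom.hom_zero[OF rhom_msubst[OF rhom_id]])
  ultimately show ?thesis by (simp add: rhom.hom_zero[OF rhom_meval])
qed

text \<open>Noether normalisation: if the \<open>y k\<close> are dependent modulo \<open>I\<close>, then \<open>y v\<close> is integral modulo
  \<open>I\<close> over the subalgebra generated by the \<open>y k - y v ^ w k\<close>, for suitable weights \<open>w\<close>.\<close>

lemma algebra_point:
  fixes y :: "'n::finite \<Rightarrow> 'a::comm_ring_1" and c :: "'k::alg_closed_field \<Rightarrow> 'a"
  assumes c: "rhom c" and I: "is_ideal I" "1 \<notin> I"
    and y: "\<And>k. k \<notin> V \<Longrightarrow> y k = 0"
  shows "\<exists>a. \<forall>p. msubst c y p \<in> I \<longrightarrow> meval a p = 0"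
proof -
  have "finite V" by simp
  then show ?thesis using y
  proof (induction arbitrary: y)
    case empty
    \<comment> \<open>A relation without variables is a constant, and a nonzero one would put 1 into
      \<open>I\<close>.\<close>
    have "p = 0" if p: "p \<in> pvars {}" and pI: "msubst c y p \<in> I" for p
    proof -
      note p0 = pvars_empty[OF p]
      have "c (lookup p 0) \<in> I"
        using pI p0 msubst_const[OF c, of y "lookup p 0"] by metis
      then have "c (inverse (lookup p 0)) * c (lookup p 0) \<in> I"
        by (rule is_idealD[OF I(1)])
      then have "c (inverse (lookup p 0) * lookup p 0) \<in> I"
        by (simp only: rhom.hom_mult[OF c])
      then have "lookup p 0 = 0"
        using I(2) by (metis left_inverse rhom.hom_one[OF c])
      then show "p = 0" using p0 by simp
    qed
    from independent_zero[where V = "{}" and y = y and c = c and I = I, OF c empty.prems this]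
    show ?case by blast
  next
    case (insert v V)
    show ?case
    proof (cases "\<forall>p\<in>pvars (insert v V). msubst c y p \<in> I \<longrightarrow> p = 0")
      case True
      then show ?thesis using independent_zero[where V = "insert v V" and y = y and c = c and I = I, OF c insert.prems] by blast
    next
      case False
      then obtain f where f: "f \<in> pvars (insert v V)" "f \<noteq> 0" "msubst c y f \<in> I" by blast
      obtain w where wv: "w v = 1" and w1: "\<And>k. w k \<ge> 1"
        and winj: "inj_on (\<lambda>m. \<Sum>k\<in>UNIV. lookup m k * w k) (keys f)"
        using separating_weights[of "keys f" v] by auto
      \<comment> \<open>The index \<open>v\<close> is dropped, so the induction hypothesis for
        \<open>V\<close> applies; \<open>y v\<close> returns as a root, modulo \<open>I\<close>, of
        a monic polynomial over the \<open>z k\<close>.\<close>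
      define z where "z k = (if k \<in> V then y k - y v ^ w k else 0)" for k
      have "\<exists>a. \<forall>p. msubst c z p \<in> I \<longrightarrow> meval a p = 0" by (rule insert.IH) (simp add: z_def)
      then obtain a' where a': "\<And>p. msubst c z p \<in> I \<Longrightarrow> meval a' p = 0" by blast
      \<comment> \<open>\<open>W k\<close> writes \<open>y k\<close> as a polynomial in
        \<open>t = y v\<close> whose coefficients are polynomials in the \<open>z k\<close>.
        \<open>toP\<close> applies this to every polynomial in the \<open>y k\<close>, and
        \<open>E\<close> evaluates the result, so that \<open>E (toP p)\<close> is \<open>p\<close>
        at \<open>y\<close>.\<close>
      define W :: "'n \<Rightarrow> ('k, 'n) mpoly poly" where
        "W k = (if k = v then monom 1 1 else if k \<in> V then [:mvar k:] + monom 1 (w k) else 0)" for k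
      define C :: "'k \<Rightarrow> ('k, 'n) mpoly poly" where "C a = [:mconst a:]" for a
      have C: "rhom C" unfolding C_def by (rule rhom_comp[OF rhom_const_poly rhom_mconst])
      define toP where "toP = msubst C W"
      define E where "E P = poly (map_poly (msubst c z) P) (y v)" for P
      have rz: "rhom (msubst c z)" by (rule rhom_msubst[OF c])
      have E: "rhom E" unfolding E_def by (rule rhom_comp[OF rhom_poly rhom_map_poly[OF rz]])
      interpret E: rhom E by (rule E)
      have Ec: "E [:p:] = msubst c z p" for p
        by (simp add: E_def map_poly_pCons rhom.hom_zero[OF rz])
      have Em: "E (monom 1 i) = y v ^ i" for i
        by (simp add: E_def map_poly_monom rhom.hom_zero[OF rz] rhom.hom_one[OF rz] poly_monom)
      have EtoP: "E (toP p) = msubst c y p" for p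
        unfolding toP_def rhom_msubst_comp[OF E C]
      proof (rule msubst_cong)
        show "E (C a) = c a" for a by (simp add: C_def Ec msubst_const[OF c])
        show "E (W k) = y k" for k
          using insert.prems[of k] by (auto simp: W_def E.hom_add Ec Em E.hom_zero msubst_var[OF c] z_def simp del: One_nat_def)
      qed
      define J where "J = {P. E P \<in> I}"
      have J: "is_ideal J"
        unfolding is_ideal_def J_def by (auto simp: E.hom_simps intro: is_idealD[OF I(1)])
      have \<chi>: "rhom (map_poly (meval a'))" by (rule rhom_map_poly[OF rhom_meval])
      interpret \<chi>: rhom "map_poly (meval a')" by (rule \<chi>)
      \<comment> \<open>Under the substitution each monomial of \<open>f\<close> becomes monic of
        degree its weight, and the weights are distinct. So the leading term of \<open>toP f\<close>
        comes from a single monomial, and its coefficient is a constant of the field.\<close>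
      define Wm where "Wm m = (\<Prod>k\<in>UNIV. W k ^ lookup m k)" for m
      define wt where "wt m = (\<Sum>k\<in>UNIV. lookup m k * w k)" for m
      have mono: "monic_deg (Wm m) (wt m)" if "m \<in> keys f" for m
        unfolding wt_def Wm_def
      proof (rule monic_deg_prod)
        fix k
        show "monic_deg (W k ^ lookup m k) (lookup m k * w k)"
        proof (cases "k \<in> insert v V")
          case True
          have "degree ([:mvar k:] + monom 1 (w k)) \<le> w k" by (intro degree_add_le degree_monom_le) simp
          then have "monic_deg (W k) (w k)"
            using True wv w1[of k] by (auto simp: W_def monic_deg_def coeff_monom degree_monom_le coeff_pCons split: nat.split)
          then show ?thesis by (rule monic_deg_power)
        next
          case False
          then have "lookup m k = 0" using f(1) that by (auto simp: pvars_def)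
          then show ?thesis by (simp add: monic_deg_1)
        qed
      qed
      have "finite (wt ` keys f)" "wt ` keys f \<noteq> {}" using f(2) by auto
      then obtain m0 where m0: "m0 \<in> keys f" and "wt m0 = Max (wt ` keys f)"
        using Max_in by (metis imageE)
      then have m0max: "wt m \<le> wt m0" if "m \<in> keys f" for m using that by simp
      define a0 where "a0 = lookup f m0"
      have a0: "a0 \<noteq> 0" using m0 by (simp add: a0_def in_keys_iff)
      define G where "G = C (inverse a0) * toP f"
      have cf: "coeff (toP f) i = (\<Sum>m\<in>keys f. mconst (lookup f m) * coeff (Wm m) i)" for i
        by (simp add: toP_def msubst_def C_def Wm_def coeff_sum)
      have c0: "coeff (toP f) (wt m0) = mconst a0"
      proof -
        have "coeff (toP f) (wt m0) = (\<Sum>m\<in>{m0}. mconst (lookup f m) * coeff (Wm m) (wt m0))"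
          unfolding cf
        proof (rule sum.mono_neutral_right)
          show "\<forall>m\<in>keys f - {m0}. mconst (lookup f m) * coeff (Wm m) (wt m0) = 0"
          proof
            fix m assume m: "m \<in> keys f - {m0}"
            then have "wt m \<noteq> wt m0" using winj m0 unfolding wt_def inj_on_def by blast
            then have "wt m < wt m0" using m0max[of m] m by simp
            then show "mconst (lookup f m) * coeff (Wm m) (wt m0) = 0"
              using mono[of m] m by (simp add: monic_deg_def coeff_eq_0)
          qed
        qed (use m0 in auto)
        also have "\<dots> = mconst a0" using mono[OF m0] by (simp add: a0_def monic_deg_def)
        finally show ?thesis .
      qed
      have ci: "coeff (toP f) i = 0" if "i > wt m0" for i
        unfolding cf
      proof (intro sum.neutral ballI)
        fix m assume m: "m \<in> keys f"
        then show "mconst (lookup f m) * coeff (Wm m) i = 0"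
          using mono[OF m] m0max[OF m] that by (simp add: monic_deg_def coeff_eq_0)
      qed
      have G1: "coeff G (wt m0) = 1" using a0 by (simp add: G_def C_def c0 mult_single)
      have G2: "coeff G i = 0" if "i > wt m0" for i using that by (simp add: G_def C_def ci)
      have "degree G = wt m0"
        using G1 G2 by (intro order_antisym degree_le le_degree) auto
      then have Glead: "lead_coeff G = 1" using G1 by simp
      have GJ: "G \<in> J" unfolding J_def G_def
        by (simp add: E.hom_mult EtoP is_idealD[OF I(1)] f)
      \<comment> \<open>Since \<open>a'\<close> is a common zero of the relations among the
        \<open>z k\<close>, evaluation at \<open>a'\<close> kills the constants contained in
        \<open>J\<close>, as \<open>lying_over\<close> requires.\<close>
      have contract: "meval a' s = 0" if "[:s:] \<in> J" for s using that a' by (simp add: J_def Ec)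
      have proper: "map_poly (meval a') P \<noteq> 1" if "P \<in> J" for P
        by (rule lying_over[OF J rhom_meval _ GJ Glead contract that]) simp_all
      \<comment> \<open>Over the point \<open>a'\<close> the ideal \<open>J\<close> becomes an ideal
        of univariate polynomials over the field. It is proper and contains the monic image of
        \<open>G\<close>, so it has a common root \<open>b\<close>, the value for
        \<open>y v\<close>.\<close>
      define J' where "J' = map_poly (meval a') ` J"
      have J': "is_ideal J'"
        unfolding is_ideal_def
      proof (intro conjI ballI allI)
        show "0 \<in> J'" using is_idealD(1)[OF J] \<chi>.hom_zero unfolding J'_def by force
        show "x + y \<in> J'" if "x \<in> J'" "y \<in> J'" for x y
          using that is_idealD(2)[OF J] unfolding J'_def by (auto simp: \<chi>.hom_add[symmetric])
        show "h * x \<in> J'" if x: "x \<in> J'" for h x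
        proof -
          obtain Q where Q: "x = map_poly (meval a') Q" "Q \<in> J" using x unfolding J'_def by blast
          have "map_poly (meval a') (map_poly mconst h) = h"
            by (rule poly_eqI) (simp add: coeff_map_poly rhom.hom_zero[OF rhom_meval] meval_const)
          then have "h * x = map_poly (meval a') (map_poly mconst h * Q)" by (simp add: \<chi>.hom_mult Q)
          then show ?thesis using is_idealD(3)[OF J Q(2)] unfolding J'_def by blast
        qed
      qed
      have "1 \<notin> J'" using proper unfolding J'_def by force
      moreover have "map_poly (meval a') G \<in> J'" using GJ unfolding J'_def by blast
      moreover have "coeff (map_poly (meval a') G) (wt m0) = 1"
        using G1 by (simp add: coeff_map_poly rhom.hom_zero[OF rhom_meval] rhom.hom_one[OF rhom_meval])
      then have "map_poly (meval a') G \<noteq> 0" by force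
      ultimately obtain b where b: "\<And>h. h \<in> J' \<Longrightarrow> poly h b = 0"
        using proper_poly_ideal_root[OF J'] by blast
      \<comment> \<open>This inverts \<open>z k = y k - y v ^ w k\<close> at the point
        found.\<close>
      define a where "a k = (if k = v then b else if k \<in> V then a' k + b ^ w k else 0)" for k
      define ev where "ev P = poly (map_poly (meval a') P) b" for P
      have ev: "rhom ev" unfolding ev_def by (rule rhom_comp[OF rhom_poly \<chi>])
      have evtoP: "ev (toP p) = meval a p" for p
        unfolding toP_def rhom_msubst_comp[OF ev C] unfolding meval_def
      proof (rule msubst_cong)
        have evc: "ev [:p:] = meval a' p" for p
          by (simp add: ev_def map_poly_pCons rhom.hom_zero[OF rhom_meval])
        have evm: "ev (monom 1 i) = b ^ i" for i
          by (simp add: ev_def map_poly_monom rhom.hom_zero[OF rhom_meval] rhom.hom_one[OF rhom_meval] poly_monom)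
        show "ev (C x) = x" for x
          by (simp add: C_def evc meval_const)
        show "ev (W k) = a k" for k
          by (simp add: W_def rhom.hom_add[OF ev] rhom.hom_zero[OF ev] evc evm meval_var a_def del: One_nat_def)
      qed
      have "meval a p = 0" if "msubst c y p \<in> I" for p
      proof -
        have "toP p \<in> J" using that by (simp add: J_def EtoP)
        then have "ev (toP p) = 0" unfolding ev_def by (intro b) (auto simp: J'_def)
        then show ?thesis by (simp add: evtoP)
      qed
      then show ?thesis by blast
    qed
  qed
qed

text \<open>Rabinowitsch's trick: adjoin a variable \<open>t\<close> and the equation
  \<open>1 = t * g\<close>. Either this equation and \<open>Y\<close> generate the unit ideal, and
  then a power of \<open>g\<close> lies in \<open>Y\<close>, or there is a common zero, at which
  \<open>g\<close> would be both zero and invertible.\<close>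

theorem nullstellensatz:
  fixes Y :: "('k::alg_closed_field, 'n::finite) mpoly set"
  assumes Y: "is_ideal Y" and g: "\<And>x. (\<forall>p\<in>Y. meval x p = 0) \<Longrightarrow> meval x g = 0"
  shows "\<exists>k. g ^ k \<in> Y"
proof (rule ccontr)
  assume no: "\<nexists>k. g ^ k \<in> Y"
  define U where "U = 1 - [:0, g:]"
  \<comment> \<open>The ideal generated by \<open>Y\<close> and \<open>U\<close>: a multiple of
    \<open>U\<close> plus a polynomial in \<open>t\<close> with all coefficients in
    \<open>Y\<close>.\<close>
  define I where "I = {Q. \<exists>P. \<forall>n. coeff (Q - P * U) n \<in> Y}"
  note YD = is_idealD[OF Y]
  have I: "is_ideal I"
    unfolding is_ideal_def
  proof (intro conjI ballI allI)
    show "0 \<in> I" unfolding I_def by (auto intro!: exI[of _ 0] YD)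
    show "Q + R \<in> I" if QR: "Q \<in> I" "R \<in> I" for Q R
    proof -
      obtain P P' where "\<And>n. coeff (Q - P * U) n \<in> Y" "\<And>n. coeff (R - P' * U) n \<in> Y" using QR unfolding I_def by auto
      then have "coeff (Q - P * U) n + coeff (R - P' * U) n \<in> Y" for n by (intro YD)
      moreover have "Q + R - (P + P') * U = (Q - P * U) + (R - P' * U)" by (simp add: algebra_simps)
      ultimately have "coeff (Q + R - (P + P') * U) n \<in> Y" for n by (simp only: coeff_add)
      then show ?thesis unfolding I_def by blast
    qed
    show "H * Q \<in> I" if Q: "Q \<in> I" for H Q
    proof -
      obtain P where "\<And>n. coeff (Q - P * U) n \<in> Y" using Q unfolding I_def by auto
      then have "coeff (H * (Q - P * U)) n \<in> Y" for n
        unfolding coeff_mult by (intro is_ideal_sum[OF Y] YD)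
      moreover have "H * Q - (H * P) * U = H * (Q - P * U)" by (simp add: algebra_simps)
      ultimately have "coeff (H * Q - (H * P) * U) n \<in> Y" for n by (simp only:)
      then show ?thesis unfolding I_def by blast
    qed
  qed
  have "1 \<notin> I"
  proof
    assume "1 \<in> I"
    then obtain P where P: "\<And>n. coeff (1 - P * U) n \<in> Y" unfolding I_def by auto
    have U: "P * U = P - pCons 0 (smult g P)" by (simp add: U_def algebra_simps)
    \<comment> \<open>Modulo \<open>Y\<close> the factor \<open>P\<close> is an inverse of
      \<open>1 - t * g\<close>, hence the geometric series with coefficients \<open>g ^ n\<close>.
      As \<open>P\<close> is a polynomial, the power just above its degree lies in
      \<open>Y\<close>.\<close>
    have "coeff P n - g ^ n \<in> Y" for n
    proof (induction n)
      case 0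
      show ?case using YD(3)[OF P[of 0], of "- 1"] by (simp add: U coeff_1)
    next
      case (Suc n)
      have "- 1 * coeff (1 - P * U) (Suc n) + g * (coeff P n - g ^ n) \<in> Y"
        by (rule YD(2)[OF YD(3)[OF P] YD(3)[OF Suc]])
      then show ?case by (simp add: U coeff_1 algebra_simps)
    qed
    from YD(3)[OF this[of "Suc (degree P)"], of "- 1"] have "g ^ Suc (degree P) \<in> Y"
      by (simp add: coeff_eq_0)
    then show False using no by blast
  qed
  define C :: "'k \<Rightarrow> ('k, 'n) mpoly poly" where "C a = [:mconst a:]" for a
  have C: "rhom C" unfolding C_def by (rule rhom_comp[OF rhom_const_poly rhom_mconst])
  \<comment> \<open>The index \<open>None\<close> stands for the new variable
    \<open>t\<close>.\<close>
  define y :: "'n option \<Rightarrow> ('k, 'n) mpoly poly" where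
    "y j = (case j of None \<Rightarrow> monom 1 1 | Some k \<Rightarrow> [:mvar k:])" for j
  obtain a :: "'n option \<Rightarrow> 'k" where a: "\<And>p. msubst C y p \<in> I \<Longrightarrow> meval a p = 0"
    using algebra_point[OF C I \<open>1 \<notin> I\<close>, of UNIV y] by auto
  define lift :: "('k, 'n) mpoly \<Rightarrow> ('k, 'n option) mpoly" where "lift = msubst mconst (\<lambda>k. mvar (Some k))"
  have l1: "msubst C y (lift p) = [:p:]" for p
  proof -
    have "msubst C y (lift p) = msubst (\<lambda>a. [:mconst a:]) (\<lambda>k. [:mvar k:]) p"
      unfolding lift_def rhom_msubst_comp[OF rhom_msubst[OF C] rhom_mconst]
      by (rule msubst_cong) (auto simp: msubst_const[OF C] msubst_var[OF C] C_def y_def)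
    also have "\<dots> = [:msubst mconst mvar p:]" by (rule rhom_msubst_comp[OF rhom_const_poly rhom_mconst, symmetric])
    finally show ?thesis by (simp add: msubst_mvar)
  qed
  define x where "x k = a (Some k)" for k
  have l2: "meval a (lift p) = meval x p" for p
    unfolding lift_def rhom_msubst_comp[OF rhom_meval rhom_mconst] unfolding meval_def
    by (rule msubst_cong) (auto simp: msubst_const[OF rhom_id] msubst_var[OF rhom_id] x_def)
  have "meval x p = 0" if "p \<in> Y" for p
  proof -
    have "coeff ([:p:] - 0 * U) n \<in> Y" for n using that YD(1) by (cases n) auto
    then have "[:p:] \<in> I" unfolding I_def by blast
    then show ?thesis using a[of "lift p"] by (simp add: l1 l2)
  qed
  then have gx: "meval x g = 0" using g by blast
  have "msubst C y (1 - mvar None * lift g) = U"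
    unfolding U_def by (simp add: rhom.hom_simps[OF rhom_msubst[OF C]] l1 msubst_var[OF C] y_def monom_Suc monom_0 del: One_nat_def)
      (simp add: monom_Suc monom_0 mult.commute)
  moreover have "coeff (U - 1 * U) n \<in> Y" for n by (simp add: YD(1))
  then have "U \<in> I" unfolding I_def by blast
  ultimately have "meval a (1 - mvar None * lift g) = 0" by (intro a) simp
  then show False by (simp add: rhom.hom_simps[OF rhom_meval] l2 gx)
qed

section \<open>Zariski closed sets of dimension zero\<close>

lemma homogeneousI:
  assumes "\<And>m. m \<in> keys F \<Longrightarrow> mon_degree m = d"
  shows "homogeneous F"
proof (cases "keys F = {}")
  case False
  have "mon_degree ` keys F = (\<lambda>_. d) ` keys F" using assms by (intro image_cong) auto
  then have "mon_degree ` keys F = {d}" using False by (simp only: image_constant_conv if_False)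
  then have "total_degree F = d" by (simp add: total_degree_def)
  then show ?thesis using assms by (simp add: homogeneous_def)
qed (simp add: homogeneous_def)

lemma mon_degree_add: "mon_degree (m + m') = mon_degree m + mon_degree m'"
  by (simp add: mon_degree_def lookup_add sum.distrib)

lemma mvar_degree: "m \<in> keys (mvar k) \<Longrightarrow> mon_degree m = 1"
  by (auto simp: mvar_def mon_degree_def lookup_single when_def split: if_splits)

text \<open>The 2 by 2 minors of the matrix with rows \<open>x\<close> and the variables: together
  they cut out the point \<open>x\<close>, and their sizes along \<open>f\<close> measure how far
  \<open>f\<close> stays from it.\<close>

definition lin_form :: "('n \<Rightarrow> 'k::field) \<Rightarrow> 'n \<Rightarrow> 'n \<Rightarrow> ('k, 'n::finite) mpoly" where
  "lin_form x a b = mconst (x a) * mvar b - mconst (x b) * mvar a"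

lemma lin_form_degree:
  fixes x :: "'n::finite \<Rightarrow> 'k::field"
  assumes "m \<in> keys (lin_form x a b)"
  shows "mon_degree m = 1"
proof -
  have k: "mon_degree m = 1" if "m \<in> keys (mconst c * (mvar k :: ('k, 'n) mpoly))" for c k
    using that subsetD[OF keys_mult[of "mconst c" "mvar k :: ('k, 'n) mpoly"], of m] mvar_degree[of _ k]
    by (auto split: if_splits)
  have "m \<in> keys (mconst (x a) * (mvar b :: ('k, 'n) mpoly)) \<or> m \<in> keys (mconst (x b) * (mvar a :: ('k, 'n) mpoly))"
    using assms unfolding lin_form_def by (auto simp: in_keys_iff lookup_minus)
  then show ?thesis using k by blast
qed

lemma meval_lin_form: "meval y (lin_form x a b) = x a * y b - x b * y a"
  by (simp add: lin_form_def rhom.hom_simps[OF rhom_meval] meval_const meval_var)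

text \<open>The degree is given through the monomials and not through \<open>total_degree\<close>,
  so that the zero polynomial counts as a form of every degree; products of linear forms may vanish,
  as \<open>lin_form x a a\<close> does.\<close>

lemma msubst_scale:
  fixes x :: "'n::finite \<Rightarrow> 'a::comm_ring_1"
  assumes "\<And>m. m \<in> keys F \<Longrightarrow> mon_degree m = d"
  shows "msubst c (\<lambda>i. t * x i) F = t ^ d * msubst c x F"
proof -
  have "(\<Prod>i\<in>UNIV. (t * x i) ^ lookup m i) = t ^ d * (\<Prod>i\<in>UNIV. x i ^ lookup m i)"
    if "m \<in> keys F" for m
    unfolding assms[OF that, symmetric] by (simp add: power_mult_distrib prod.distrib mon_degree_def power_sum)
  then show ?thesis unfolding msubst_def
    by (simp add: sum_distrib_left mult.left_commute)
qed

lemma meval_scale: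
  "(\<And>m. m \<in> keys F \<Longrightarrow> mon_degree m = d) \<Longrightarrow> meval (\<lambda>i. c * x i) F = c ^ d * meval x F"
  unfolding meval_def by (rule msubst_scale)

lemma proj_point_self: "x \<in> proj_point x"
  unfolding proj_point_def by (auto intro!: exI[of _ 1])

lemma proj_point_scale:
  assumes "c \<noteq> 0"
  shows "proj_point (\<lambda>i. c * x i) = proj_point x"
proof -
  have "\<exists>c'. c' \<noteq> 0 \<and> (\<lambda>i. d * x i) = (\<lambda>i. c' * (c * x i))" if "d \<noteq> 0" for d
    using that assms by (intro exI[of _ "d / c"]) auto
  moreover have "\<exists>c'. c' \<noteq> 0 \<and> (\<lambda>i. d * (c * x i)) = (\<lambda>i. c' * x i)" if "d \<noteq> 0" for d
    using that assms by (intro exI[of _ "d * c"]) (auto simp: mult.assoc)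
  ultimately show ?thesis unfolding proj_point_def by auto
qed

lemma proj_point_eqI:
  assumes "\<exists>i. x i \<noteq> 0" "\<exists>i. y i \<noteq> 0" "\<And>a b. x a * y b = x b * y a"
  shows "proj_point y = proj_point x"
proof -
  obtain a where a: "x a \<noteq> 0" using assms(1) by auto
  have y: "y = (\<lambda>i. (y a / x a) * x i)" using a assms(3)[of a] by (auto simp: field_simps)
  then have "y a / x a \<noteq> 0" using assms(2) by (metis mult_zero_left)
  then show ?thesis using y proj_point_scale by metis
qed

lemma proj_zeros_iff:
  assumes T: "\<And>F. F \<in> T \<Longrightarrow> homogeneous F"
  shows "proj_point x \<in> proj_zeros T \<longleftrightarrow> (\<exists>i. x i \<noteq> 0) \<and> (\<forall>F\<in>T. meval x F = 0)"
proof -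
  have nz: "proj_point x \<in> proj_space \<longleftrightarrow> (\<exists>i. x i \<noteq> 0)"
  proof
    assume "proj_point x \<in> proj_space"
    then obtain y j where "proj_point x = proj_point y" "y j \<noteq> 0" unfolding proj_space_def by auto
    then obtain c where "c \<noteq> 0" "x = (\<lambda>i. c * y i)" using proj_point_self[of x] unfolding proj_point_def by auto
    then show "\<exists>i. x i \<noteq> 0" using \<open>y j \<noteq> 0\<close> by auto
  qed (auto simp: proj_space_def)
  have "meval y F = 0" if y: "y \<in> proj_point x" and F: "F \<in> T" "meval x F = 0" for y F
  proof -
    obtain c where "y = (\<lambda>i. c * x i)" using y unfolding proj_point_def by auto
    then show ?thesis using meval_scale[of F "total_degree F" c x] T[OF F(1)] F(2) by (auto simp: homogeneous_def)
  qed
  then show ?thesis unfolding proj_zeros_def using nz proj_point_self[of x] by blast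
qed

lemma proj_zeros_subset_space: "proj_zeros T \<subseteq> proj_space"
  unfolding proj_zeros_def by auto

lemma proj_spaceE:
  assumes "P \<in> proj_space"
  obtains x where "P = proj_point x" "\<exists>i. x i \<noteq> 0"
  using assms unfolding proj_space_def by auto

lemma proj_set_eqI:
  assumes "A \<subseteq> proj_space" "B \<subseteq> proj_space" "\<And>x. \<exists>i. x i \<noteq> 0 \<Longrightarrow> proj_point x \<in> A \<longleftrightarrow> proj_point x \<in> B"
  shows "A = B"
proof (rule Set.set_eqI)
  fix P
  show "P \<in> A \<longleftrightarrow> P \<in> B"
  proof (cases "P \<in> proj_space")
    case True
    then obtain x where "P = proj_point x" "\<exists>i. x i \<noteq> 0" by (rule proj_spaceE)
    then show ?thesis using assms(3)[of x] by simp
  qed (use assms(1,2) in blast)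
qed

lemma zariski_closed_subset_space: "zariski_closed A \<Longrightarrow> A \<subseteq> proj_space"
  unfolding zariski_closed_def using proj_zeros_subset_space by auto

lemma zariski_closed_section:
  assumes "zariski_closed X" "\<And>i. i \<in> I \<Longrightarrow> homogeneous (D i)"
  shows "zariski_closed ((\<Inter>i\<in>I. hypersurface (D i)) \<inter> X)"
proof -
  obtain S where S: "\<And>F. F \<in> S \<Longrightarrow> homogeneous F" "X = proj_zeros S"
    using assms unfolding zariski_closed_def by auto
  have "(\<Inter>i\<in>I. hypersurface (D i)) \<inter> X = proj_zeros (S \<union> D ` I)"
    unfolding S(2) hypersurface_def proj_zeros_def by auto
  then show ?thesis using S(1) assms(2) unfolding zariski_closed_def by (metis UnE imageE)
qed

lemma irreducible_point:
  fixes x :: "'n::finite \<Rightarrow> 'k::field"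
  assumes "\<exists>i. x i \<noteq> 0"
  shows "irreducible_closed {proj_point x}"
proof -
  define T where "T = {lin_form x a b | a b. True}"
  have T: "\<And>F. F \<in> T \<Longrightarrow> homogeneous F" unfolding T_def using lin_form_degree homogeneousI by blast
  have "{proj_point x} = proj_zeros T"
  proof (rule proj_set_eqI)
    show "{proj_point x} \<subseteq> proj_space" using assms by (auto simp: proj_space_def)
    show "proj_point y \<in> {proj_point x} \<longleftrightarrow> proj_point y \<in> proj_zeros T" if y: "\<exists>i. y i \<noteq> 0" for y
    proof
      assume "proj_point y \<in> {proj_point x}"
      then obtain c where "y = (\<lambda>i. c * x i)" using proj_point_self[of y] unfolding proj_point_def by auto
      then have "\<forall>F\<in>T. meval y F = 0" by (auto simp: T_def meval_lin_form)
      then show "proj_point y \<in> proj_zeros T" using y proj_zeros_iff[of T y] T by blast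
    next
      assume "proj_point y \<in> proj_zeros T"
      then have "\<forall>F\<in>T. meval y F = 0" using proj_zeros_iff[of T y] T by blast
      then have "meval y (lin_form x a b) = 0" for a b unfolding T_def by blast
      then have "x a * y b = x b * y a" for a b by (simp add: meval_lin_form)
      then show "proj_point y \<in> {proj_point x}" using proj_point_eqI[OF assms y] by simp
    qed
  qed (rule proj_zeros_subset_space)
  then show ?thesis using T unfolding irreducible_closed_def zariski_closed_def by blast
qed

text \<open>The sets of forms vanishing on a descending chain increase, and by the basis theorem
  finitely many of these forms, all present at some stage \<open>N\<close>, generate the whole
  union. Then every equation of \<open>Z (Suc N)\<close> already vanishes on
  \<open>Z N\<close>.\<close>

lemma wf_zariski_closed:
  "wf {(A, B :: ('n::finite \<Rightarrow> 'k::field) set set). zariski_closed A \<and> zariski_closed B \<and> A \<subset> B}"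
  unfolding wf_iff_no_infinite_down_chain
proof
  assume "\<exists>Z. \<forall>n. (Z (Suc n), Z n) \<in> {(A, B :: ('n \<Rightarrow> 'k) set set). zariski_closed A \<and> zariski_closed B \<and> A \<subset> B}"
  then obtain Z :: "nat \<Rightarrow> ('n \<Rightarrow> 'k) set set" where
    Z: "\<And>n. (Z (Suc n), Z n) \<in> {(A, B). zariski_closed A \<and> zariski_closed B \<and> A \<subset> B}" by blast
  have cl: "zariski_closed (Z n)" and less: "Z (Suc n) \<subset> Z n" for n using Z[of n] by auto
  have anti: "Z m \<subseteq> Z n" if "n \<le> m" for m n
    using less by (intro lift_Suc_antimono_le[of Z, OF _ that]) (rule psubset_imp_subset)
  define V where "V n = {F. homogeneous F \<and> (\<forall>P\<in>Z n. \<forall>x\<in>P. meval x F = 0)}" for n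
  have Vmono: "V n \<subseteq> V m" if "n \<le> m" for m n using anti[OF that] unfolding V_def by blast
  have noeth: "noeth (UNIV :: ('k, 'n) mpoly set)" using noeth_pvars[of UNIV] by simp
  obtain F where F: "F \<subseteq> (\<Union>n. V n)" "finite F" "(\<Union>n. V n) \<subseteq> ispan UNIV F"
    using noeth unfolding noeth_def by (metis subset_UNIV)
  have "\<exists>N. F \<subseteq> V N"
    using F(2,1)
  proof induction
    case (insert f F)
    then obtain N n where "F \<subseteq> V N" "f \<in> V n" by auto
    then have "insert f F \<subseteq> V (max N n)" using Vmono[of N "max N n"] Vmono[of n "max N n"] by auto
    then show ?case ..
  qed simp
  then obtain N where N: "F \<subseteq> V N" ..
  obtain T where T: "\<And>G. G \<in> T \<Longrightarrow> homogeneous G" "Z (Suc N) = proj_zeros T"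
    using cl[of "Suc N"] unfolding zariski_closed_def by auto
  have "ispan UNIV F \<subseteq> {G. \<forall>P\<in>Z N. \<forall>x\<in>P. meval x G = 0}"
    by (rule ispan_closed_subset) (use N in \<open>auto simp: V_def rhom.hom_simps[OF rhom_meval]\<close>)
  moreover have "T \<subseteq> V (Suc N)" using T unfolding V_def proj_zeros_def by auto
  ultimately have "meval x G = 0" if "G \<in> T" "P \<in> Z N" "x \<in> P" for G P x using that F(3) by blast
  then have "Z N \<subseteq> proj_zeros T"
    using zariski_closed_subset_space[OF cl[of N]] unfolding proj_zeros_def by auto
  then show False using less[of N] T(2) by auto
qed

text \<open>Noetherian induction: if \<open>Y\<close> is reducible, one of two smaller closed pieces
  is infinite.\<close>

lemma infinite_irreducible_closed:
  assumes "zariski_closed Y" "infinite Y"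
  shows "\<exists>Z\<subseteq>Y. irreducible_closed Z \<and> infinite Z"
  using assms
proof (induction Y rule: wf_induct_rule[OF wf_zariski_closed])
  case (1 Y)
  show ?case
  proof (cases "irreducible_closed Y")
    case False
    then obtain A B where AB: "zariski_closed A" "zariski_closed B" "Y = A \<union> B" "A \<noteq> Y" "B \<noteq> Y"
      using 1(2,3) unfolding irreducible_closed_def by auto
    then have "infinite A \<or> infinite B" using 1(3) by auto
    moreover have "A \<subset> Y" "B \<subset> Y" using AB by auto
    ultimately obtain C where "C \<subset> Y" "infinite C" "zariski_closed C" using AB by blast
    then show ?thesis using 1(1)[of C] 1(2) by auto
  qed (use 1 in blast)
qed

lemma zdim_ge:
  fixes Z :: "nat \<Rightarrow> ('b::finite \<Rightarrow> 'a::field) set set"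
  assumes "\<And>j. j \<le> l \<Longrightarrow> irreducible_closed (Z j) \<and> Z j \<subseteq> Y" "\<And>j. j < l \<Longrightarrow> Z j \<subset> Z (Suc j)"
  shows "ereal (real l) \<le> zdim Y"
proof -
  have "Z 0 \<noteq> {}" using assms(1)[of 0] unfolding irreducible_closed_def by auto
  then have "Y \<noteq> {}" using assms(1)[of 0] by auto
  moreover have "ereal (real l) \<in> {ereal (real l) | l. \<exists>Z :: nat \<Rightarrow> ('b \<Rightarrow> 'a) set set.
      (\<forall>j\<le>l. irreducible_closed (Z j) \<and> Z j \<subseteq> Y) \<and> (\<forall>j<l. Z j \<subset> Z (Suc j))}"
    using assms by blast
  ultimately show ?thesis unfolding zdim_def by (simp only: if_False) (rule Sup_upper)
qed

text \<open>A point inside an infinite irreducible closed subset gives a chain of length 1.\<close>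

lemma finite_zdim_le_0:
  assumes "zariski_closed Y" "zdim Y \<le> 0"
  shows "finite Y"
proof (rule ccontr)
  assume "infinite Y"
  then obtain Z where Z: "Z \<subseteq> Y" "irreducible_closed Z" "infinite Z"
    using infinite_irreducible_closed assms(1) by blast
  then obtain P where P: "P \<in> Z" by (metis finite.emptyI ex_in_conv)
  then have "P \<in> proj_space" using Z zariski_closed_subset_space[of Z] unfolding irreducible_closed_def by auto
  then have "irreducible_closed {P}" using irreducible_point by (metis proj_spaceE)
  moreover have "{P} \<subset> Z" using P Z(3) by auto
  ultimately have "ereal (real 1) \<le> zdim Y"
    using Z by (intro zdim_ge[where Z = "\<lambda>j. if j = 0 then {P} else Z"]) auto
  then show False using assms(2) by (auto simp: zero_ereal_def dest: order_trans)
qed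

lemma empty_zdim_le_minus1:
  assumes "Y \<subseteq> proj_space" "zdim Y \<le> -1"
  shows "Y = {}"
proof (rule ccontr)
  assume "Y \<noteq> {}"
  then obtain P where P: "P \<in> Y" by auto
  then have "irreducible_closed {P}" using irreducible_point assms(1) by (metis proj_spaceE subsetD)
  then have "ereal (real 0) \<le> zdim Y"
    using P by (intro zdim_ge[where Z = "\<lambda>j. {P}"]) auto
  then have "ereal 0 \<le> - 1" using assms(2) order_trans by fastforce
  then show False by (simp add: one_ereal_def)
qed

section \<open>Ideals of the affine charts\<close>

abbreviation chart where "chart i \<equiv> pvars (UNIV - {i})"

lemma carrier_chart: "carrier (chart_ring i) = chart i"
  unfolding chart_ring_def pvars_def by auto

lemma chart_simps [simp]:
  "x \<otimes>\<^bsub>chart_ring i\<^esub> y = x * y" "\<one>\<^bsub>chart_ring i\<^esub> = 1"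
  "\<zero>\<^bsub>chart_ring i\<^esub> = 0" "x \<oplus>\<^bsub>chart_ring i\<^esub> y = x + y"
  unfolding chart_ring_def by simp_all

lemma cring_chart: "cring (chart_ring i)"
proof (rule cringI)
  note A = subring1D[OF subring1_pvars[of "UNIV - {i}"]]
  show "abelian_group (chart_ring i)"
  proof (rule abelian_groupI)
    show "\<exists>y\<in>carrier (chart_ring i). y \<oplus>\<^bsub>chart_ring i\<^esub> x = \<zero>\<^bsub>chart_ring i\<^esub>" if "x \<in> carrier (chart_ring i)" for x
      using that by (intro bexI[of _ "- x"]) (simp_all add: carrier_chart A)
  qed (simp_all add: carrier_chart A algebra_simps)
  show "comm_monoid (chart_ring i)"
    by unfold_locales (simp_all add: carrier_chart A algebra_simps)
qed (simp_all add: algebra_simps)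

text \<open>Links the record-based ideals of the chart ring with the arithmetic of the polynomial
  type; negatives come from multiplication by the constant \<open>- 1\<close>.\<close>

lemma chart_idealI:
  assumes J: "J \<subseteq> chart i" "0 \<in> J" "\<And>x y. x \<in> J \<Longrightarrow> y \<in> J \<Longrightarrow> x + y \<in> J"
    and m: "\<And>a x. a \<in> chart i \<Longrightarrow> x \<in> J \<Longrightarrow> a * x \<in> J"
  shows "ideal J (chart_ring i)"
proof -
  interpret cring "chart_ring i" by (rule cring_chart)
  note A = subring1D[OF subring1_pvars[of "UNIV - {i}"]]
  have neg: "- x \<in> J" if "x \<in> J" for x using m[OF A(5)[OF A(1)], of x] that by simp
  have m': "x * a \<in> J" if "a \<in> chart i" "x \<in> J" for a x
    using m[OF that] by (simp add: mult.commute)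
  show ?thesis
  proof (rule idealI)
    show "ring (chart_ring i)" by (rule ring_axioms)
    show "subgroup J (add_monoid (chart_ring i))"
    proof (rule add.subgroupI)
      show "J \<noteq> {}" using J by auto
      fix x assume x: "x \<in> J"
      have "\<ominus>\<^bsub>chart_ring i\<^esub> x = - x"
        by (rule minus_equality) (use x J(1) neg in \<open>auto simp: carrier_chart\<close>)
      then show "\<ominus>\<^bsub>chart_ring i\<^esub> x \<in> J" using neg x by simp
    qed (use J in \<open>simp_all add: carrier_chart\<close>)
  qed (simp_all add: carrier_chart m m')
qed

lemma chart_idealD:
  assumes "ideal J (chart_ring i)"
  shows "J \<subseteq> chart i" "0 \<in> J" "x \<in> J \<Longrightarrow> y \<in> J \<Longrightarrow> x + y \<in> J"
    "a \<in> chart i \<Longrightarrow> x \<in> J \<Longrightarrow> a * x \<in> J"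
proof -
  interpret ideal J "chart_ring i" by fact
  show "J \<subseteq> chart i" using a_subset by (simp add: carrier_chart)
  show "0 \<in> J" using additive_subgroup.zero_closed[OF additive_subgroup_axioms] by simp
  show "x \<in> J \<Longrightarrow> y \<in> J \<Longrightarrow> x + y \<in> J" using additive_subgroup.a_closed[OF additive_subgroup_axioms, of x y] by simp
  show "a \<in> chart i \<Longrightarrow> x \<in> J \<Longrightarrow> a * x \<in> J" using I_l_closed[of x a] by (simp add: carrier_chart)
qed

lemma ispan_subset_chart_ideal:
  "ideal J (chart_ring i) \<Longrightarrow> S \<subseteq> J \<Longrightarrow> ispan (chart i) S \<subseteq> J"
  by (rule ispan_closed_subset) (auto dest: chart_idealD)

lemma dehomogenize_eq: "dehomogenize i F = msubst mconst (\<lambda>k. if k = i then 1 else mvar k) F"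
  unfolding dehomogenize_def by (rule msubst_cong) (simp_all only: mvar_def)

lemma dehomogenize_in_chart: "dehomogenize i F \<in> chart i"
  unfolding dehomogenize_eq
  by (rule msubst_in_subring[OF subring1_pvars])
     (auto intro: mconst_in_pvars mvar_in_pvars subring1D[OF subring1_pvars])

lemma msubst_chart_cong:
  assumes "p \<in> pvars V" "\<And>k. k \<in> V \<Longrightarrow> x k = y k"
  shows "msubst c x p = msubst c y p"
  unfolding msubst_def
proof (rule sum.cong[OF refl])
  fix m assume m: "m \<in> keys p"
  have "(\<Prod>k\<in>UNIV. x k ^ lookup m k) = (\<Prod>k\<in>UNIV. y k ^ lookup m k)"
  proof (rule prod.cong[OF refl])
    fix k show "x k ^ lookup m k = y k ^ lookup m k"
      using assms m by (cases "k \<in> V") (auto simp: pvars_def)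
  qed
  then show "c (lookup p m) * (\<Prod>k\<in>UNIV. x k ^ lookup m k) =
    c (lookup p m) * (\<Prod>k\<in>UNIV. y k ^ lookup m k)" by simp
qed

lemma dehomogenize_chart: 
  assumes "p \<in> chart i"
  shows "dehomogenize i p = p"
proof -
  have "dehomogenize i p = msubst mconst mvar p"
    unfolding dehomogenize_eq by (rule msubst_chart_cong[OF assms]) auto
  then show ?thesis by (simp add: msubst_mvar)
qed

lemma msubst_dehomogenize:
  assumes "rhom c"
  shows "msubst c x (dehomogenize i F) = msubst c (x(i := 1)) F"
  unfolding dehomogenize_eq rhom_msubst_comp[OF rhom_msubst[OF assms] rhom_mconst]
  by (rule msubst_cong)
     (auto simp: msubst_const[OF assms] msubst_var[OF assms] rhom.hom_one[OF rhom_msubst[OF assms]])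

lemma meval_dehomogenize: "meval x (dehomogenize i F) = meval (x(i := 1)) F"
  unfolding meval_def by (rule msubst_dehomogenize[OF rhom_id])

section \<open>The ideal of the intersection on one chart\<close>

context
  fixes D :: "nat \<Rightarrow> ('k::field, 'n::finite) mpoly" and X :: "('n \<Rightarrow> 'k) set set" and I :: "nat set" and i :: 'n
begin

lemma section_gens_in_chart:
  "(\<Union>Z\<in>insert (variety_scheme X) ((\<lambda>l. hypersurface_scheme (D l)) ` I). Z i) \<subseteq> carrier (chart_ring i)"
proof -
  interpret cring "chart_ring i" by (rule cring_chart)
  have "hypersurface_scheme (D l) i \<subseteq> carrier (chart_ring i)" for l
    unfolding hypersurface_scheme_def
    by (rule ideal.Icarr[OF cgenideal_ideal, THEN subsetI]) (auto simp: carrier_chart dehomogenize_in_chart)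
  then show ?thesis by (auto simp: variety_scheme_def)
qed

lemma section_ideal: "ideal (scheme_section D X I i) (chart_ring i)"
  unfolding scheme_section_def scheme_Inter_def
  by (rule ring.genideal_ideal[OF cring.axioms(1)[OF cring_chart] section_gens_in_chart])

lemma section_gens:
  "variety_scheme X i \<subseteq> scheme_section D X I i" "l \<in> I \<Longrightarrow> dehomogenize i (D l) \<in> scheme_section D X I i"
proof -
  have s: "(\<Union>Z\<in>insert (variety_scheme X) ((\<lambda>l. hypersurface_scheme (D l)) ` I). Z i) \<subseteq> scheme_section D X I i"
    unfolding scheme_section_def scheme_Inter_def
    by (rule ring.genideal_self[OF cring.axioms(1)[OF cring_chart] section_gens_in_chart])
  show "variety_scheme X i \<subseteq> scheme_section D X I i" using s by auto
  assume "l \<in> I"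
  moreover have "dehomogenize i (D l) \<in> hypersurface_scheme (D l) i"
    unfolding hypersurface_scheme_def
    by (rule ring.cgenideal_self[OF cring.axioms(1)[OF cring_chart]]) (simp add: carrier_chart dehomogenize_in_chart)
  ultimately show "dehomogenize i (D l) \<in> scheme_section D X I i" using s by auto
qed

text \<open>Used with the ideal of polynomials whose size along \<open>f\<close> is controlled:
  checking the generators then covers the whole chart ideal.\<close>

lemma section_minimal:
  assumes J: "ideal J (chart_ring i)" and "variety_scheme X i \<subseteq> J" "\<And>l. l \<in> I \<Longrightarrow> dehomogenize i (D l) \<in> J"
  shows "scheme_section D X I i \<subseteq> J"
proof -
  have "hypersurface_scheme (D l) i \<subseteq> J" if "l \<in> I" for l
    unfolding hypersurface_scheme_def
    by (rule ring.cgenideal_minimal[OF cring.axioms(1)[OF cring_chart] J assms(3)[OF that]])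
  then show ?thesis
    unfolding scheme_section_def scheme_Inter_def
    using assms(2) by (intro ring.genideal_minimal[OF cring.axioms(1)[OF cring_chart] J]) auto
qed

lemma section_zero_point:
  assumes X: "zariski_closed X" and D: "\<And>l. l \<in> I \<Longrightarrow> homogeneous (D l)"
    and x: "x i = 1" "\<And>p. p \<in> scheme_section D X I i \<Longrightarrow> meval x p = 0"
  shows "proj_point x \<in> (\<Inter>l\<in>I. hypersurface (D l)) \<inter> X"
proof -
  have x1: "x(i := 1) = x" using x(1) by auto
  have nz: "\<exists>k. x k \<noteq> 0" using x(1) by (metis zero_neq_one)
  have "proj_point x \<in> hypersurface (D l)" if "l \<in> I" for l
  proof -
    have "meval x (D l) = 0"
      using x(2)[OF section_gens(2)[OF that]] by (simp add: meval_dehomogenize x1)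
    then show ?thesis
      using proj_zeros_iff[of "{D l}" x] D[OF that] nz unfolding hypersurface_def by auto
  qed
  moreover have "proj_point x \<in> X"
  proof -
    obtain T where T: "\<And>F. F \<in> T \<Longrightarrow> homogeneous F" "X = proj_zeros T" using X unfolding zariski_closed_def by auto
    have "meval x F = 0" if "F \<in> T" for F
    proof -
      have "meval y (dehomogenize i F) = 0" if "proj_point y \<in> X" "y i = 1" for y
      proof -
        have "y(i := 1) = y" using that(2) by auto
        then show ?thesis using that(1) T \<open>F \<in> T\<close> proj_zeros_iff[of T y] by (auto simp: meval_dehomogenize)
      qed
      then have "dehomogenize i F \<in> variety_scheme X i"
        unfolding variety_scheme_def by (simp add: carrier_chart dehomogenize_in_chart)
      then show ?thesis using x(2) section_gens(1) x1 by (metis meval_dehomogenize subsetD)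
    qed
    then show ?thesis unfolding T(2) using proj_zeros_iff[of T x] T(1) nz by blast
  qed
  ultimately show ?thesis by auto
qed

end

text \<open>The Nullstellensatz is applied in the full polynomial ring to the ideal extended from
  the chart. A zero of it may have any value at the coordinate \<open>i\<close>, but chart
  polynomials do not see this coordinate, so it can be reset to 1. Setting X_i to 1 also carries the
  resulting membership back to the chart ring.\<close>

lemma section_nullstellensatz:
  fixes D :: "nat \<Rightarrow> ('k::alg_closed_field, 'n::finite) mpoly"
  assumes X: "zariski_closed X" and D: "\<And>l. l \<in> I \<Longrightarrow> homogeneous (D l)"
    and g: "g \<in> chart i"
    and vanish: "\<And>x. x i = 1 \<Longrightarrow> proj_point x \<in> (\<Inter>l\<in>I. hypersurface (D l)) \<inter> X \<Longrightarrow> meval x g = 0"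
  shows "\<exists>k. g ^ k \<in> scheme_section D X I i"
proof -
  let ?S = "scheme_section D X I i"
  note S = section_ideal[of D X I i]
  have "is_ideal (ispan UNIV ?S)"
    unfolding is_ideal_def by (auto intro: ispan_zero ispan_add ispan_mult simp: subring1_def)
  moreover have "meval x g = 0" if x: "\<forall>p\<in>ispan UNIV ?S. meval x p = 0" for x
  proof -
    let ?x = "x(i := 1)"
    have eq: "meval ?x p = meval x p" if "p \<in> chart i" for p
      unfolding meval_def by (rule msubst_chart_cong[OF that]) auto
    have "meval ?x p = 0" if "p \<in> ?S" for p
      using x that eq[of p] chart_idealD(1)[OF S] ispan_base[of UNIV p ?S] by auto
    then have "proj_point ?x \<in> (\<Inter>l\<in>I. hypersurface (D l)) \<inter> X"
      by (intro section_zero_point[OF X D]) auto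
    then show ?thesis using vanish[of ?x] eq[OF g] by simp
  qed
  ultimately obtain k where "g ^ k \<in> ispan UNIV ?S" using nullstellensatz by blast
  then have "dehomogenize i (g ^ k) \<in> ispan (dehomogenize i ` UNIV) (dehomogenize i ` ?S)"
    by (rule rhom_ispan[OF rhom_dehomogenize])
  moreover have "dehomogenize i ` ?S \<subseteq> ?S" using dehomogenize_chart chart_idealD(1)[OF S] by fastforce
  then have "ispan (dehomogenize i ` UNIV) (dehomogenize i ` ?S) \<subseteq> ?S"
    by (rule ispan_closed_subset) (auto intro: chart_idealD[OF S] dehomogenize_in_chart)
  moreover have "g ^ k \<in> chart i" using g by (intro subring1D[OF subring1_pvars])
  then have "dehomogenize i (g ^ k) = g ^ k" by (rule dehomogenize_chart)
  ultimately have "g ^ k \<in> ?S" by auto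
  then show ?thesis ..
qed

section \<open>Powers of chart ideals and the exponent M\<close>

abbreviation ideal_pow where
  "ideal_pow i J m \<equiv> J [^]\<^bsub>ideals_set (chart_ring i)\<^esub> (m::nat)"

lemma ideals_set_one: "\<one>\<^bsub>ideals_set (chart_ring i)\<^esub> = chart i"
  by (simp add: ideals_set_def carrier_chart)

lemma ideal_pow_Suc: "ideal_pow i J (Suc m) =
    ideal_prod (chart_ring i) (ideal_pow i J m) J"
  by (simp add: nat_pow_Suc ideals_set_def)

lemma power_in_ideal_pow:
  assumes "g \<in> J"
  shows "g ^ m \<in> ideal_pow i J m"
proof (induction m)
  case 0
  show ?case by (simp add: ideals_set_one subring1D[OF subring1_pvars])
next
  case (Suc m)
  show ?case unfolding ideal_pow_Suc power_Suc2 using ideal_prod.prod[OF Suc assms, of "chart_ring i"] by simp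
qed

lemma ispan_prod:
  assumes "subring1 A" "x \<in> ispan A S" "y \<in> ispan A T"
  shows "x * y \<in> ispan A {s * t | s t. s \<in> S \<and> t \<in> T}"
  using assms(2)
proof induction
  case ispan_zero
  then show ?case by (simp add: ispan.ispan_zero)
next
  case (ispan_step r a s)
  have "s * y \<in> ispan A {s * t | s t. s \<in> S \<and> t \<in> T}"
    using assms(3)
  proof induction
    case ispan_zero
    then show ?case by (simp add: ispan.ispan_zero)
  next
    case (ispan_step r b t)
    then have "b * (s * t) + s * r \<in> ispan A {s * t | s t. s \<in> S \<and> t \<in> T}"
      using \<open>s \<in> S\<close> by (intro ispan.ispan_step) auto
    then show ?case by (simp add: algebra_simps)
  qed
  then have "a * (s * y) + r * y \<in> ispan A {s * t | s t. s \<in> S \<and> t \<in> T}"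
    by (rule ispan_add[OF ispan_mult[OF assms(1) ispan_step.hyps(2)] ispan_step.IH])
  then show ?case by (simp add: algebra_simps)
qed

abbreviation monomials where
  "monomials F m \<equiv> {(\<Prod>s\<in>F. s ^ e s) | e. (\<Sum>s\<in>F. e s) = m}"

lemma ideal_pow_subset_ispan:
  assumes J: "J \<subseteq> ispan (chart i) F" and F: "finite F"
  shows "ideal_pow i J m \<subseteq>
    ispan (chart i) (monomials F m)"
proof (induction m)
  case 0
  have "p \<in> ispan (chart i) (monomials F 0)" if "p \<in> chart i" for p
  proof -
    have "p * 1 + 0 \<in> ispan (chart i) (monomials F 0)"
      by (rule ispan_step[OF ispan_zero that]) (auto intro!: exI[of _ "\<lambda>_. 0"])
    then show ?thesis by simp
  qed
  then show ?case by (auto simp: ideals_set_one)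
next
  case (Suc m)
  let ?A = "chart i"
  let ?M = "monomials F"
  have sub: "{u * t | u t. u \<in> ?M m \<and> t \<in> F} \<subseteq> ?M (Suc m)"
  proof safe
    fix t e assume t: "t \<in> F" and m: "m = (\<Sum>s\<in>F. e s)"
    let ?e = "e(t := Suc (e t))"
    have "(\<Prod>s\<in>F. s ^ ?e s) = (\<Prod>s\<in>F. s ^ e s * (if s = t then s else 1))"
      by (intro prod.cong) auto
    also have "\<dots> = (\<Prod>s\<in>F. s ^ e s) * t" using F t by (simp add: prod.distrib)
    finally have "(\<Prod>s\<in>F. s ^ e s) * t = (\<Prod>s\<in>F. s ^ ?e s)" by simp
    moreover have "(\<Sum>s\<in>F. ?e s) = (\<Sum>s\<in>F. e s + (if s = t then 1 else 0))" by (intro sum.cong) auto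
    then have "(\<Sum>s\<in>F. ?e s) = Suc (\<Sum>s\<in>F. e s)" using F t by (simp add: sum.distrib)
    ultimately show "\<exists>e'. (\<Prod>s\<in>F. s ^ e s) * t = (\<Prod>s\<in>F. s ^ e' s) \<and> (\<Sum>s\<in>F. e' s) = Suc (\<Sum>s\<in>F. e s)" by blast
  qed
  have "x \<in> ispan ?A (?M (Suc m))" if "x \<in> ideal_prod (chart_ring i) (ideal_pow i J m) J" for x
    using that
  proof induction
    case (prod u v)
    then have "u * v \<in> ispan ?A {u * t | u t. u \<in> ?M m \<and> t \<in> F}"
      using Suc J by (intro ispan_prod[OF subring1_pvars]) auto
    then show ?case using ispan_mono[OF sub, of ?A] by auto
  next
    case (sum u v)
    then show ?case by (simp add: ispan_add)
  qed
  then show ?case by (auto simp only: ideal_pow_Suc)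
qed

text \<open>Let finitely many \<open>s\<close> generate \<open>J\<close>, with
  \<open>s ^ k s\<close> in \<open>Y\<close>. A monomial in them whose degree exceeds the sum of all
  \<open>k s\<close> has some exponent at least \<open>k s\<close>, so it lies in \<open>Y\<close>.
  The claim covers all large exponents, so that one exponent can serve finitely many ideals at
  once.\<close>

lemma ideal_pow_radical_subset:
  fixes Y :: "('k::field, 'n::finite) mpoly set"
  assumes Y: "ideal Y (chart_ring i)"
    and J: "J \<subseteq> chart i" "\<And>p. p \<in> J \<Longrightarrow> \<exists>k. p ^ k \<in> Y"
  shows "\<exists>M0::nat. \<forall>M\<ge>M0. ideal_pow i J M \<subseteq> Y"
proof -
  let ?A = "chart i :: ('k, 'n) mpoly set"
  note A = subring1D[OF subring1_pvars[of "UNIV - {i}"]]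
  obtain F where F: "F \<subseteq> J" "finite F" "J \<subseteq> ispan ?A F"
    using noeth_pvars[of "UNIV - {i}"] J(1) unfolding noeth_def by meson
  obtain k where k: "\<And>s. s \<in> F \<Longrightarrow> s ^ k s \<in> Y" using J(2) F(1) by (metis subsetD)
  define K where "K = (\<Sum>s\<in>F. k s)"
  have "(\<Prod>s\<in>F. s ^ e s) \<in> Y" if e: "(\<Sum>s\<in>F. e s) \<ge> Suc K" for e
  proof -
    have "\<exists>s\<in>F. e s \<ge> k s"
    proof (rule ccontr)
      assume "\<not> ?thesis"
      then have "(\<Sum>s\<in>F. e s) \<le> K" unfolding K_def by (intro sum_mono) (auto simp: not_le)
      then show False using e by simp
    qed
    then obtain s where s: "s \<in> F" "e s \<ge> k s" by auto
    have pF: "(\<Prod>t\<in>G. t ^ e t) \<in> ?A" if "G \<subseteq> F" for G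
      using that F(1) J(1) by (induction G rule: infinite_finite_induct) (auto intro!: A)
    have "(\<Prod>s\<in>F. s ^ e s) = (s ^ (e s - k s) * (\<Prod>t\<in>F - {s}. t ^ e t)) * s ^ k s"
      using s F(2) by (simp add: prod.remove[OF F(2) s(1)] power_add[symmetric] mult.assoc[symmetric] algebra_simps)
    also have "\<dots> \<in> Y"
      using s F(1) J(1) by (intro chart_idealD(4)[OF Y] A k pF) auto
    finally show ?thesis .
  qed
  then have "monomials F M \<subseteq> Y" if "M \<ge> Suc K" for M using that by auto
  then have "ideal_pow i J M \<subseteq> Y" if "M \<ge> Suc K" for M
    using ideal_pow_subset_ispan[OF F(3,2), of M] ispan_subset_chart_ideal[OF Y] that by blast
  then show ?thesis by blast
qed

text \<open>\<open>M_index\<close> is defined by \<open>LEAST\<close>, so an admissible exponent has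
  to be exhibited before its defining property can be used.\<close>

lemma M_index_power:
  fixes D :: "nat \<Rightarrow> ('k::field, 'n::finite) mpoly"
  assumes I: "I \<subseteq> {1..q}" "card I = t_index q D X 0 + 1"
    and g: "g \<in> chart i" "g ^ k \<in> scheme_section D X I i"
  shows "g ^ M_index q D X \<in> scheme_section D X I i"
proof -
  let ?P = "\<lambda>M. 0 < M \<and> (\<forall>I. I \<subseteq> {1..q} \<and> card I = t_index q D X 0 + 1 \<longrightarrow>
        subscheme_le (scheme_section D X I) (scheme_mult M (scheme_Supp (scheme_section D X I))))"
  have "\<exists>M0::nat. \<forall>M\<ge>M0. ideal_pow i (scheme_Supp (scheme_section D X I) i) M \<subseteq> scheme_section D X I i" for I i
    by (rule ideal_pow_radical_subset[OF section_ideal]) (auto simp: scheme_Supp_def carrier_chart)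
  then have "\<forall>I. \<exists>f. \<forall>i. \<forall>M\<ge>f i.
      ideal_pow i (scheme_Supp (scheme_section D X I) i) M \<subseteq> scheme_section D X I i"
    by (intro allI choice)
  from choice[OF this] obtain M0 where M0: "\<And>I i M. M \<ge> M0 I i \<Longrightarrow>
      ideal_pow i (scheme_Supp (scheme_section D X I) i) M \<subseteq> scheme_section D X I i" by blast
  have fin: "finite (Pow {1..q} \<times> (UNIV :: 'n set))" by simp
  \<comment> \<open>The sum over all index sets and all charts dominates each single threshold, and
    \<open>Suc\<close> makes it positive.\<close>
  have "?P (Suc (\<Sum>(I, i)\<in>Pow {1..q} \<times> UNIV. M0 I i))"
    unfolding subscheme_le_def scheme_mult_def
  proof (intro conjI allI impI)
    fix I i assume "I \<subseteq> {1..q} \<and> card I = t_index q D X 0 + 1"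
    then have "M0 I i \<le> (\<Sum>(I, i)\<in>Pow {1..q} \<times> UNIV. M0 I i)"
      using member_le_sum[of "(I, i)" "Pow {1..q} \<times> UNIV" "\<lambda>(I, i). M0 I i"] fin by auto
    then show "ideal_pow i (scheme_Supp (scheme_section D X I) i) (Suc (\<Sum>(I, i)\<in>Pow {1..q} \<times> UNIV. M0 I i)) \<subseteq> scheme_section D X I i"
      by (intro M0) simp
  qed simp
  then have "?P (M_index q D X)" unfolding M_index_def by (rule LeastI)
  then have "ideal_pow i (scheme_Supp (scheme_section D X I) i) (M_index q D X) \<subseteq> scheme_section D X I i"
    using I unfolding subscheme_le_def scheme_mult_def by blast
  moreover have "g \<in> scheme_Supp (scheme_section D X I) i"
    using g unfolding scheme_Supp_def carrier_chart by auto
  ultimately show ?thesis using power_in_ideal_pow by blast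
qed

section \<open>Entire functions over a non-Archimedean field\<close>

lemma absval_0 [simp]: "absval (0 :: 'k::complete_nonarch_field) = 0"
  by (simp add: absval_eq_0_iff)

lemma absval_pos: "x \<noteq> 0 \<Longrightarrow> 0 < absval (x :: 'k::complete_nonarch_field)"
  using absval_nonneg[of x] absval_eq_0_iff[of x] by linarith

lemma absval_1 [simp]: "absval (1 :: 'k::complete_nonarch_field) = 1"
  using absval_mult[of "1::'k" 1] absval_pos[of "1::'k"] by simp

lemma absval_minus [simp]: "absval (- x) = absval (x :: 'k::complete_nonarch_field)"
  using dist_absval[of x 0] dist_absval[of 0 x] by (simp add: dist_commute)

lemma absval_power: "absval ((x :: 'k::complete_nonarch_field) ^ n) = absval x ^ n"
  by (induction n) (simp_all add: absval_mult)

lemma absval_diff_le_max: "absval (x - y) \<le> max (absval x) (absval (y :: 'k::complete_nonarch_field))"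
  using absval_add_le_max[of x "- y"] by simp

lemma absval_add_le: "absval (x + y) \<le> absval x + absval (y :: 'k::complete_nonarch_field)"
  using absval_add_le_max[of x y] absval_nonneg[of x] absval_nonneg[of y] by linarith

lemma absval_sum_le:
  fixes f :: "'b \<Rightarrow> 'k::complete_nonarch_field"
  assumes "\<And>i. i \<in> A \<Longrightarrow> absval (f i) \<le> B" "0 \<le> B"
  shows "absval (sum f A) \<le> B"
  using assms
proof (induction A rule: infinite_finite_induct)
  case (insert a A)
  then show ?case using absval_add_le_max[of "f a" "sum f A"] by force
qed simp_all

lemma absval_sum_less:
  fixes f :: "'b \<Rightarrow> 'k::complete_nonarch_field"
  assumes "\<And>i. i \<in> A \<Longrightarrow> absval (f i) < B" "0 < B"
  shows "absval (sum f A) < B"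
  using assms
proof (induction A rule: infinite_finite_induct)
  case (insert a A)
  then show ?case using absval_add_le_max[of "f a" "sum f A"] by force
qed simp_all

lemma absval_add_eq:
  fixes x y :: "'k::complete_nonarch_field"
  assumes "absval y < absval x"
  shows "absval (x + y) = absval x"
  using absval_add_le_max[of x y] absval_diff_le_max[of "x + y" y] assms by auto

section \<open>Growth of coefficients and the norms\<close>

lemma entire_imp_bounded:
  assumes "entire g" "r > 0"
  shows "\<exists>B. \<forall>k. absval (fps_nth g k) * r ^ k \<le> B"
proof -
  let ?L = "limsup (\<lambda>n. ereal (root n (absval (fps_nth g n))))"
  have "?L = 0"
    using assms(1) unfolding entire_def na_conv_radius_def
    by (cases ?L) (auto simp: zero_ereal_def split: if_splits)
  then have "?L < ereal (1 / r)" using assms(2) by simp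
  then have "\<forall>\<^sub>F n in sequentially. ereal (root n (absval (fps_nth g n))) < ereal (1 / r)"
    by (rule Limsup_lessD)
  then obtain N where N: "\<And>n. n \<ge> N \<Longrightarrow> root n (absval (fps_nth g n)) < 1 / r"
    unfolding eventually_sequentially by auto
  \<comment> \<open>Starting at \<open>Suc N\<close> excludes index 0, where \<open>root 0\<close>
    is 0 and its power does not recover the coefficient.\<close>
  have tail: "absval (fps_nth g n) * r ^ n \<le> 1" if "n \<ge> Suc N" for n
  proof -
    have "absval (fps_nth g n) = root n (absval (fps_nth g n)) ^ n"
      using that by (simp add: real_root_pow_pos2 absval_nonneg)
    also have "\<dots> \<le> (1 / r) ^ n"
      using N[of n] that by (intro power_mono) (auto simp: real_root_ge_zero absval_nonneg)
    finally show ?thesis using assms(2) by (simp add: field_simps)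
  qed
  define B where "B = Max ((\<lambda>k. absval (fps_nth g k) * r ^ k) ` {..Suc N})"
  have "absval (fps_nth g k) * r ^ k \<le> max 1 B" for k
  proof (cases "k \<le> Suc N")
    case True
    then have "absval (fps_nth g k) * r ^ k \<le> B" unfolding B_def by (intro Max_ge) auto
    then show ?thesis by simp
  qed (use tail[of k] in auto)
  then show ?thesis by blast
qed

lemma bounded_imp_entire:
  assumes "\<And>r. r > 0 \<Longrightarrow> \<exists>B. \<forall>k. absval (fps_nth g k) * r ^ k \<le> B"
  shows "entire g"
proof -
  let ?L = "limsup (\<lambda>n. ereal (root n (absval (fps_nth g n))))"
  have le: "?L \<le> ereal e" if e: "e > 0" for e
  proof -
    \<comment> \<open>The \<open>n\<close>-th root of the bound tends to 1 and is eventually below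
      2, so division by \<open>2 / e\<close> leaves at most \<open>e\<close>.\<close>
    define r where "r = 2 / e"
    have r: "r > 0" using e by (simp add: r_def)
    obtain B0 where B0: "\<And>k. absval (fps_nth g k) * r ^ k \<le> B0" using assms[OF r] by blast
    define B where "B = max 1 B0"
    have B: "absval (fps_nth g k) \<le> B / r ^ k" for k
      using B0[of k] r by (simp add: B_def field_simps)
    have "(\<lambda>n. root n B) \<longlonglongrightarrow> 1" by (rule LIMSEQ_root_const) (simp add: B_def)
    then have "\<forall>\<^sub>F n in sequentially. root n B < 2" by (rule order_tendstoD) simp
    moreover have "\<forall>\<^sub>F n in sequentially. n > (0::nat)" by (rule eventually_gt_at_top)
    ultimately have "\<forall>\<^sub>F n in sequentially. ereal (root n (absval (fps_nth g n))) \<le> ereal e"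
    proof eventually_elim
      case (elim n)
      have "root n (absval (fps_nth g n)) \<le> root n (B / r ^ n)" using elim B by simp
      also have "\<dots> = root n B / r" using elim r by (simp add: real_root_divide real_root_power_cancel)
      also have "\<dots> \<le> 2 / r" using elim r by (intro divide_right_mono) auto
      also have "\<dots> = e" by (simp add: r_def)
      finally show ?case by simp
    qed
    then show ?thesis by (rule Limsup_bounded)
  qed
  have "?L \<le> 0" by (rule ereal_le_epsilon2) (use le in \<open>auto simp: zero_ereal_def\<close>)
  moreover have "0 \<le> ?L"
    by (rule le_Limsup) (auto simp: real_root_ge_zero absval_nonneg intro!: always_eventually)
  ultimately have "?L = 0" by (rule order_antisym)
  then show ?thesis unfolding entire_def na_conv_radius_def by (simp add: zero_ereal_def)
qed

lemma fps_abs_upper: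
  assumes "entire g" "r > 0"
  shows "absval (fps_nth g k) * r ^ k \<le> fps_abs r g"
proof -
  obtain B where "\<And>k. absval (fps_nth g k) * r ^ k \<le> B" using entire_imp_bounded[OF assms] by blast
  then have "bdd_above (range (\<lambda>k. absval (fps_nth g k) * r ^ k))" by (rule bdd_aboveI2)
  then show ?thesis unfolding fps_abs_def by (rule cSUP_upper[OF UNIV_I])
qed

lemma fps_abs_least: "(\<And>k. absval (fps_nth g k) * r ^ k \<le> B) \<Longrightarrow> fps_abs r g \<le> B"
  unfolding fps_abs_def by (rule cSUP_least) auto

lemma fps_abs_nonneg: "entire g \<Longrightarrow> r > 0 \<Longrightarrow> 0 \<le> fps_abs r g"
  using fps_abs_upper[of g r 0] absval_nonneg[of "fps_nth g 0"] by simp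

lemma fps_abs_pos:
  assumes "entire g" "r > 0" "g \<noteq> 0"
  shows "0 < fps_abs r g"
proof -
  obtain k where k: "fps_nth g k \<noteq> 0" using assms(3) by (metis fps_ext fps_zero_nth)
  then have "0 < absval (fps_nth g k) * r ^ k" using assms(2) by (intro mult_pos_pos absval_pos) auto
  then show ?thesis using fps_abs_upper[OF assms(1,2), of k] by linarith
qed

lemma fps_abs_mono:
  assumes "entire g" "r \<ge> 1"
  shows "fps_abs 1 g \<le> fps_abs r g"
proof (rule fps_abs_least)
  fix k
  have "absval (fps_nth g k) * 1 ^ k \<le> absval (fps_nth g k) * r ^ k"
    using assms(2) by (intro mult_left_mono power_mono) (auto simp: absval_nonneg)
  also have "\<dots> \<le> fps_abs r g" using assms by (intro fps_abs_upper) auto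
  finally show "absval (fps_nth g k) * 1 ^ k \<le> fps_abs r g" .
qed

text \<open>Boundedness at radius \<open>2 * s\<close> yields geometric decay at radius
  \<open>s\<close>.\<close>

lemma entire_geometric_bound:
  assumes "entire g" "s > 0"
  shows "\<exists>B>0. \<forall>k. absval (fps_nth g k) * s ^ k \<le> B * (1 / 2) ^ k"
proof -
  obtain B where B: "\<And>k. absval (fps_nth g k) * (2 * s) ^ k \<le> B"
    using entire_imp_bounded[OF assms(1), of "2 * s"] assms(2) by auto
  have "absval (fps_nth g k) * s ^ k \<le> max 1 B * (1 / 2) ^ k" for k
    using B[of k] by (simp add: power_mult_distrib field_simps)
  then show ?thesis by (intro exI[of _ "max 1 B"]) auto
qed

lemma geometric_less:
  fixes B x c :: real
  assumes "0 \<le> x" "x < 1" "0 < c"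
  shows "\<exists>N. \<forall>k\<ge>N. B * x ^ k < c"
proof -
  have "(\<lambda>k. B * x ^ k) \<longlonglongrightarrow> B * 0" using assms by (intro tendsto_intros LIMSEQ_realpow_zero) auto
  then have "\<forall>\<^sub>F k in sequentially. B * x ^ k < c" by (rule order_tendstoD) (use assms in simp)
  then show ?thesis unfolding eventually_sequentially .
qed

lemma fps_abs_finite_large:
  assumes g: "entire g" "r > 0" and c: "c > 0"
  shows "finite {k. absval (fps_nth g k) * r ^ k \<ge> c}"
proof -
  obtain B where B: "B > 0" "\<And>k. absval (fps_nth g k) * r ^ k \<le> B * (1 / 2) ^ k"
    using entire_geometric_bound[OF g] by blast
  obtain N where N: "\<And>k. k \<ge> N \<Longrightarrow> B * (1 / 2) ^ k < c" using geometric_less[of "1 / 2" c B] c by auto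
  have "{k. absval (fps_nth g k) * r ^ k \<ge> c} \<subseteq> {..<N}"
  proof
    fix k assume "k \<in> {k. absval (fps_nth g k) * r ^ k \<ge> c}"
    then have "\<not> B * (1 / 2) ^ k < c" using B(2)[of k] by simp
    then show "k \<in> {..<N}" using N[of k] by (meson lessThan_iff not_le)
  qed
  then show ?thesis by (rule finite_subset) simp
qed

text \<open>Only finitely many terms exceed half the supremum, so it is attained. The first index
  where this happens is what Gauss's lemma compares.\<close>

lemma fps_abs_attained:
  assumes g: "entire g" "r > 0" "g \<noteq> 0"
  shows "\<exists>k. absval (fps_nth g k) * r ^ k = fps_abs r g \<and> (\<forall>j<k. absval (fps_nth g j) * r ^ j < fps_abs r g)"
proof -
  let ?v = "\<lambda>k. absval (fps_nth g k) * r ^ k"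
  let ?s = "fps_abs r g"
  have s: "?s > 0" by (rule fps_abs_pos[OF g])
  let ?F = "{k. ?v k \<ge> ?s / 2}"
  have fin: "finite ?F" using fps_abs_finite_large[OF g(1,2), of "?s / 2"] s by simp
  have ne: "?F \<noteq> {}"
  proof
    assume "?F = {}"
    then have "?s \<le> ?s / 2" by (intro fps_abs_least) (auto simp: not_le intro: less_imp_le)
    then show False using s by simp
  qed
  have "Max (?v ` ?F) \<in> ?v ` ?F" by (rule Max_in) (use fin ne in blast)+
  then obtain k where k: "k \<in> ?F" "?v k = Max (?v ` ?F)" by (metis (no_types, lifting) imageE)
  have "?v j \<le> ?v k" for j
  proof (cases "j \<in> ?F")
    case True
    then show ?thesis using k(2) fin by simp
  qed (use k(1) in auto)
  then have "?s \<le> ?v k" by (rule fps_abs_least)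
  then have ex: "?v k = ?s" using fps_abs_upper[OF g(1,2), of k] by linarith
  let ?k = "LEAST k. ?v k = ?s"
  have "?v ?k = ?s" using ex by (rule LeastI)
  moreover have "?v j < ?s" if "j < ?k" for j
    using not_less_Least[OF that] fps_abs_upper[OF g(1,2), of j] by linarith
  ultimately show ?thesis by blast
qed

lemma fps_abs_add_le:
  assumes "entire f" "entire g" "r > 0"
  shows "fps_abs r (f + g) \<le> max (fps_abs r f) (fps_abs r g)"
proof (rule fps_abs_least)
  fix k
  have "absval (fps_nth (f + g) k) * r ^ k \<le> max (absval (fps_nth f k)) (absval (fps_nth g k)) * r ^ k"
    using assms(3) absval_add_le_max by (intro mult_right_mono) auto
  also have "\<dots> \<le> max (fps_abs r f) (fps_abs r g)"
    using fps_abs_upper[OF assms(1,3), of k] fps_abs_upper[OF assms(2,3), of k] by (auto simp: max_def)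
  finally show "absval (fps_nth (f + g) k) * r ^ k \<le> max (fps_abs r f) (fps_abs r g)" .
qed

lemma entire_const: "entire (fps_const c)"
proof (rule bounded_imp_entire)
  fix r :: real assume "r > 0"
  then have "absval (fps_nth (fps_const c) k) * r ^ k \<le> absval c" for k by (cases k) (auto simp: absval_nonneg)
  then show "\<exists>B. \<forall>k. absval (fps_nth (fps_const c) k) * r ^ k \<le> B" by blast
qed

lemma fps_abs_const: "r > 0 \<Longrightarrow> fps_abs r (fps_const c) = absval c"
proof (rule antisym)
  assume r: "r > 0"
  show "fps_abs r (fps_const c) \<le> absval c"
  proof (rule fps_abs_least)
    fix k show "absval (fps_nth (fps_const c) k) * r ^ k \<le> absval c" by (cases k) (auto simp: absval_nonneg)
  qed
  show "absval c \<le> fps_abs r (fps_const c)" using fps_abs_upper[OF entire_const r, of c 0] by simp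
qed

lemma entire_add:
  assumes "entire f" "entire g"
  shows "entire (f + g)"
proof (rule bounded_imp_entire)
  fix r :: real assume r: "r > 0"
  have "absval (fps_nth (f + g) k) * r ^ k \<le> fps_abs r f + fps_abs r g" for k
  proof -
    have "absval (fps_nth (f + g) k) * r ^ k \<le> (absval (fps_nth f k) + absval (fps_nth g k)) * r ^ k"
      using r absval_add_le by (intro mult_right_mono) auto
    then show ?thesis
      using fps_abs_upper[OF assms(1) r, of k] fps_abs_upper[OF assms(2) r, of k] by (simp add: distrib_right)
  qed
  then show "\<exists>B. \<forall>k. absval (fps_nth (f + g) k) * r ^ k \<le> B" by blast
qed

lemma fps_mult_nth_abs_le:
  assumes "entire f" "entire g" "r > 0"
  shows "absval (fps_nth (f * g) k) * r ^ k \<le> fps_abs r f * fps_abs r g"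
proof -
  have "absval (fps_nth (f * g) k) \<le> fps_abs r f * fps_abs r g / r ^ k"
    unfolding fps_mult_nth
  proof (rule absval_sum_le)
    fix i assume i: "i \<in> {0..k}"
    have "absval (fps_nth f i * fps_nth g (k - i)) * r ^ k =
        (absval (fps_nth f i) * r ^ i) * (absval (fps_nth g (k - i)) * r ^ (k - i))"
      using i by (simp add: absval_mult power_add[symmetric])
    also have "\<dots> \<le> fps_abs r f * fps_abs r g"
      using assms by (intro mult_mono fps_abs_upper fps_abs_nonneg) (auto simp: absval_nonneg)
    finally show "absval (fps_nth f i * fps_nth g (k - i)) \<le> fps_abs r f * fps_abs r g / r ^ k"
      using assms(3) by (simp add: field_simps)
  qed (use assms in \<open>simp add: fps_abs_nonneg\<close>)
  then show ?thesis using assms(3) by (simp add: field_simps)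
qed

lemma entire_mult: "entire f \<Longrightarrow> entire g \<Longrightarrow> entire (f * g)"
  by (rule bounded_imp_entire) (use fps_mult_nth_abs_le in blast)

text \<open>Gauss's lemma: the product of the two first maximal terms strictly dominates all other
  contributions to its coefficient.\<close>

lemma fps_abs_mult:
  assumes f: "entire f" and g: "entire g" and r: "r > 0"
  shows "fps_abs r (f * g) = fps_abs r f * fps_abs r g"
proof (cases "f = 0 \<or> g = 0")
  case True
  then show ?thesis using fps_abs_const[OF r, of 0] by auto
next
  case False
  obtain p where p: "absval (fps_nth f p) * r ^ p = fps_abs r f" "\<And>j. j < p \<Longrightarrow> absval (fps_nth f j) * r ^ j < fps_abs r f"
    using fps_abs_attained[OF f r] False by blast
  obtain q where q: "absval (fps_nth g q) * r ^ q = fps_abs r g" "\<And>j. j < q \<Longrightarrow> absval (fps_nth g j) * r ^ j < fps_abs r g"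
    using fps_abs_attained[OF g r] False by blast
  have pos: "fps_abs r f > 0" "fps_abs r g > 0" using False f g r fps_abs_pos by auto
  let ?t = "\<lambda>i. fps_nth f i * fps_nth g (p + q - i)"
  have main: "absval (?t p) * r ^ (p + q) = fps_abs r f * fps_abs r g"
    unfolding p(1)[symmetric] q(1)[symmetric] by (simp add: absval_mult power_add)
  have "absval (sum ?t ({0..p + q} - {p})) < absval (?t p)"
  proof (rule absval_sum_less)
    have "0 < absval (?t p) * r ^ (p + q)" unfolding main using pos by simp
    then show "0 < absval (?t p)" using r by (simp add: zero_less_mult_iff)
    fix i assume i: "i \<in> {0..p + q} - {p}"
    have "absval (?t i) * r ^ (p + q) = (absval (fps_nth f i) * r ^ i) * (absval (fps_nth g (p + q - i)) * r ^ (p + q - i))"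
      using i by (simp add: absval_mult power_add[symmetric])
    also have "\<dots> < fps_abs r f * fps_abs r g"
    proof (cases "i < p")
      case True
      have "(absval (fps_nth f i) * r ^ i) * (absval (fps_nth g (p + q - i)) * r ^ (p + q - i)) \<le>
          (absval (fps_nth f i) * r ^ i) * fps_abs r g"
        using r by (intro mult_left_mono fps_abs_upper[OF g r]) (simp add: absval_nonneg)
      also have "\<dots> < fps_abs r f * fps_abs r g" by (rule mult_strict_right_mono[OF p(2)[OF True] pos(2)])
      finally show ?thesis .
    next
      case False
      then have "p + q - i < q" using i by auto
      have "(absval (fps_nth f i) * r ^ i) * (absval (fps_nth g (p + q - i)) * r ^ (p + q - i)) \<le>
          fps_abs r f * (absval (fps_nth g (p + q - i)) * r ^ (p + q - i))"
        using r by (intro mult_right_mono fps_abs_upper[OF f r]) (simp add: absval_nonneg)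
      also have "\<dots> < fps_abs r f * fps_abs r g"
        by (rule mult_strict_left_mono[OF q(2)[OF \<open>p + q - i < q\<close>] pos(1)])
      finally show ?thesis .
    qed
    finally show "absval (?t i) < absval (?t p)" using r by (simp add: main[symmetric])
  qed
  then have "absval (?t p + sum ?t ({0..p + q} - {p})) = absval (?t p)" by (rule absval_add_eq)
  moreover have "fps_nth (f * g) (p + q) = ?t p + sum ?t ({0..p + q} - {p})"
    unfolding fps_mult_nth by (rule sum.remove) auto
  ultimately have "fps_abs r f * fps_abs r g = absval (fps_nth (f * g) (p + q)) * r ^ (p + q)"
    using main by simp
  also have "\<dots> \<le> fps_abs r (f * g)" by (rule fps_abs_upper[OF entire_mult[OF f g] r])
  finally show ?thesis
    using fps_abs_least[of "f * g" r, OF fps_mult_nth_abs_le[OF f g r]] by linarith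
qed

lemma subring1_entire: "subring1 {g. entire g}"
  unfolding subring1_def
proof (intro conjI ballI)
  show "1 \<in> {g :: 'a fps. entire g}" using entire_const[of 1] by simp
  show "- g \<in> {g :: 'a fps. entire g}" if "g \<in> {g. entire g}" for g
    using that entire_mult[OF entire_const[of "- 1"], of g] by (simp flip: fps_const_neg)
qed (auto intro: entire_add entire_mult)

lemma entire_power: "entire g \<Longrightarrow> entire (g ^ n)"
  using subring1D(6)[OF subring1_entire] by blast

lemma fps_abs_power:
  fixes g :: "'a::complete_nonarch_field fps"
  shows "entire g \<Longrightarrow> r > 0 \<Longrightarrow> fps_abs r (g ^ n) = fps_abs r g ^ n"
proof (induction n)
  case 0
  then show ?case using fps_abs_const[of r "1 :: 'a"] by simp
next
  case (Suc n)
  then show ?case by (simp add: fps_abs_mult entire_power)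
qed

lemma entire_mcomp: "(\<And>i. entire (f i)) \<Longrightarrow> entire (mcomp F f)"
  using msubst_in_subring[OF subring1_entire, of fps_const f F] unfolding mcomp_def by (simp add: entire_const)

section \<open>Values of entire functions at points\<close>

lemma tendsto_absval_iff: "(s \<longlongrightarrow> L) F \<longleftrightarrow> ((\<lambda>n. absval (s n - L)) \<longlongrightarrow> 0) F"
  for L :: "'k::complete_nonarch_field"
  by (subst tendsto_dist_iff) (simp add: dist_absval)

lemma tendsto_add_absval:
  fixes a b :: "'k::complete_nonarch_field"
  assumes "s \<longlonglongrightarrow> a" "t \<longlonglongrightarrow> b"
  shows "(\<lambda>n. s n + t n) \<longlonglongrightarrow> a + b"
  unfolding tendsto_absval_iff
proof (rule tendsto_sandwich[OF _ _ tendsto_const])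
  show "(\<lambda>n. absval (s n - a) + absval (t n - b)) \<longlonglongrightarrow> 0"
    using tendsto_add[OF assms[unfolded tendsto_absval_iff]] by simp
  have "absval (s n + t n - (a + b)) \<le> absval (s n - a) + absval (t n - b)" for n
    using absval_add_le[of "s n - a" "t n - b"] by (simp add: algebra_simps)
  then show "\<forall>\<^sub>F n in sequentially. absval (s n + t n - (a + b)) \<le> absval (s n - a) + absval (t n - b)" by simp
qed (simp add: absval_nonneg)

lemma tendsto_mult_absval:
  fixes a b :: "'k::complete_nonarch_field"
  assumes "s \<longlonglongrightarrow> a" "t \<longlonglongrightarrow> b"
  shows "(\<lambda>n. s n * t n) \<longlonglongrightarrow> a * b"
  unfolding tendsto_absval_iff
proof (rule tendsto_sandwich[OF _ _ tendsto_const])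
  let ?x = "\<lambda>n. absval (s n - a)" and ?y = "\<lambda>n. absval (t n - b)"
  have "(\<lambda>n. ?x n * ?y n + ?x n * absval b + absval a * ?y n) \<longlonglongrightarrow> 0 * 0 + 0 * absval b + absval a * 0"
    by (intro tendsto_add tendsto_mult tendsto_const assms[unfolded tendsto_absval_iff])
  then show "(\<lambda>n. ?x n * ?y n + ?x n * absval b + absval a * ?y n) \<longlonglongrightarrow> 0" by simp
  have "absval (s n * t n - a * b) \<le> ?x n * ?y n + ?x n * absval b + absval a * ?y n" for n
  proof -
    have "s n * t n - a * b = ((s n - a) * (t n - b) + (s n - a) * b) + a * (t n - b)" by (simp add: algebra_simps)
    then show ?thesis
      using absval_add_le[of "(s n - a) * (t n - b) + (s n - a) * b" "a * (t n - b)"]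
        absval_add_le[of "(s n - a) * (t n - b)" "(s n - a) * b"] by (simp add: absval_mult)
  qed
  then show "\<forall>\<^sub>F n in sequentially. absval (s n * t n - a * b) \<le> ?x n * ?y n + ?x n * absval b + absval a * ?y n" by simp
qed (simp add: absval_nonneg)

lemma entire_term_bound:
  assumes "entire g"
  shows "\<exists>B>0. \<forall>k. absval (fps_nth g k * z ^ k) \<le> B * (1 / 2) ^ k"
proof -
  \<comment> \<open>The summand 1 keeps the radius positive at \<open>z = 0\<close>.\<close>
  obtain B where B: "B > 0" "\<And>k. absval (fps_nth g k) * (absval z + 1) ^ k \<le> B * (1 / 2) ^ k"
    using entire_geometric_bound[OF assms, of "absval z + 1"] absval_nonneg[of z] by auto
  have "absval (fps_nth g k * z ^ k) \<le> absval (fps_nth g k) * (absval z + 1) ^ k" for k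
    unfolding absval_mult absval_power
    using absval_nonneg[of z] by (intro mult_left_mono power_mono) (auto simp: absval_nonneg)
  then show ?thesis using B order_trans by blast
qed

text \<open>By the ultrametric inequality a block of the series is at most the bound for its first
  term, which tends to 0; completeness then gives \<open>suminf\<close> its value.\<close>

lemma na_eval_limit:
  assumes "entire g"
  shows "(\<lambda>n. \<Sum>k<n. fps_nth g k * z ^ k) \<longlonglongrightarrow> na_eval g z"
proof -
  let ?S = "\<lambda>n. \<Sum>k<n. fps_nth g k * z ^ k"
  obtain B where B: "B > 0" "\<And>k. absval (fps_nth g k * z ^ k) \<le> B * (1 / 2) ^ k"
    using entire_term_bound[OF assms] by blast
  have d: "dist (?S m) (?S n) \<le> B * (1 / 2) ^ n" if "n \<le> m" for m n
  proof -
    have "?S m - ?S n = (\<Sum>k\<in>{..<m} - {..<n}. fps_nth g k * z ^ k)"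
      using that by (intro sum_diff[symmetric]) auto
    moreover have "absval (\<Sum>k\<in>{..<m} - {..<n}. fps_nth g k * z ^ k) \<le> B * (1 / 2) ^ n"
    proof (rule absval_sum_le)
      fix k assume "k \<in> {..<m} - {..<n}"
      then have "B * (1 / 2) ^ k \<le> B * (1 / 2) ^ n" using B(1) by (intro mult_left_mono power_decreasing) auto
      then show "absval (fps_nth g k * z ^ k) \<le> B * (1 / 2) ^ n" using B(2)[of k] by linarith
    qed (use B(1) in simp)
    ultimately show ?thesis by (simp add: dist_absval)
  qed
  have "Cauchy ?S"
  proof (rule metric_CauchyI)
    fix e :: real assume e: "e > 0"
    obtain N where N: "\<And>k. k \<ge> N \<Longrightarrow> B * (1 / 2) ^ k < e" using geometric_less[of "1 / 2" e B] e by auto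
    have "dist (?S m) (?S n) < e" if "m \<ge> N" "n \<ge> N" for m n
    proof (cases "n \<le> m")
      case True
      show ?thesis using d[OF True] N[OF that(2)] by linarith
    next
      case False
      then show ?thesis using d[of m n] N[OF that(1)] by (simp add: dist_commute)
    qed
    then show "\<exists>N. \<forall>m\<ge>N. \<forall>n\<ge>N. dist (?S m) (?S n) < e" by blast
  qed
  then obtain L where "?S \<longlonglongrightarrow> L" using Cauchy_convergent_iff convergent_def by blast
  then have "(\<lambda>k. fps_nth g k * z ^ k) sums L" unfolding sums_def .
  then have "na_eval g z = L" unfolding na_eval_def by (rule sums_unique[symmetric])
  then show ?thesis using \<open>?S \<longlonglongrightarrow> L\<close> by simp
qed

lemma na_eval_const: "na_eval (fps_const c) z = c"
proof -
  have "\<forall>\<^sub>F n in sequentially. (\<Sum>k<n. fps_nth (fps_const c) k * z ^ k) = c"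
    using eventually_gt_at_top[of 0]
  proof eventually_elim
    case (elim n)
    have "(\<Sum>k<n. fps_nth (fps_const c) k * z ^ k) = (\<Sum>k<n. if k = 0 then c else 0)" by (intro sum.cong) auto
    then show ?case using elim by simp
  qed
  then have "(\<lambda>n. \<Sum>k<n. fps_nth (fps_const c) k * z ^ k) \<longlonglongrightarrow> c" by (rule tendsto_eventually)
  then show ?thesis using LIMSEQ_unique na_eval_limit[OF entire_const] by blast
qed

lemma na_eval_add:
  assumes "entire f" "entire g"
  shows "na_eval (f + g) z = na_eval f z + na_eval g z"
proof -
  have "(\<lambda>n. \<Sum>k<n. fps_nth (f + g) k * z ^ k) \<longlonglongrightarrow> na_eval f z + na_eval g z"
    using tendsto_add_absval[OF na_eval_limit[OF assms(1)] na_eval_limit[OF assms(2)], of z z]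
    by (simp add: distrib_right sum.distrib)
  then show ?thesis using LIMSEQ_unique na_eval_limit[OF entire_add[OF assms]] by blast
qed

text \<open>The product of two partial sums differs from the partial sum of the Cauchy product by
  terms with \<open>i + j \<ge> n\<close>. Each is at most \<open>A * B / 2 ^ n\<close>, and by the
  ultrametric inequality so is their sum.\<close>

lemma na_eval_mult:
  assumes f: "entire f" and g: "entire g"
  shows "na_eval (f * g) z = na_eval f z * na_eval g z"
proof -
  let ?a = "\<lambda>k. fps_nth f k * z ^ k" and ?b = "\<lambda>k. fps_nth g k * z ^ k"
  let ?C = "\<lambda>n. \<Sum>k<n. fps_nth (f * g) k * z ^ k"
  obtain A where A: "A > 0" "\<And>k. absval (?a k) \<le> A * (1 / 2) ^ k" using entire_term_bound[OF f] by blast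
  obtain B where B: "B > 0" "\<And>k. absval (?b k) \<le> B * (1 / 2) ^ k" using entire_term_bound[OF g] by blast
  have C: "?C n = (\<Sum>(i, j)\<in>{(i, j). i + j < n}. ?a i * ?b j)" for n
  proof -
    have "?C n = (\<Sum>k<n. \<Sum>i\<le>k. ?a i * ?b (k - i))"
    proof (rule sum.cong[OF refl])
      fix k
      show "fps_nth (f * g) k * z ^ k = (\<Sum>i\<le>k. ?a i * ?b (k - i))"
        unfolding fps_mult_nth sum_distrib_right atLeast0AtMost
      proof (rule sum.cong[OF refl])
        fix i assume "i \<in> {..k}"
        then have "z ^ k = z ^ i * z ^ (k - i)" by (simp add: power_add[symmetric])
        then show "fps_nth f i * fps_nth g (k - i) * z ^ k = ?a i * ?b (k - i)" by simp
      qed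
    qed
    then show ?thesis by (simp add: sum.triangle_reindex)
  qed
  have bound: "absval ((\<Sum>k<n. ?a k) * (\<Sum>k<n. ?b k) - ?C n) \<le> A * B * (1 / 2) ^ n" for n
  proof -
    let ?T = "{(i, j). i + j < n}"
    have sub: "?T \<subseteq> {..<n} \<times> {..<n}" by auto
    have "(\<Sum>k<n. ?a k) * (\<Sum>k<n. ?b k) = (\<Sum>(i, j)\<in>{..<n} \<times> {..<n}. ?a i * ?b j)"
      by (simp add: sum_product sum.cartesian_product)
    then have "(\<Sum>k<n. ?a k) * (\<Sum>k<n. ?b k) - ?C n = (\<Sum>(i, j)\<in>{..<n} \<times> {..<n} - ?T. ?a i * ?b j)"
      unfolding C using sum_diff[OF _ sub, of "\<lambda>(i, j). ?a i * ?b j"] by simp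
    moreover have "absval (\<Sum>(i, j)\<in>{..<n} \<times> {..<n} - ?T. ?a i * ?b j) \<le> A * B * (1 / 2) ^ n"
    proof (rule absval_sum_le)
      fix p assume "p \<in> {..<n} \<times> {..<n} - ?T"
      then obtain i j where p: "p = (i, j)" "i + j \<ge> n" by auto
      have "absval (?a i * ?b j) \<le> (A * (1 / 2) ^ i) * (B * (1 / 2) ^ j)"
        unfolding absval_mult[of "?a i"] by (rule mult_mono[OF A(2) B(2)]) (use A in \<open>auto simp: absval_nonneg\<close>)
      also have "\<dots> = A * B * (1 / 2) ^ (i + j)" by (simp add: power_add)
      also have "\<dots> \<le> A * B * (1 / 2) ^ n" using A B p by (intro mult_left_mono power_decreasing) auto
      finally show "absval (case p of (i, j) \<Rightarrow> ?a i * ?b j) \<le> A * B * (1 / 2) ^ n" by (simp add: p)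
    qed (use A B in simp)
    ultimately show ?thesis by simp
  qed
  define d where "d n = ?C n - (\<Sum>k<n. ?a k) * (\<Sum>k<n. ?b k)" for n
  have d: "absval (d n) \<le> A * B * (1 / 2) ^ n" for n
    using bound[of n] absval_minus[of "d n"] by (simp add: d_def)
  have "(\<lambda>n. absval (d n)) \<longlonglongrightarrow> 0"
  proof (rule tendsto_sandwich[OF _ _ tendsto_const])
    have "(\<lambda>n. A * B * (1 / 2) ^ n) \<longlonglongrightarrow> A * B * 0" by (intro tendsto_intros LIMSEQ_realpow_zero) auto
    then show "(\<lambda>n. A * B * (1 / 2) ^ n) \<longlonglongrightarrow> 0" by simp
  qed (simp_all add: absval_nonneg d)
  then have "d \<longlonglongrightarrow> 0" unfolding tendsto_absval_iff[of d 0] by simp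
  then have "(\<lambda>n. ?C n - (\<Sum>k<n. ?a k) * (\<Sum>k<n. ?b k)) \<longlonglongrightarrow> 0" unfolding d_def .
  from tendsto_add_absval[OF this tendsto_mult_absval[OF na_eval_limit[OF f, of z] na_eval_limit[OF g, of z]]]
  have "?C \<longlonglongrightarrow> na_eval f z * na_eval g z" by simp
  then show ?thesis using LIMSEQ_unique na_eval_limit[OF entire_mult[OF f g]] by blast
qed

lemma na_eval_mcomp:
  assumes f: "\<And>i. entire (f i)"
  shows "na_eval (mcomp F f) z = meval (\<lambda>i. na_eval (f i) z) F"
proof (induction F rule: mpoly_induct)
  case (const a)
  show ?case by (simp add: mcomp_def msubst_const[OF rhom_fps_const] na_eval_const meval_const)
next
  case (var k)
  show ?case by (simp add: mcomp_def msubst_var[OF rhom_fps_const] meval_var)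
next
  case (add F G)
  then show ?case
    by (simp add: rhom.hom_add[OF rhom_mcomp] rhom.hom_add[OF rhom_meval] na_eval_add entire_mcomp[OF f])
next
  case (mult F G)
  then show ?case
    by (simp add: rhom.hom_mult[OF rhom_mcomp] rhom.hom_mult[OF rhom_meval] na_eval_mult entire_mcomp[OF f])
qed

text \<open>Otherwise the product of all linear factors, increased by 1, would be a nonconstant
  polynomial without roots.\<close>

lemma infinite_alg_closed: "infinite (UNIV :: 'k::alg_closed_field set)"
proof
  assume fin: "finite (UNIV :: 'k set)"
  let ?q = "\<Prod>a\<in>UNIV. [:- a, 1 :: 'k:]"
  have "degree ?q = card (UNIV :: 'k set)" by (subst degree_prod_eq_sum_degree) auto
  then have dq: "degree ?q > 0" using fin by (simp add: card_gt_0_iff)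
  then have "degree (?q + 1) = degree ?q" by (intro degree_add_eq_left) simp
  then obtain x where "poly (?q + 1) x = 0" using alg_closed_imp_poly_has_root dq by metis
  moreover have "poly ?q x = 0" using fin by (auto simp: poly_prod intro!: exI[of _ x])
  ultimately show False by simp
qed

text \<open>For the trivial absolute value an entire function is a polynomial.\<close>

lemma entire_eq_0:
  fixes g :: "'k::{complete_nonarch_field, alg_closed_field} fps"
  assumes g: "entire g" and zero: "\<And>z. na_eval g z = 0"
  shows "g = 0"
proof (cases "\<exists>x::'k. x \<noteq> 0 \<and> absval x \<noteq> 1")
  case False
  then have triv: "absval x = 1" if "x \<noteq> 0" for x :: 'k using that by blast
  have "finite {k. absval (fps_nth g k) * 1 ^ k \<ge> 1}" by (rule fps_abs_finite_large[OF g]) auto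
  moreover have "{k. fps_nth g k \<noteq> 0} \<subseteq> {k. absval (fps_nth g k) * 1 ^ k \<ge> 1}" using triv by auto
  ultimately have "finite {k. fps_nth g k \<noteq> 0}" by (rule rev_finite_subset)
  then obtain N where N: "\<And>k. fps_nth g k \<noteq> 0 \<Longrightarrow> k < N" by (metis (mono_tags) finite_nat_set_iff_bounded mem_Collect_eq)
  have N': "fps_nth g k = 0" if "k \<ge> N" for k using N[of k] that by force
  define p where "p = (\<Sum>k<N. monom (fps_nth g k) k)"
  have "poly p z = 0" for z
  proof -
    have "\<forall>\<^sub>F n in sequentially. (\<Sum>k<n. fps_nth g k * z ^ k) = poly p z"
      using eventually_ge_at_top[of N]
    proof eventually_elim
      case (elim n)
      have "(\<Sum>k<n. fps_nth g k * z ^ k) = (\<Sum>k<N. fps_nth g k * z ^ k)"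
        using elim N' by (intro sum.mono_neutral_right) auto
      then show ?case by (simp add: p_def poly_sum poly_monom)
    qed
    then have "(\<lambda>n. \<Sum>k<n. fps_nth g k * z ^ k) \<longlonglongrightarrow> poly p z" by (rule tendsto_eventually)
    then show ?thesis using LIMSEQ_unique na_eval_limit[OF g] zero by metis
  qed
  then have "p = 0" using poly_roots_finite[of p] infinite_alg_closed[where ?'k = 'k] by auto
  have "fps_nth g k = 0" for k
  proof (cases "k < N")
    case True
    then have "coeff p k = fps_nth g k" by (simp add: p_def coeff_sum coeff_monom)
    then show ?thesis using \<open>p = 0\<close> by simp
  qed (use N in blast)
  then show ?thesis by (simp add: fps_eq_iff)
next
  case True
  then obtain x0 :: 'k where x0: "x0 \<noteq> 0" "absval x0 \<noteq> 1" by blast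
  obtain x :: 'k where x: "x \<noteq> 0" "absval x < 1"
  proof (cases "absval x0 < 1")
    case False
    have "absval x0 * absval (inverse x0) = 1" using x0 absval_mult[of x0 "inverse x0"] by simp
    then have "absval (inverse x0) < 1"
      using False x0(2) mult_strict_left_mono[of 1 "absval (inverse x0)" "absval x0"]
        mult_left_mono[of 1 "absval (inverse x0)" "absval x0"] by linarith
    then show ?thesis using that[of "inverse x0"] x0 by simp
  qed (use that x0 in blast)
  show ?thesis
  proof (rule ccontr)
    assume "g \<noteq> 0"
    define d where "d = subdegree g"
    define c where "c = absval (fps_nth g d)"
    have c: "c > 0" using \<open>g \<noteq> 0\<close> by (simp add: c_def d_def absval_pos)
    define A where "A = fps_abs 1 g"
    have A: "absval (fps_nth g k) \<le> A" for k using fps_abs_upper[OF g, of 1 k] by (simp add: A_def)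
    \<comment> \<open>The point \<open>z\<close> is so small that the lowest nonzero term exceeds
      all later ones there. Then all long partial sums have the absolute value of that term,
      although their limit is 0.\<close>
    obtain m where m: "A * absval x ^ Suc m < c"
      using geometric_less[OF absval_nonneg x(2) c, of A] by (metis le_SucI order_refl)
    define z where "z = x ^ Suc m"
    have z: "z \<noteq> 0" "absval z < 1" "A * absval z < c"
      using x m power_Suc_less_one[OF absval_pos[OF x(1)] x(2), of m] by (simp_all add: z_def absval_mult absval_power)
    have z0: "absval z > 0" using z(1) by (rule absval_pos)
    have term_le: "absval (fps_nth g k * z ^ k) \<le> A * absval z * absval z ^ d" if "k > d" for k
    proof -
      have "absval (fps_nth g k * z ^ k) \<le> A * absval z ^ k"
        unfolding absval_mult absval_power by (intro mult_right_mono A) (simp add: absval_nonneg)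
      also have "\<dots> \<le> A * absval z ^ Suc d"
        using that z z0 A[of 0] absval_nonneg[of "fps_nth g 0"] by (intro mult_left_mono power_decreasing) auto
      finally show ?thesis by (simp add: mult_ac)
    qed
    have main: "absval (fps_nth g d * z ^ d) = c * absval z ^ d"
      unfolding absval_mult absval_power c_def ..
    have "absval (\<Sum>k<n. fps_nth g k * z ^ k) = c * absval z ^ d" if "n > d" for n
    proof -
      have "(\<Sum>k<n. fps_nth g k * z ^ k) = fps_nth g d * z ^ d + (\<Sum>k\<in>{..<n} - {d}. fps_nth g k * z ^ k)"
        using that by (intro sum.remove) auto
      moreover have "absval (\<Sum>k\<in>{..<n} - {d}. fps_nth g k * z ^ k) < absval (fps_nth g d * z ^ d)"
      proof (rule absval_sum_less)
        show pos: "0 < absval (fps_nth g d * z ^ d)"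
          unfolding main by (rule mult_pos_pos[OF c zero_less_power[OF z0]])
        fix k assume k: "k \<in> {..<n} - {d}"
        show "absval (fps_nth g k * z ^ k) < absval (fps_nth g d * z ^ d)"
        proof (cases "k < d")
          case True
          then have "fps_nth g k = 0" unfolding d_def by (rule nth_less_subdegree_zero)
          then show ?thesis using pos by (simp only: mult_zero_left absval_0)
        next
          case False
          then have "absval (fps_nth g k * z ^ k) \<le> A * absval z * absval z ^ d" using k term_le[of k] by simp
          also have "\<dots> < c * absval z ^ d" by (rule mult_strict_right_mono[OF z(3) zero_less_power[OF z0]])
          finally show ?thesis unfolding main .
        qed
      qed
      ultimately show ?thesis by (simp only: absval_add_eq main)
    qed
    then have "\<forall>\<^sub>F n in sequentially. absval ((\<Sum>k<n. fps_nth g k * z ^ k) - 0) = c * absval z ^ d"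
      by (intro eventually_mono[OF eventually_gt_at_top[of d]]) simp
    then have "(\<lambda>n. absval ((\<Sum>k<n. fps_nth g k * z ^ k) - 0)) \<longlonglongrightarrow> c * absval z ^ d" by (rule tendsto_eventually)
    moreover have "(\<lambda>n. absval ((\<Sum>k<n. fps_nth g k * z ^ k) - 0)) \<longlonglongrightarrow> 0"
      using na_eval_limit[OF g, of z] unfolding zero tendsto_absval_iff .
    ultimately show False using LIMSEQ_unique c z0 by fastforce
  qed
qed

section \<open>Evaluation at an analytic map\<close>

lemma rhom_fps_to_fls: "rhom (fps_to_fls :: 'k::field fps \<Rightarrow> 'k fls)"
  by unfold_locales (simp_all add: fls_times_fps_to_fls)

text \<open>Laurent series form a field, so the quotients \<open>f k / f i\<close> exist as soon as
  \<open>f i\<close> is not the zero series, wherever its zeros lie.\<close>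

definition chart_eval :: "('n::finite \<Rightarrow> 'k::field fps) \<Rightarrow> 'n \<Rightarrow> ('k, 'n) mpoly \<Rightarrow> 'k fls" where
  "chart_eval f i = msubst (\<lambda>a. fps_to_fls (fps_const a)) (\<lambda>k. fps_to_fls (f k) / fps_to_fls (f i))"

lemma rhom_fls_const: "rhom (\<lambda>a :: 'k::field. fps_to_fls (fps_const a))"
  by (rule rhom_comp[OF rhom_fps_to_fls rhom_fps_const])

lemma rhom_chart_eval: "rhom (chart_eval f i)"
  unfolding chart_eval_def by (rule rhom_msubst[OF rhom_fls_const])

lemma chart_eval_const: "chart_eval f i (mconst a) = fps_to_fls (fps_const a)"
  unfolding chart_eval_def by (rule msubst_const[OF rhom_fls_const])

lemma chart_eval_var: "chart_eval f i (mvar k) = fps_to_fls (f k) / fps_to_fls (f i)"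
  unfolding chart_eval_def by (rule msubst_var[OF rhom_fls_const])

lemma chart_eval_dehomogenize:
  assumes "f i \<noteq> 0" and F: "\<And>m. m \<in> keys F \<Longrightarrow> mon_degree m = d"
  shows "chart_eval f i (dehomogenize i F) * fps_to_fls (f i) ^ d = fps_to_fls (mcomp F f)"
proof -
  let ?c = "\<lambda>a. fps_to_fls (fps_const a)" and ?x = "\<lambda>k. fps_to_fls (f k) / fps_to_fls (f i)"
  have "?x(i := 1) = ?x" using assms(1) by (auto simp: fun_eq_iff)
  then have "chart_eval f i (dehomogenize i F) * fps_to_fls (f i) ^ d = fps_to_fls (f i) ^ d * msubst ?c ?x F"
    unfolding chart_eval_def msubst_dehomogenize[OF rhom_fls_const] by (simp add: mult.commute)
  also have "\<dots> = msubst ?c (\<lambda>k. fps_to_fls (f i) * ?x k) F" by (rule msubst_scale[OF F, symmetric])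
  also have "\<dots> = msubst ?c (\<lambda>k. fps_to_fls (f k)) F"
    by (rule msubst_cong) (use assms(1) in auto)
  also have "\<dots> = fps_to_fls (mcomp F f)"
    unfolding mcomp_def by (rule rhom_msubst_comp[OF rhom_fps_to_fls rhom_fps_const, symmetric])
  finally show ?thesis .
qed

text \<open>Clearing denominators turns the formal value into an entire function, whose values at
  points are tied to those of \<open>p\<close> at the affine coordinates. The exponent is left open,
  so that sums and products simply add exponents.\<close>

lemma chart_eval_values:
  assumes f: "\<And>k. entire (f k)" and i: "f i \<noteq> 0"
  shows "\<exists>N e. entire e \<and> chart_eval f i p * fps_to_fls (f i) ^ N = fps_to_fls e \<and>
    (\<forall>z. na_eval (f i) z \<noteq> 0 \<longrightarrow> na_eval e z = na_eval (f i) z ^ N * meval (\<lambda>k. na_eval (f k) z / na_eval (f i) z) p)"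
proof -
  let ?F = "fps_to_fls (f i)" and ?ev = "\<lambda>z. meval (\<lambda>k. na_eval (f k) z / na_eval (f i) z)"
  have F: "?F \<noteq> 0" using i by simp
  have pw: "na_eval (f i ^ N) z = na_eval (f i) z ^ N" for N z
  proof (induction N)
    case 0
    then show ?case using na_eval_const[of 1 z] by simp
  next
    case (Suc N)
    then show ?case by (simp add: na_eval_mult f entire_power)
  qed
  show ?thesis
  proof (induction p rule: mpoly_induct)
    case (const a)
    show ?case
      by (intro exI[of _ 0] exI[of _ "fps_const a"])
         (simp add: entire_const chart_eval_const na_eval_const meval_const)
  next
    case (var k)
    show ?case
      by (intro exI[of _ 1] exI[of _ "f k"]) (use F in \<open>simp add: f chart_eval_var meval_var\<close>)
  next
    case (add p q)
    obtain N e where e: "entire e" "chart_eval f i p * ?F ^ N = fps_to_fls e"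
      "\<And>z. na_eval (f i) z \<noteq> 0 \<Longrightarrow> na_eval e z = na_eval (f i) z ^ N * ?ev z p"
      using add(1) by blast
    obtain N' e' where e': "entire e'" "chart_eval f i q * ?F ^ N' = fps_to_fls e'"
      "\<And>z. na_eval (f i) z \<noteq> 0 \<Longrightarrow> na_eval e' z = na_eval (f i) z ^ N' * ?ev z q"
      using add(2) by blast
    have "chart_eval f i (p + q) * ?F ^ (N + N') = fps_to_fls (e * f i ^ N' + e' * f i ^ N)"
      by (simp add: rhom.hom_add[OF rhom_chart_eval] rhom.hom_simps[OF rhom_fps_to_fls] e(2)[symmetric] e'(2)[symmetric] power_add algebra_simps)
    moreover have "na_eval (e * f i ^ N' + e' * f i ^ N) z = na_eval (f i) z ^ (N + N') * ?ev z (p + q)"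
      if "na_eval (f i) z \<noteq> 0" for z
      using that by (simp add: na_eval_add na_eval_mult entire_mult entire_power f e(1) e'(1) e(3) e'(3) pw
          rhom.hom_add[OF rhom_meval] power_add algebra_simps)
    moreover have "entire (e * f i ^ N' + e' * f i ^ N)"
      by (intro entire_add entire_mult entire_power f e(1) e'(1))
    ultimately show ?case by blast
  next
    case (mult p q)
    obtain N e where e: "entire e" "chart_eval f i p * ?F ^ N = fps_to_fls e"
      "\<And>z. na_eval (f i) z \<noteq> 0 \<Longrightarrow> na_eval e z = na_eval (f i) z ^ N * ?ev z p"
      using mult(1) by blast
    obtain N' e' where e': "entire e'" "chart_eval f i q * ?F ^ N' = fps_to_fls e'"
      "\<And>z. na_eval (f i) z \<noteq> 0 \<Longrightarrow> na_eval e' z = na_eval (f i) z ^ N' * ?ev z q"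
      using mult(2) by blast
    have "chart_eval f i (p * q) * ?F ^ (N + N') = fps_to_fls (e * e')"
      by (simp add: rhom.hom_mult[OF rhom_chart_eval] rhom.hom_mult[OF rhom_fps_to_fls] e(2)[symmetric] e'(2)[symmetric] power_add algebra_simps)
    moreover have "na_eval (e * e') z = na_eval (f i) z ^ (N + N') * ?ev z (p * q)"
      if "na_eval (f i) z \<noteq> 0" for z
      using that by (simp add: na_eval_mult e(1) e'(1) e(3) e'(3) rhom.hom_mult[OF rhom_meval] power_add algebra_simps)
    moreover have "entire (e * e')" by (intro entire_mult e(1) e'(1))
    ultimately show ?case by blast
  qed
qed

lemma analytic_map_entire: "analytic_map f X \<Longrightarrow> entire (f k)"
  by (simp add: analytic_map_def)

text \<open>Where \<open>f i\<close> does not vanish, the affine coordinates of \<open>f\<close> lie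
  on \<open>X\<close>, so \<open>p\<close> vanishes there, and the identity theorem for entire
  functions applies.\<close>

lemma chart_eval_variety:
  fixes f :: "'n::finite \<Rightarrow> 'k::{complete_nonarch_field, alg_closed_field} fps"
  assumes f: "analytic_map f X" and i: "f i \<noteq> 0" and p: "p \<in> variety_scheme X i"
  shows "chart_eval f i p = 0"
proof -
  note ent = analytic_map_entire[OF f]
  obtain N e where e: "entire e" "chart_eval f i p * fps_to_fls (f i) ^ N = fps_to_fls e"
      "\<And>z. na_eval (f i) z \<noteq> 0 \<Longrightarrow> na_eval e z = na_eval (f i) z ^ N * meval (\<lambda>k. na_eval (f k) z / na_eval (f i) z) p"
    using chart_eval_values[of f i p, OF ent i] by blast
  \<comment> \<open>The extra factor \<open>f i\<close> covers the zeros of \<open>f i\<close>, at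
    which nothing is known about \<open>e\<close>.\<close>
  have "na_eval (e * f i) z = 0" for z
  proof (cases "na_eval (f i) z = 0")
    case False
    let ?x = "\<lambda>k. na_eval (f k) z / na_eval (f i) z"
    have "proj_point (\<lambda>k. inverse (na_eval (f i) z) * na_eval (f k) z) = map_point f z"
      unfolding map_point_def using False by (intro proj_point_scale) simp
    then have "proj_point ?x \<in> X" using f by (simp add: divide_inverse mult.commute analytic_map_def)
    then have "meval ?x p = 0" using p False unfolding variety_scheme_def by auto
    then show ?thesis using e(3)[OF False] by (simp add: na_eval_mult e(1) ent)
  qed (simp add: na_eval_mult e(1) ent)
  then have "e * f i = 0" by (intro entire_eq_0 entire_mult e(1) ent)
  then have "e = 0" using i by simp
  then show ?thesis using e(2) i by simp
qed

section \<open>Size of chart functions along f\<close>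

lemma fps_abs_le_map_abs: "fps_abs r (f k) \<le> map_abs r f"
  unfolding map_abs_def by (rule Max_ge) auto

lemma map_abs_attained: "\<exists>i. fps_abs r (f i) = map_abs r f"
proof -
  have "map_abs r f \<in> range (\<lambda>i. fps_abs r (f i))" unfolding map_abs_def by (rule Max_in) auto
  then show ?thesis by auto
qed

text \<open>Expresses that the value of \<open>p\<close> along \<open>f\<close> has size at most
  \<open>C * \<beta> r\<close> at the radii where \<open>f i\<close> is the largest component.
  Denominators are cleared because \<open>fps_abs\<close> is defined on power series;
  \<open>C\<close> does not depend on \<open>r\<close>.\<close>

definition chart_bounded ::
  "('n::finite \<Rightarrow> 'k::complete_nonarch_field fps) \<Rightarrow> 'n \<Rightarrow> (real \<Rightarrow> real) \<Rightarrow> ('k, 'n) mpoly \<Rightarrow> bool" where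
  "chart_bounded f i \<beta> p \<longleftrightarrow> (\<exists>N e C. entire e \<and> chart_eval f i p * fps_to_fls (f i) ^ N = fps_to_fls e \<and> 0 \<le> C \<and>
     (\<forall>r\<ge>1. fps_abs r (f i) = map_abs r f \<longrightarrow> fps_abs r e \<le> C * \<beta> r * fps_abs r (f i) ^ N))"

context
  fixes f :: "'n::finite \<Rightarrow> 'k::complete_nonarch_field fps" and i :: 'n
  assumes f: "\<And>k. entire (f k)" and i: "f i \<noteq> 0"
begin

lemma chart_boundedI:
  assumes "entire e" "chart_eval f i p * fps_to_fls (f i) ^ N = fps_to_fls e" "0 \<le> C"
    "\<And>r. r \<ge> 1 \<Longrightarrow> fps_abs r (f i) = map_abs r f \<Longrightarrow> fps_abs r e \<le> C * \<beta> r * fps_abs r (f i) ^ N"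
  shows "chart_bounded f i \<beta> p"
  unfolding chart_bounded_def using assms by blast

lemma chart_bounded_add:
  assumes \<beta>: "\<And>r. r \<ge> 1 \<Longrightarrow> 0 \<le> \<beta> r" and "chart_bounded f i \<beta> p" "chart_bounded f i \<beta> q"
  shows "chart_bounded f i \<beta> (p + q)"
proof -
  let ?F = "fps_to_fls (f i)"
  obtain N e C where e: "entire e" "chart_eval f i p * ?F ^ N = fps_to_fls e" "0 \<le> C"
    "\<And>r. r \<ge> 1 \<Longrightarrow> fps_abs r (f i) = map_abs r f \<Longrightarrow> fps_abs r e \<le> C * \<beta> r * fps_abs r (f i) ^ N"
    using assms(2) unfolding chart_bounded_def by blast
  obtain N' e' C' where e': "entire e'" "chart_eval f i q * ?F ^ N' = fps_to_fls e'" "0 \<le> C'"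
    "\<And>r. r \<ge> 1 \<Longrightarrow> fps_abs r (f i) = map_abs r f \<Longrightarrow> fps_abs r e' \<le> C' * \<beta> r * fps_abs r (f i) ^ N'"
    using assms(3) unfolding chart_bounded_def by blast
  show ?thesis
  proof (rule chart_boundedI[where N = "N + N'" and e = "e * f i ^ N' + e' * f i ^ N" and C = "C + C'"])
    show "entire (e * f i ^ N' + e' * f i ^ N)" by (intro entire_add entire_mult entire_power f e(1) e'(1))
    show "chart_eval f i (p + q) * ?F ^ (N + N') = fps_to_fls (e * f i ^ N' + e' * f i ^ N)"
      by (simp add: rhom.hom_add[OF rhom_chart_eval] rhom.hom_simps[OF rhom_fps_to_fls] e(2)[symmetric] e'(2)[symmetric] power_add algebra_simps)
    fix r :: real assume r: "r \<ge> 1" "fps_abs r (f i) = map_abs r f"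
    then have r0: "r > 0" by simp
    let ?n = "fps_abs r (f i)"
    have n: "?n \<ge> 0" by (rule fps_abs_nonneg[OF f r0])
    have "fps_abs r (e * f i ^ N') \<le> C * \<beta> r * ?n ^ N * ?n ^ N'"
      using e(4)[OF r] n by (simp add: fps_abs_mult fps_abs_power e(1) entire_power f r0 mult_right_mono)
    moreover have "fps_abs r (e' * f i ^ N) \<le> C' * \<beta> r * ?n ^ N' * ?n ^ N"
      using e'(4)[OF r] n by (simp add: fps_abs_mult fps_abs_power e'(1) entire_power f r0 mult_right_mono)
    moreover have "0 \<le> C * \<beta> r * ?n ^ (N + N')" "0 \<le> C' * \<beta> r * ?n ^ (N + N')"
      using e(3) e'(3) \<beta>[OF r(1)] n by simp_all
    moreover have "fps_abs r (e * f i ^ N' + e' * f i ^ N) \<le> max (fps_abs r (e * f i ^ N')) (fps_abs r (e' * f i ^ N))"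
      by (intro fps_abs_add_le entire_mult entire_power f e(1) e'(1) r0)
    ultimately show "fps_abs r (e * f i ^ N' + e' * f i ^ N) \<le> (C + C') * \<beta> r * ?n ^ (N + N')"
      by (simp add: power_add algebra_simps max_def split: if_splits)
  qed (use e(3) e'(3) in simp)
qed

text \<open>Together with \<open>chart_bounded_1\<close> this makes the polynomials bounded by
  \<beta> closed under arbitrary multiples, hence an ideal.\<close>

lemma chart_bounded_mult:
  assumes "chart_bounded f i (\<lambda>_. 1) p" "chart_bounded f i \<beta> q"
  shows "chart_bounded f i \<beta> (p * q)"
proof -
  let ?F = "fps_to_fls (f i)"
  obtain N e C where e: "entire e" "chart_eval f i p * ?F ^ N = fps_to_fls e" "0 \<le> C"
    "\<And>r. r \<ge> 1 \<Longrightarrow> fps_abs r (f i) = map_abs r f \<Longrightarrow> fps_abs r e \<le> C * 1 * fps_abs r (f i) ^ N"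
    using assms(1) unfolding chart_bounded_def by blast
  obtain N' e' C' where e': "entire e'" "chart_eval f i q * ?F ^ N' = fps_to_fls e'" "0 \<le> C'"
    "\<And>r. r \<ge> 1 \<Longrightarrow> fps_abs r (f i) = map_abs r f \<Longrightarrow> fps_abs r e' \<le> C' * \<beta> r * fps_abs r (f i) ^ N'"
    using assms(2) unfolding chart_bounded_def by blast
  show ?thesis
  proof (rule chart_boundedI[where N = "N + N'" and e = "e * e'" and C = "C * C'"])
    show "chart_eval f i (p * q) * ?F ^ (N + N') = fps_to_fls (e * e')"
      by (simp add: rhom.hom_mult[OF rhom_chart_eval] rhom.hom_mult[OF rhom_fps_to_fls] e(2)[symmetric] e'(2)[symmetric] power_add algebra_simps)
    fix r :: real assume r: "r \<ge> 1" "fps_abs r (f i) = map_abs r f"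
    then have r0: "r > 0" by simp
    have "fps_abs r (e * e') = fps_abs r e * fps_abs r e'" by (rule fps_abs_mult[OF e(1) e'(1) r0])
    also have "\<dots> \<le> (C * 1 * fps_abs r (f i) ^ N) * (C' * \<beta> r * fps_abs r (f i) ^ N')"
      using e(3) by (intro mult_mono e(4) e'(4) r) (auto intro!: mult_nonneg_nonneg zero_le_power fps_abs_nonneg e'(1) f r0)
    finally show "fps_abs r (e * e') \<le> C * C' * \<beta> r * fps_abs r (f i) ^ (N + N')"
      by (simp add: power_add mult_ac)
  qed (use e e' in \<open>auto intro: entire_mult\<close>)
qed

text \<open>The variables go to \<open>f k / f i\<close>, of size at most 1 at the radii considered,
  and constants keep their absolute value.\<close>

lemma chart_bounded_1: "chart_bounded f i (\<lambda>_. 1) p"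
proof (induction p rule: mpoly_induct)
  case (const a)
  show ?case
    by (rule chart_boundedI[where N = 0 and e = "fps_const a" and C = "absval a"])
       (auto simp: entire_const chart_eval_const absval_nonneg fps_abs_const)
next
  case (var k)
  show ?case
    by (rule chart_boundedI[where N = 1 and e = "f k" and C = 1])
       (use i fps_abs_le_map_abs[of _ f k] in \<open>auto simp: f chart_eval_var\<close>)
qed (auto intro: chart_bounded_add chart_bounded_mult)

text \<open>Denominators are cleared twice, through the homogeneity of \<open>G\<close> and through
  the power \<open>N\<close>; by multiplicativity of the norm the powers of \<open>f i\<close>
  cancel in the comparison.\<close>

lemma chart_bounded_power:
  assumes b: "chart_bounded f i \<beta> (dehomogenize i G ^ k)"
    and G: "\<And>m. m \<in> keys G \<Longrightarrow> mon_degree m = d"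
  shows "\<exists>C\<ge>0. \<forall>r\<ge>1. fps_abs r (f i) = map_abs r f \<longrightarrow>
    fps_abs r (mcomp G f) ^ k \<le> C * \<beta> r * map_abs r f ^ (k * d)"
proof -
  let ?F = "fps_to_fls (f i)" and ?G = "mcomp G f"
  obtain N e C where e: "entire e" "chart_eval f i (dehomogenize i G ^ k) * ?F ^ N = fps_to_fls e" "0 \<le> C"
    "\<And>r. r \<ge> 1 \<Longrightarrow> fps_abs r (f i) = map_abs r f \<Longrightarrow> fps_abs r e \<le> C * \<beta> r * fps_abs r (f i) ^ N"
    using b unfolding chart_bounded_def by blast
  have ce: "chart_eval f i (dehomogenize i G) * ?F ^ d = fps_to_fls ?G"
    by (rule chart_eval_dehomogenize[of f i, OF i G])
  have "fps_to_fls (e * f i ^ (k * d)) = chart_eval f i (dehomogenize i G ^ k) * ?F ^ N * (?F ^ d) ^ k"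
    by (simp add: rhom.hom_simps[OF rhom_fps_to_fls] e(2) power_mult[symmetric] mult.commute[of k])
  also have "\<dots> = (chart_eval f i (dehomogenize i G) * ?F ^ d) ^ k * ?F ^ N"
    by (simp add: rhom.hom_power[OF rhom_chart_eval] power_mult_distrib mult_ac)
  also have "\<dots> = fps_to_fls (?G ^ k * f i ^ N)"
    by (simp only: ce rhom.hom_mult[OF rhom_fps_to_fls] rhom.hom_power[OF rhom_fps_to_fls])
  finally have eq: "e * f i ^ (k * d) = ?G ^ k * f i ^ N" by simp
  have "fps_abs r ?G ^ k \<le> C * \<beta> r * map_abs r f ^ (k * d)" if r: "r \<ge> 1" "fps_abs r (f i) = map_abs r f" for r
  proof -
    have r0: "r > 0" using r by simp
    have n: "fps_abs r (f i) > 0" by (rule fps_abs_pos[OF f r0 i])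
    have "fps_abs r (?G ^ k * f i ^ N) = fps_abs r (e * f i ^ (k * d))" by (simp add: eq)
    then have "fps_abs r ?G ^ k * fps_abs r (f i) ^ N = fps_abs r e * fps_abs r (f i) ^ (k * d)"
      by (simp add: fps_abs_mult fps_abs_power e(1) entire_mcomp entire_power f r0)
    also have "\<dots> \<le> (C * \<beta> r * fps_abs r (f i) ^ N) * fps_abs r (f i) ^ (k * d)"
      using e(4)[OF r] n by (intro mult_right_mono) auto
    finally have "fps_abs r ?G ^ k * fps_abs r (f i) ^ N \<le> (C * \<beta> r * fps_abs r (f i) ^ (k * d)) * fps_abs r (f i) ^ N"
      by (simp add: mult_ac)
    then show ?thesis using n r(2) by simp
  qed
  then show ?thesis using e(3) by blast
qed

end

lemma map_abs_pos:
  assumes f: "analytic_map f X" and r: "r > 0"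
  shows "map_abs r f > 0"
proof -
  note ent = analytic_map_entire[OF f]
  obtain i where "na_eval (f i) 0 \<noteq> 0" using f unfolding analytic_map_def by blast
  then have "f i \<noteq> 0" using na_eval_const[of 0 0] by auto
  then have "fps_abs r (f i) > 0" by (intro fps_abs_pos ent r)
  then show ?thesis using fps_abs_le_map_abs[of r f i] by linarith
qed

lemma map_abs_mono:
  assumes f: "\<And>k. entire (f k)" and r: "r \<ge> 1"
  shows "map_abs 1 f \<le> map_abs r f"
  using map_abs_attained[of 1 f] fps_abs_mono[OF f r] fps_abs_le_map_abs[of r f] by (metis order_trans)

text \<open>Let \<beta> be the largest normalised size of the forms \<open>D l\<close> along
  \<open>f\<close>. The polynomials bounded by \<beta> form an ideal that contains all generators of
  the section, those coming from \<open>X\<close> having value 0, so membership of the power of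
  \<open>G\<close> already gives its bound. Only \<open>l\<close> varies with \<open>r\<close>, not
  the constant.\<close>

lemma section_power_estimate:
  fixes f :: "'n::finite \<Rightarrow> 'k::{complete_nonarch_field, alg_closed_field} fps"
  assumes f: "analytic_map f X" and I: "finite I" "I \<noteq> {}"
    and D: "\<And>l. l \<in> I \<Longrightarrow> homogeneous (D l)"
    and G: "\<And>m. m \<in> keys G \<Longrightarrow> mon_degree m = d"
    and mem: "\<And>i. dehomogenize i G ^ k \<in> scheme_section D X I i"
  shows "\<exists>C\<ge>0. \<forall>r\<ge>1. \<exists>l\<in>I. fps_abs r (mcomp G f) ^ k * map_abs r f ^ total_degree (D l) \<le>
    C * map_abs r f ^ (k * d) * fps_abs r (mcomp (D l) f)"
proof -
  note ent = analytic_map_entire[OF f]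
  let ?\<rho> = "\<lambda>r l. fps_abs r (mcomp (D l) f) / map_abs r f ^ total_degree (D l)"
  define \<beta> where "\<beta> r = Max ((\<lambda>l. ?\<rho> r l) ` I)" for r
  have \<beta>_ge: "?\<rho> r l \<le> \<beta> r" if "l \<in> I" for r l
    unfolding \<beta>_def using I that by (intro Max_ge) auto
  have \<beta>_in: "\<exists>l\<in>I. \<beta> r = ?\<rho> r l" for r
  proof -
    have "\<beta> r \<in> (\<lambda>l. ?\<rho> r l) ` I"
      unfolding \<beta>_def by (rule Max_in) (use I in auto)
    then show ?thesis by (elim imageE) blast
  qed
  have \<beta>0: "0 \<le> \<beta> r" if r: "r \<ge> 1" for r
  proof -
    obtain l where "\<beta> r = ?\<rho> r l" using \<beta>_in by blast
    then show ?thesis using map_abs_pos[OF f, of r] fps_abs_nonneg[OF entire_mcomp[of f "D l", OF ent], of r] r by simp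
  qed
  have "\<exists>C\<ge>0. \<forall>r\<ge>1. fps_abs r (f i) = map_abs r f \<longrightarrow> fps_abs r (mcomp G f) ^ k \<le> C * \<beta> r * map_abs r f ^ (k * d)" for i
  proof (cases "f i = 0")
    case True
    \<comment> \<open>A zero component is never the largest one.\<close>
    have "fps_abs r (f i) \<noteq> map_abs r f" if "r \<ge> 1" for r
      using True map_abs_pos[OF f, of r] fps_abs_const[of r "0::'k"] that by simp
    then show ?thesis by auto
  next
    case False
    let ?J = "{p \<in> chart i. chart_bounded f i \<beta> p}"
    have zero: "chart_bounded f i \<beta> p" if "chart_eval f i p = 0" for p
      by (rule chart_boundedI[of f i, OF ent False, where N = 0 and e = 0 and C = 0])
         (use that entire_const[of "0::'k"] fps_abs_const[of _ "0::'k"] in auto)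
    have "ideal ?J (chart_ring i)"
    proof (rule chart_idealI)
      show "0 \<in> ?J"
        using zero[of 0] subring1D(2)[OF subring1_pvars] by (auto simp: rhom.hom_zero[OF rhom_chart_eval])
      show "x + y \<in> ?J" if "x \<in> ?J" "y \<in> ?J" for x y
        using that \<beta>0 by (auto intro: chart_bounded_add[of f i, OF ent False] subring1D[OF subring1_pvars])
      show "a * x \<in> ?J" if "a \<in> chart i" "x \<in> ?J" for a x
        using that by (auto intro: chart_bounded_mult[of f i, OF ent False] chart_bounded_1[of f i, OF ent False] subring1D[OF subring1_pvars])
    qed auto
    moreover have "variety_scheme X i \<subseteq> ?J"
      using zero chart_eval_variety[OF f False] by (auto simp: variety_scheme_def carrier_chart)
    moreover have "dehomogenize i (D l) \<in> ?J" if l: "l \<in> I" for l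
    proof -
      have "chart_bounded f i \<beta> (dehomogenize i (D l))"
      proof (rule chart_boundedI[of f i, OF ent False, where N = "total_degree (D l)" and e = "mcomp (D l) f" and C = 1])
        show "chart_eval f i (dehomogenize i (D l)) * fps_to_fls (f i) ^ total_degree (D l) = fps_to_fls (mcomp (D l) f)"
          by (rule chart_eval_dehomogenize[of f i, OF False]) (use D[OF l] in \<open>simp add: homogeneous_def\<close>)
        fix r :: real assume r: "r \<ge> 1" "fps_abs r (f i) = map_abs r f"
        then show "fps_abs r (mcomp (D l) f) \<le> 1 * \<beta> r * fps_abs r (f i) ^ total_degree (D l)"
          using \<beta>_ge[OF l, of r] map_abs_pos[OF f, of r] by (simp add: field_simps)
      qed (simp_all add: entire_mcomp ent)
      then show ?thesis by (simp add: dehomogenize_in_chart)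
    qed
    ultimately have "scheme_section D X I i \<subseteq> ?J" by (rule section_minimal)
    then have "chart_bounded f i \<beta> (dehomogenize i G ^ k)" using mem by blast
    then show ?thesis by (rule chart_bounded_power[of f i, OF ent False _ G])
  qed
  then obtain C where C0: "\<And>i. C i \<ge> 0" and C: "\<And>i r. r \<ge> 1 \<Longrightarrow> fps_abs r (f i) = map_abs r f \<Longrightarrow>
      fps_abs r (mcomp G f) ^ k \<le> C i * \<beta> r * map_abs r f ^ (k * d)" by metis
  \<comment> \<open>The chart depends on \<open>r\<close>; the sum of the constants of all charts
    serves for every \<open>r\<close>.\<close>
  have "\<exists>l\<in>I. fps_abs r (mcomp G f) ^ k * map_abs r f ^ total_degree (D l) \<le>
      (\<Sum>i\<in>UNIV. C i) * map_abs r f ^ (k * d) * fps_abs r (mcomp (D l) f)" if r: "r \<ge> 1" for r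
  proof -
    have pos: "map_abs r f > 0" using map_abs_pos[OF f] r by simp
    obtain i where i: "fps_abs r (f i) = map_abs r f" using map_abs_attained by blast
    obtain l where l: "l \<in> I" "\<beta> r = ?\<rho> r l" using \<beta>_in by blast
    have "fps_abs r (mcomp G f) ^ k \<le> C i * \<beta> r * map_abs r f ^ (k * d)" by (rule C[OF r i])
    also have "\<dots> \<le> (\<Sum>i\<in>UNIV. C i) * \<beta> r * map_abs r f ^ (k * d)"
      using C0 pos \<beta>0[OF r] by (intro mult_right_mono member_le_sum) auto
    finally have "fps_abs r (mcomp G f) ^ k * map_abs r f ^ total_degree (D l) \<le>
      (\<Sum>i\<in>UNIV. C i) * map_abs r f ^ (k * d) * fps_abs r (mcomp (D l) f)"
      using pos by (simp add: l(2) field_simps)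
    then show ?thesis using l(1) by blast
  qed
  then show ?thesis using C0 by (intro exI[of _ "\<Sum>i\<in>UNIV. C i"]) (auto intro: sum_nonneg)
qed

section \<open>Distances to finitely many points\<close>

lemma mcomp_const: "mcomp (mconst a) f = fps_const a"
  unfolding mcomp_def by (rule msubst_const[OF rhom_fps_const])

lemma mcomp_var: "mcomp (mvar k) f = f k"
  unfolding mcomp_def by (rule msubst_var[OF rhom_fps_const])

lemma mcomp_lin_form: "mcomp (lin_form v a b) f = fps_const (v a) * f b - fps_const (v b) * f a"
  by (simp add: lin_form_def rhom.hom_simps[OF rhom_mcomp] mcomp_const mcomp_var)

lemma keys_prod_degree:
  assumes "\<And>v m. v \<in> V \<Longrightarrow> m \<in> keys (g v) \<Longrightarrow> mon_degree m = 1"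
    and "finite V" "m \<in> keys (prod g V)"
  shows "mon_degree m = card V"
  using assms(2,1,3)
proof (induction arbitrary: m)
  case empty
  then show ?case by (simp add: mon_degree_def)
next
  case (insert v V)
  then obtain a b where "m = a + b" "a \<in> keys (g v)" "b \<in> keys (prod g V)"
    using keys_mult[of "g v" "prod g V"] by auto
  moreover have "mon_degree b = card V"
    using insert.prems(1) by (intro insert.IH[OF _ \<open>b \<in> _\<close>]) blast
  moreover have "mon_degree a = 1" using insert.prems(1) \<open>a \<in> _\<close> by blast
  ultimately show ?case using insert.hyps by (simp add: mon_degree_add)
qed

lemma finite_uniform_pos:
  fixes P :: "'a \<Rightarrow> real \<Rightarrow> bool"
  assumes "finite A" "\<And>a. a \<in> A \<Longrightarrow> \<exists>c>0. P a c" "\<And>a c c'. P a c \<Longrightarrow> c' \<le> c \<Longrightarrow> P a c'"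
  shows "\<exists>c>0. \<forall>a\<in>A. P a c"
  using assms(1,2)
proof induction
  case empty
  show ?case by (intro exI[of _ 1]) simp
next
  case (insert a A)
  then obtain c where "c > 0" "\<forall>a\<in>A. P a c" by auto
  moreover obtain c' where "c' > 0" "P a c'" using insert.prems by blast
  ultimately show ?case by (intro exI[of _ "min c c'"]) (auto intro: assms(3))
qed

text \<open>The minors attached to two distinct points together determine all components of
  \<open>f\<close> linearly with constant coefficients, so the largest of them dominates |f|_r up to
  a constant.\<close>

lemma two_points_bound:
  fixes f :: "'n::finite \<Rightarrow> 'k::complete_nonarch_field fps"
  assumes f: "\<And>k. entire (f k)" and v: "\<exists>i. v i \<noteq> 0" and w: "\<exists>i. w i \<noteq> 0" and ne: "proj_point w \<noteq> proj_point v"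
  shows "\<exists>c>0. \<forall>r\<ge>1. \<exists>a b. c * map_abs r f \<le> fps_abs r (mcomp (lin_form v a b) f) \<or>
     c * map_abs r f \<le> fps_abs r (mcomp (lin_form w a b) f)"
proof -
  let ?L = "\<lambda>v s. mcomp (lin_form v (fst s) (snd s)) f"
  define m where "m r = Max (range (\<lambda>s. max (fps_abs r (?L v s)) (fps_abs r (?L w s))))" for r
  have m_ge: "fps_abs r (?L v s) \<le> m r" "fps_abs r (?L w s) \<le> m r" for r s
  proof -
    have "max (fps_abs r (?L v s)) (fps_abs r (?L w s)) \<le> m r" unfolding m_def by (rule Max_ge) auto
    then show "fps_abs r (?L v s) \<le> m r" "fps_abs r (?L w s) \<le> m r" by simp_all
  qed
  have m_in: "\<exists>s. m r = max (fps_abs r (?L v s)) (fps_abs r (?L w s))" for r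
  proof -
    have "m r \<in> range (\<lambda>s. max (fps_abs r (?L v s)) (fps_abs r (?L w s)))" unfolding m_def by (rule Max_in) auto
    then show ?thesis by auto
  qed
  have m0: "m r \<ge> 0" if "r \<ge> 1" for r
    using m_ge(1)[of r undefined] fps_abs_nonneg[OF entire_mcomp[of f, OF f], of r "lin_form v (fst undefined) (snd undefined)"] that
    by (meson less_le_trans order_trans zero_less_one)
  \<comment> \<open>The functions dominated by the largest minor; they are closed under linear
    combinations over the field.\<close>
  define S :: "'k fps set" where "S = {g. entire g \<and> (\<exists>C\<ge>0. \<forall>r\<ge>1. fps_abs r g \<le> C * m r)}"
  have SL: "?L v s \<in> S" "?L w s \<in> S" for s
    unfolding S_def using m_ge by (auto intro!: entire_mcomp f exI[of _ 1])
  have Sadd: "g + h \<in> S" if gh: "g \<in> S" "h \<in> S" for g h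
  proof -
    obtain C C' where C: "C \<ge> 0" "\<And>r. r \<ge> 1 \<Longrightarrow> fps_abs r g \<le> C * m r" "C' \<ge> 0" "\<And>r. r \<ge> 1 \<Longrightarrow> fps_abs r h \<le> C' * m r"
      using gh unfolding S_def by auto
    have "fps_abs r (g + h) \<le> (C + C') * m r" if r: "r \<ge> 1" for r
    proof -
      have "fps_abs r (g + h) \<le> max (fps_abs r g) (fps_abs r h)"
        using gh r by (intro fps_abs_add_le) (auto simp: S_def)
      moreover have "0 \<le> C * m r" "0 \<le> C' * m r" using C m0[OF r] by simp_all
      ultimately show ?thesis using C(2)[OF r] C(4)[OF r] by (simp add: distrib_right)
    qed
    then show ?thesis using gh C unfolding S_def by (auto intro!: entire_add exI[of _ "C + C'"])
  qed
  have Smult: "fps_const a * g \<in> S" if g: "g \<in> S" for a g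
  proof -
    obtain C where C: "C \<ge> 0" "\<And>r. r \<ge> 1 \<Longrightarrow> fps_abs r g \<le> C * m r" using g unfolding S_def by auto
    have "fps_abs r (fps_const a * g) \<le> (absval a * C) * m r" if r: "r \<ge> 1" for r
    proof -
      have "fps_abs r (fps_const a * g) = absval a * fps_abs r g"
        using g r by (subst fps_abs_mult) (auto simp: S_def entire_const fps_abs_const)
      then show ?thesis using mult_left_mono[OF C(2)[OF r] absval_nonneg[of a]] by (simp add: mult.assoc)
    qed
    then show ?thesis using g C unfolding S_def
      by (auto intro!: entire_mult entire_const exI[of _ "absval a * C"] simp: absval_nonneg)
  qed
  have Sdiv: "g \<in> S" if "fps_const a * g \<in> S" "a \<noteq> 0" for a g
  proof -
    have "fps_const (inverse a) * (fps_const a * g) = g"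
      using that(2) by (simp add: mult.assoc[symmetric])
    then show ?thesis using Smult[OF that(1), of "inverse a"] by metis
  qed
  \<comment> \<open>A nonzero minor of the two points makes the two linear equations for
    \<open>f a\<close> and \<open>f b\<close> solvable by Cramer's rule. The other components follow
    from the equations of \<open>v\<close>, because \<open>v a\<close> or \<open>v b\<close> is
    nonzero.\<close>
  obtain a b where ab: "v a * w b \<noteq> v b * w a" using proj_point_eqI[OF v w] ne by blast
  let ?d = "v a * w b - v b * w a"
  have d: "?d \<noteq> 0" using ab by simp
  have "fps_const ?d * f a = fps_const (w a) * ?L v (a, b) + fps_const (- v a) * ?L w (a, b)"
    by (simp add: mcomp_lin_form fps_const_sub[symmetric] fps_const_mult[symmetric] fps_const_neg[symmetric]
        algebra_simps del: fps_const_sub fps_const_mult fps_const_neg)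
  then have fa: "f a \<in> S" using Sdiv[OF _ d] Sadd Smult SL by metis
  have "fps_const ?d * f b = fps_const (w b) * ?L v (a, b) + fps_const (- v b) * ?L w (a, b)"
    by (simp add: mcomp_lin_form fps_const_sub[symmetric] fps_const_mult[symmetric] fps_const_neg[symmetric]
        algebra_simps del: fps_const_sub fps_const_mult fps_const_neg)
  then have fb: "f b \<in> S" using Sdiv[OF _ d] Sadd Smult SL by metis
  have eq: "fps_const (v j) * f k = ?L v (j, k) + fps_const (v k) * f j" for j k
    by (simp add: mcomp_lin_form)
  have fS: "f k \<in> S" for k
  proof (cases "v a = 0")
    case False
    show ?thesis using Sdiv[OF _ False] eq[of a k] Sadd Smult SL fa by metis
  next
    case True
    then have "v b \<noteq> 0" using ab by auto
    then show ?thesis using Sdiv eq[of b k] Sadd Smult SL fb by metis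
  qed
  then have "\<forall>k. \<exists>C\<ge>0. \<forall>r\<ge>1. fps_abs r (f k) \<le> C * m r" unfolding S_def by blast
  then obtain C where C: "\<And>k. C k \<ge> 0" "\<And>k r. r \<ge> 1 \<Longrightarrow> fps_abs r (f k) \<le> C k * m r" by metis
  define C' where "C' = 1 + (\<Sum>k\<in>UNIV. C k)"
  have C': "C' > 0" unfolding C'_def using sum_nonneg[of UNIV C] C(1) by (simp add: add_pos_nonneg)
  have "inverse C' * map_abs r f \<le> m r" if r: "r \<ge> 1" for r
  proof -
    obtain k where k: "fps_abs r (f k) = map_abs r f" using map_abs_attained by blast
    have "C k \<le> C'" unfolding C'_def using member_le_sum[of k UNIV C] C(1) by simp
    then have "map_abs r f \<le> C' * m r" using C(2)[OF r, of k] mult_right_mono[OF _ m0[OF r], of "C k" C'] k by linarith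
    then show ?thesis using C' by (simp add: field_simps)
  qed
  then have "\<exists>a b. inverse C' * map_abs r f \<le> fps_abs r (mcomp (lin_form v a b) f) \<or>
     inverse C' * map_abs r f \<le> fps_abs r (mcomp (lin_form w a b) f)" if "r \<ge> 1" for r
    using m_in[of r] that by (metis le_max_iff_disj)
  then show ?thesis using C' by (intro exI[of _ "inverse C'"]) simp
qed

text \<open>Since \<open>f\<close> is not constantly the point \<open>v\<close>, some minor is a
  nonzero entire function, and its norm at \<open>r \<ge> 1\<close> is at least its norm at
  1.\<close>

lemma one_point_bound:
  fixes f :: "'n::finite \<Rightarrow> 'k::complete_nonarch_field fps"
  assumes f: "analytic_map f X" and nonconst: "\<exists>z w. map_point f z \<noteq> map_point f w" and v: "\<exists>i. v i \<noteq> 0"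
  shows "\<exists>c>0. \<exists>a b. \<forall>r\<ge>1. c \<le> fps_abs r (mcomp (lin_form v a b) f)"
proof -
  note ent = analytic_map_entire[OF f]
  have "\<exists>a b. mcomp (lin_form v a b) f \<noteq> 0"
  proof (rule ccontr)
    assume zero: "\<nexists>a b. mcomp (lin_form v a b) f \<noteq> 0"
    have "map_point f z = proj_point v" for z
      unfolding map_point_def
    proof (rule proj_point_eqI[OF v])
      show "\<exists>i. na_eval (f i) z \<noteq> 0" using f unfolding analytic_map_def by blast
      fix a b
      have "na_eval (mcomp (lin_form v a b) f) z = 0" using zero na_eval_const[of 0 z] by auto
      then show "v a * na_eval (f b) z = v b * na_eval (f a) z"
        by (simp add: na_eval_mcomp[of f, OF ent] meval_lin_form)
    qed
    then show False using nonconst by simp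
  qed
  then obtain a b where ab: "mcomp (lin_form v a b) f \<noteq> 0" by blast
  show ?thesis
    using fps_abs_pos[OF entire_mcomp[of f, OF ent] zero_less_one ab] fps_abs_mono[OF entire_mcomp[of f, OF ent]]
    by (intro exI[of _ "fps_abs 1 (mcomp (lin_form v a b) f)"]) auto
qed

text \<open>Since \<open>f\<close> can be close to at most one of the points, some product of linear forms through the
  points has size at least \<open>|f|\<^sub>r ^ (card V - 1)\<close>, up to a constant.\<close>

lemma product_lower_bound:
  fixes f :: "'n::finite \<Rightarrow> 'k::complete_nonarch_field fps"
  assumes f: "analytic_map f X" and nonconst: "\<exists>z w. map_point f z \<noteq> map_point f w"
    and V: "finite V" "\<And>v. v \<in> V \<Longrightarrow> \<exists>i. v i \<noteq> 0" "inj_on proj_point V"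
  shows "\<exists>c>0. \<forall>r\<ge>1. \<exists>\<sigma>\<in>V \<rightarrow>\<^sub>E UNIV.
    c * map_abs r f ^ card V \<le> fps_abs r (mcomp (\<Prod>v\<in>V. lin_form v (fst (\<sigma> v)) (snd (\<sigma> v))) f) * map_abs r f"
proof -
  note ent = analytic_map_entire[OF f]
  have pos: "map_abs r f > 0" if "r \<ge> 1" for r using map_abs_pos[OF f] that by simp
  let ?L = "\<lambda>v s. mcomp (lin_form v (fst s) (snd s)) f"
  have "\<exists>c1>0. \<forall>v\<in>V. \<exists>a b. \<forall>r\<ge>1. c1 \<le> fps_abs r (mcomp (lin_form v a b) f)"
  proof (rule finite_uniform_pos[OF V(1)])
    fix v assume "v \<in> V"
    then show "\<exists>c>0. \<exists>a b. \<forall>r\<ge>1. c \<le> fps_abs r (mcomp (lin_form v a b) f)"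
      using one_point_bound[OF f nonconst V(2)] by blast
  qed (meson order_trans)
  then obtain c1 where c1: "c1 > 0" "\<And>v. v \<in> V \<Longrightarrow> \<exists>a b. \<forall>r\<ge>1. c1 \<le> fps_abs r (mcomp (lin_form v a b) f)" by blast
  define P where "P p c \<longleftrightarrow> (\<forall>r\<ge>1. \<exists>a b. c * map_abs r f \<le> fps_abs r (mcomp (lin_form (fst p) a b) f) \<or>
     c * map_abs r f \<le> fps_abs r (mcomp (lin_form (snd p) a b) f))" for p c
  have "\<exists>c2>0. \<forall>p\<in>{p \<in> V \<times> V. fst p \<noteq> snd p}. P p c2"
  proof (rule finite_uniform_pos)
    show "finite {p \<in> V \<times> V. fst p \<noteq> snd p}" using V(1) by simp
    fix p assume p: "p \<in> {p \<in> V \<times> V. fst p \<noteq> snd p}"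
    then have "proj_point (snd p) \<noteq> proj_point (fst p)" using V(3) unfolding inj_on_def by auto
    then show "\<exists>c>0. P p c" unfolding P_def using p V(2) by (intro two_points_bound ent) auto
  next
    fix p c c' assume "P p c" "c' \<le> c"
    then show "P p c'" unfolding P_def by (meson less_imp_le mult_right_mono order_trans pos)
  qed
  then obtain c2 where c2: "c2 > 0" "\<And>v w. v \<in> V \<Longrightarrow> w \<in> V \<Longrightarrow> v \<noteq> w \<Longrightarrow> P (v, w) c2" by auto
  define c where "c = min c1 c2"
  have c: "c > 0" "c \<le> c1" "c \<le> c2" using c1 c2 by (auto simp: c_def)
  \<comment> \<open>Each factor contributes \<open>c\<close>. The factor
    \<open>min 1 (map_abs 1 f)\<close> covers the case that \<open>f\<close> is far from every
    point, where the product of the sizes is |f|_r ^ card V and the extra |f|_r is bounded below by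
    |f|_1.\<close>
  have "\<exists>\<sigma>\<in>V \<rightarrow>\<^sub>E UNIV. (c ^ card V * min 1 (map_abs 1 f)) * map_abs r f ^ card V \<le>
      fps_abs r (mcomp (\<Prod>v\<in>V. lin_form v (fst (\<sigma> v)) (snd (\<sigma> v))) f) * map_abs r f" if r: "r \<ge> 1" for r
  proof -
    \<comment> \<open>\<open>good v\<close> says that \<open>f\<close> is far from \<open>v\<close>
      at this radius; by the bound for pairs at most one point fails it.\<close>
    define good where "good v \<longleftrightarrow> (\<exists>s. c * map_abs r f \<le> fps_abs r (?L v s))" for v
    have bad: "v = w" if vw: "v \<in> V" "w \<in> V" "\<not> good v" "\<not> good w" for v w
    proof (rule ccontr)
      assume "v \<noteq> w"
      then obtain a b where "c2 * map_abs r f \<le> fps_abs r (?L v (a, b)) \<or> c2 * map_abs r f \<le> fps_abs r (?L w (a, b))"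
        using c2(2)[OF vw(1,2)] r unfolding P_def by fastforce
      moreover have "c * map_abs r f \<le> c2 * map_abs r f" using c(3) pos[OF r] by simp
      ultimately show False using vw(3,4) unfolding good_def by (meson order_trans)
    qed
    define h where "h v = (if good v then map_abs r f else 1)" for v
    have "\<exists>s. c * h v \<le> fps_abs r (?L v s)" if vV: "v \<in> V" for v
    proof (cases "good v")
      case True
      then show ?thesis by (simp add: h_def good_def)
    next
      case False
      obtain a b where "c1 \<le> fps_abs r (mcomp (lin_form v a b) f)" using c1(2)[OF vV] r by blast
      then show ?thesis using False c(2) by (intro exI[of _ "(a, b)"]) (simp add: h_def)
    qed
    then obtain s where s: "\<And>v. v \<in> V \<Longrightarrow> c * h v \<le> fps_abs r (?L v (s v))" by metis
    \<comment> \<open>Restriction to \<open>V\<close> puts the choice into a finite set of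
      functions, which later allows a single constant.\<close>
    let ?\<sigma> = "restrict s V"
    have h0: "0 < h v" for v using pos[OF r] by (simp add: h_def)
    have "c ^ card V * (\<Prod>v\<in>V. h v) = (\<Prod>v\<in>V. c * h v)" by (simp add: prod.distrib)
    also have "\<dots> \<le> (\<Prod>v\<in>V. fps_abs r (?L v (s v)))"
      using s c(1) h0 by (intro prod_mono) (auto intro: less_imp_le)
    also have "\<dots> = fps_abs r (mcomp (\<Prod>v\<in>V. lin_form v (fst (?\<sigma> v)) (snd (?\<sigma> v))) f)"
    proof -
      have "fps_abs r (prod g V) = (\<Prod>v\<in>V. fps_abs r (g v)) \<and> entire (prod g V)" if "\<And>v. entire (g v)" for g :: "('n \<Rightarrow> 'k) \<Rightarrow> 'k fps"
        using V(1)
      proof induction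
        case empty
        then show ?case using r fps_abs_const[of r "1::'k"] entire_const[of "1::'k"] by simp
      next
        case (insert v V)
        then show ?case using r that by (simp add: fps_abs_mult entire_mult)
      qed
      from this[of "\<lambda>v. ?L v (s v)"] show ?thesis
        by (simp add: rhom.hom_prod[OF rhom_mcomp] entire_mcomp[of f, OF ent])
    qed
    finally have le: "c ^ card V * (\<Prod>v\<in>V. h v) \<le> fps_abs r (mcomp (\<Prod>v\<in>V. lin_form v (fst (?\<sigma> v)) (snd (?\<sigma> v))) f)" .
    have hprod: "min 1 (map_abs 1 f) * map_abs r f ^ card V \<le> (\<Prod>v\<in>V. h v) * map_abs r f"
    proof (cases "\<forall>v\<in>V. good v")
      case True
      then have "(\<Prod>v\<in>V. h v) = map_abs r f ^ card V" by (simp add: h_def)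
      then show ?thesis using map_abs_mono[of f, OF ent r] pos[OF r] by (simp add: mult.commute)
    next
      case False
      then obtain v0 where v0: "v0 \<in> V" "\<not> good v0" by blast
      then have "good v" if "v \<in> V - {v0}" for v using bad[of v v0] that by auto
      then have "(\<Prod>v\<in>V - {v0}. h v) = (\<Prod>v\<in>V - {v0}. map_abs r f)" by (intro prod.cong) (auto simp: h_def)
      then have "(\<Prod>v\<in>V. h v) = map_abs r f ^ (card V - 1)"
        using V(1) v0 by (simp add: prod.remove[OF V(1) v0(1)] h_def)
      moreover have "card V = Suc (card V - 1)" using V(1) v0(1) by (metis card_gt_0_iff empty_iff Suc_diff_1)
      ultimately have "(\<Prod>v\<in>V. h v) * map_abs r f = map_abs r f ^ card V" by (metis power_Suc2)
      moreover have "min 1 (map_abs 1 f) * map_abs r f ^ card V \<le> 1 * map_abs r f ^ card V"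
        using pos[OF r] by (intro mult_right_mono) auto
      ultimately show ?thesis by simp
    qed
    have "(c ^ card V * min 1 (map_abs 1 f)) * map_abs r f ^ card V \<le> c ^ card V * ((\<Prod>v\<in>V. h v) * map_abs r f)"
      using mult_left_mono[OF hprod, of "c ^ card V"] c(1) by (simp add: mult.assoc)
    also have "\<dots> \<le> fps_abs r (mcomp (\<Prod>v\<in>V. lin_form v (fst (?\<sigma> v)) (snd (?\<sigma> v))) f) * map_abs r f"
      using mult_right_mono[OF le, of "map_abs r f"] pos[OF r] by (simp add: mult.assoc)
    finally show ?thesis by (intro bexI[of _ ?\<sigma>]) auto
  qed
  moreover have "c ^ card V * min 1 (map_abs 1 f) > 0" using c(1) pos[of 1] by simp
  ultimately show ?thesis by blast
qed

section \<open>The second main theorem\<close>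

lemma proximity_eq:
  assumes f: "analytic_map f X" and Q: "mcomp Q f \<noteq> 0" and r: "r \<ge> 1"
  shows "proximity_fun f r Q = real (total_degree Q) * characteristic_fun f r - ln (fps_abs r (mcomp Q f))"
proof -
  note ent = analytic_map_entire[OF f]
  have "map_abs r f > 0" using map_abs_pos[OF f] r by simp
  moreover have "fps_abs r (mcomp Q f) > 0" using r by (intro fps_abs_pos entire_mcomp ent Q) simp
  ultimately show ?thesis
    unfolding proximity_fun_def characteristic_fun_def by (simp add: ln_div ln_realpow)
qed

text \<open>The norm of \<open>mcomp Q f\<close> at \<open>r \<ge> 1\<close> is at least its value
  at 1, so its logarithm is bounded below.\<close>

lemma proximity_le:
  assumes f: "analytic_map f X" and Q: "mcomp Q f \<noteq> 0" "total_degree Q \<ge> 1" and r: "r \<ge> 1"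
  shows "proximity_fun f r Q / real (total_degree Q) \<le> characteristic_fun f r + \<bar>ln (fps_abs 1 (mcomp Q f))\<bar>"
proof -
  note ent = analytic_map_entire[OF f]
  have "fps_abs 1 (mcomp Q f) > 0" by (intro fps_abs_pos entire_mcomp ent Q) simp
  then have "ln (fps_abs 1 (mcomp Q f)) \<le> ln (fps_abs r (mcomp Q f))"
    using fps_abs_mono[OF entire_mcomp[of f Q, OF ent] r] by simp
  then have "proximity_fun f r Q \<le> real (total_degree Q) * characteristic_fun f r + \<bar>ln (fps_abs 1 (mcomp Q f))\<bar>"
    unfolding proximity_eq[OF f Q(1) r] by linarith
  also have "\<dots> \<le> real (total_degree Q) * (characteristic_fun f r + \<bar>ln (fps_abs 1 (mcomp Q f))\<bar>)"
    using mult_right_mono[of 1 "real (total_degree Q)" "\<bar>ln (fps_abs 1 (mcomp Q f))\<bar>"] Q(2) by (simp add: distrib_left)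
  finally show ?thesis using Q(2) by (simp add: field_simps)
qed

lemma proximity_le_of_estimate:
  assumes f: "analytic_map f X" and Q: "mcomp Q f \<noteq> 0" and r: "r \<ge> 1" and C: "C > 0"
    and le: "map_abs r f ^ total_degree Q \<le> C * map_abs r f ^ M * fps_abs r (mcomp Q f)"
  shows "proximity_fun f r Q \<le> real M * characteristic_fun f r + \<bar>ln C\<bar>"
proof -
  note ent = analytic_map_entire[OF f]
  have T: "map_abs r f > 0" using map_abs_pos[OF f] r by simp
  have Q0: "fps_abs r (mcomp Q f) > 0" using r by (intro fps_abs_pos entire_mcomp ent Q) simp
  have "ln (map_abs r f ^ total_degree Q) \<le> ln (C * map_abs r f ^ M * fps_abs r (mcomp Q f))"
    using le T Q0 C by (subst ln_le_cancel_iff) auto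
  also have "\<dots> = ln C + real M * characteristic_fun f r + ln (fps_abs r (mcomp Q f))"
    using T Q0 C by (simp add: ln_mult ln_realpow characteristic_fun_def)
  finally show ?thesis
    unfolding proximity_eq[OF f Q r] using T by (simp add: ln_realpow characteristic_fun_def)
qed

text \<open>The constant 1 vanishes on the empty intersection, so it lies in the section ideal of
  every chart; the rest is \<open>section_power_estimate\<close> for \<open>G = 1\<close>, of degree
  0.\<close>

lemma empty_section_proximity:
  fixes D :: "nat \<Rightarrow> ('k::{complete_nonarch_field, alg_closed_field}, 'n::finite) mpoly"
    and f :: "'n \<Rightarrow> 'k fps"
  assumes f: "analytic_map f X" and X: "zariski_closed X" and I: "finite I" "I \<noteq> {}"
    and D: "\<And>l. l \<in> I \<Longrightarrow> homogeneous (D l)" "\<And>l. l \<in> I \<Longrightarrow> mcomp (D l) f \<noteq> 0"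
    and empty: "(\<Inter>l\<in>I. hypersurface (D l)) \<inter> X = {}"
  shows "\<exists>C\<ge>0. \<forall>r\<ge>1. \<exists>l\<in>I. proximity_fun f r (D l) \<le> C"
proof -
  have "dehomogenize i 1 ^ 1 \<in> scheme_section D X I i" for i
  proof -
    have "\<exists>k. (1 :: ('k, 'n) mpoly) ^ k \<in> scheme_section D X I i"
      by (rule section_nullstellensatz[OF X D(1)]) (use empty in \<open>auto intro: subring1D[OF subring1_pvars]\<close>)
    then show ?thesis by (simp add: rhom.hom_one[OF rhom_dehomogenize])
  qed
  then obtain C where C: "C \<ge> 0" "\<And>r. r \<ge> 1 \<Longrightarrow> \<exists>l\<in>I. fps_abs r (mcomp 1 f) ^ 1 * map_abs r f ^ total_degree (D l) \<le>
    C * map_abs r f ^ (1 * 0) * fps_abs r (mcomp (D l) f)"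
    using section_power_estimate[where G = 1 and d = 0 and k = 1 and D = D, OF f I D(1)] by (auto simp: mon_degree_def)
  have "\<exists>l\<in>I. proximity_fun f r (D l) \<le> \<bar>ln (C + 1)\<bar>" if r: "r \<ge> 1" for r
  proof -
    obtain l where l: "l \<in> I" "fps_abs r (mcomp 1 f) ^ 1 * map_abs r f ^ total_degree (D l) \<le>
      C * map_abs r f ^ (1 * 0) * fps_abs r (mcomp (D l) f)" using C(2)[OF r] by blast
    note ent = analytic_map_entire[OF f]
    have "fps_abs r (mcomp (D l) f) \<ge> 0" using r by (intro fps_abs_nonneg entire_mcomp ent) simp
    moreover have "fps_abs r (mcomp 1 f) = 1"
      using r fps_abs_const[of r "1::'k"] by (simp add: rhom.hom_one[OF rhom_mcomp])
    \<comment> \<open>\<open>C\<close> may be 0, and the logarithm needs a positive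
      constant.\<close>
    ultimately have "map_abs r f ^ total_degree (D l) \<le> (C + 1) * map_abs r f ^ 0 * fps_abs r (mcomp (D l) f)"
      using l(2) by (simp add: distrib_right)
    then have "proximity_fun f r (D l) \<le> real 0 * characteristic_fun f r + \<bar>ln (C + 1)\<bar>"
      using C(1) by (intro proximity_le_of_estimate[OF f D(2)[OF l(1)] r]) auto
    then show ?thesis using l(1) by auto
  qed
  then show ?thesis by (intro exI[of _ "\<bar>ln (C + 1)\<bar>"]) auto
qed

text \<open>Which choice \<sigma> makes \<open>G \<sigma>\<close> large along \<open>f\<close>
  depends on \<open>r\<close>, so the section estimate is proved for every \<sigma>, and the
  finitely many constants are merged.\<close>

lemma finite_section_proximity:
  fixes D :: "nat \<Rightarrow> ('k::{complete_nonarch_field, alg_closed_field}, 'n::finite) mpoly"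
    and f :: "'n \<Rightarrow> 'k fps"
  assumes f: "analytic_map f X" and nonconst: "\<exists>z w. map_point f z \<noteq> map_point f w"
    and X: "zariski_closed X" and I: "I \<subseteq> {1..q}" "card I = t_index q D X 0 + 1"
    and D: "\<And>l. l \<in> I \<Longrightarrow> homogeneous (D l)" "\<And>l. l \<in> I \<Longrightarrow> mcomp (D l) f \<noteq> 0"
    and fin: "finite ((\<Inter>l\<in>I. hypersurface (D l)) \<inter> X)"
  shows "\<exists>C\<ge>0. \<forall>r\<ge>1. \<exists>l\<in>I. proximity_fun f r (D l) \<le> real (M_index q D X) * characteristic_fun f r + C"
proof -
  let ?Y = "(\<Inter>l\<in>I. hypersurface (D l)) \<inter> X" and ?M = "M_index q D X"
  note ent = analytic_map_entire[OF f]
  have pos: "map_abs r f > 0" if "r \<ge> 1" for r using map_abs_pos[OF f] that by simp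
  have I': "finite I" "I \<noteq> {}" using I(2) by (auto intro: card_ge_0_finite)
  have "\<exists>v. P = proj_point v \<and> (\<exists>i. v i \<noteq> 0)" if "P \<in> ?Y" for P
  proof -
    have "P \<in> proj_space" using zariski_closed_subset_space[OF X] that by auto
    then show ?thesis unfolding proj_space_def by auto
  qed
  then obtain rep where rep: "\<And>P. P \<in> ?Y \<Longrightarrow> P = proj_point (rep P) \<and> (\<exists>i. rep P i \<noteq> 0)" by metis
  \<comment> \<open>One coordinate vector per point, so that \<open>proj_point\<close> is injective
    on \<open>V\<close>.\<close>
  define V where "V = rep ` ?Y"
  have V: "finite V" "\<And>v. v \<in> V \<Longrightarrow> \<exists>i. v i \<noteq> 0" "inj_on proj_point V"
    using fin rep by (auto simp: V_def inj_on_def)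
  define G where "G \<sigma> = (\<Prod>v\<in>V. lin_form v (fst (\<sigma> v)) (snd (\<sigma> v)))" for \<sigma> :: "('n \<Rightarrow> 'k) \<Rightarrow> 'n \<times> 'n"
  have Gdeg: "mon_degree m = card V" if "m \<in> keys (G \<sigma>)" for m \<sigma>
    using that unfolding G_def by (rule keys_prod_degree[rotated 2]) (use V(1) lin_form_degree in auto)
  have mem: "dehomogenize i (G \<sigma>) ^ ?M \<in> scheme_section D X I i" for i \<sigma>
  proof -
    have "\<exists>k. dehomogenize i (G \<sigma>) ^ k \<in> scheme_section D X I i"
    proof (rule section_nullstellensatz[OF X D(1) dehomogenize_in_chart])
      fix x assume x: "x i = 1" "proj_point x \<in> ?Y"
      let ?v = "rep (proj_point x)"
      have v: "?v \<in> V" "proj_point x = proj_point ?v" using rep[OF x(2)] x(2) by (auto simp: V_def)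
      then obtain c where "x = (\<lambda>i. c * ?v i)" using proj_point_self[of x] unfolding proj_point_def by auto
      then have "x j = c * ?v j" for j by (rule fun_cong)
      then have "meval x (lin_form ?v (fst (\<sigma> ?v)) (snd (\<sigma> ?v))) = 0" by (simp add: meval_lin_form)
      then have "meval x (G \<sigma>) = 0"
        unfolding G_def rhom.hom_prod[OF rhom_meval] using V(1) v(1) by (intro prod_zero) auto
      moreover have "x(i := 1) = x" using x(1) by auto
      ultimately show "meval x (dehomogenize i (G \<sigma>)) = 0" by (simp add: meval_dehomogenize)
    qed
    then show ?thesis using M_index_power[OF I dehomogenize_in_chart] by blast
  qed
  have "\<exists>C\<ge>0. \<forall>r\<ge>1. \<exists>l\<in>I. fps_abs r (mcomp (G \<sigma>) f) ^ ?M * map_abs r f ^ total_degree (D l) \<le>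
    C * map_abs r f ^ (?M * card V) * fps_abs r (mcomp (D l) f)" for \<sigma>
    by (rule section_power_estimate[where D = D and G = "G \<sigma>", OF f I' D(1) Gdeg mem])
  then obtain C where C0: "\<And>\<sigma>. C \<sigma> \<ge> 0" and C: "\<And>\<sigma> r. r \<ge> 1 \<Longrightarrow> \<exists>l\<in>I. fps_abs r (mcomp (G \<sigma>) f) ^ ?M * map_abs r f ^ total_degree (D l) \<le>
    C \<sigma> * map_abs r f ^ (?M * card V) * fps_abs r (mcomp (D l) f)" by metis
  obtain c where c: "c > 0" "\<And>r. r \<ge> 1 \<Longrightarrow> \<exists>\<sigma>\<in>V \<rightarrow>\<^sub>E UNIV.
      c * map_abs r f ^ card V \<le> fps_abs r (mcomp (G \<sigma>) f) * map_abs r f"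
    using product_lower_bound[OF f nonconst V] unfolding G_def by blast
  have \<Sigma>fin: "finite (V \<rightarrow>\<^sub>E (UNIV :: ('n \<times> 'n) set))" using V(1) by (intro finite_PiE) auto
  define C' where "C' = 1 + (\<Sum>\<sigma>\<in>V \<rightarrow>\<^sub>E UNIV. C \<sigma>)"
  have C': "C \<sigma> \<le> C'" if "\<sigma> \<in> V \<rightarrow>\<^sub>E UNIV" for \<sigma>
    using member_le_sum[OF that, of C] C0 \<Sigma>fin unfolding C'_def by fastforce
  have C'pos: "C' > 0" unfolding C'_def using sum_nonneg[of "V \<rightarrow>\<^sub>E UNIV" C] C0 by (simp add: add_pos_nonneg)
  define K where "K = C' / c ^ ?M"
  have K: "K > 0" using C'pos c(1) by (simp add: K_def)
  have "\<exists>l\<in>I. proximity_fun f r (D l) \<le> real ?M * characteristic_fun f r + \<bar>ln K\<bar>" if r: "r \<ge> 1" for r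
  proof -
    obtain \<sigma> where \<sigma>: "\<sigma> \<in> V \<rightarrow>\<^sub>E UNIV" "c * map_abs r f ^ card V \<le> fps_abs r (mcomp (G \<sigma>) f) * map_abs r f"
      using c(2)[OF r] by blast
    obtain l where l: "l \<in> I" "fps_abs r (mcomp (G \<sigma>) f) ^ ?M * map_abs r f ^ total_degree (D l) \<le>
      C \<sigma> * map_abs r f ^ (?M * card V) * fps_abs r (mcomp (D l) f)" using C[OF r] by blast
    let ?T = "map_abs r f" and ?Q = "fps_abs r (mcomp (D l) f)" and ?d = "total_degree (D l)"
    have T: "?T > 0" by (rule pos[OF r])
    have Q: "?Q \<ge> 0" using r by (intro fps_abs_nonneg entire_mcomp ent) simp
    \<comment> \<open>The lower bound for \<open>G \<sigma>\<close> is raised to the power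
      \<open>?M\<close> and inserted into the section estimate. The factor
      \<open>?T ^ (?M * card V)\<close> cancels and \<open>?T ^ ?M\<close> remains, which becomes
      the multiple of the characteristic function.\<close>
    have "(c * ?T ^ card V) ^ ?M \<le> (fps_abs r (mcomp (G \<sigma>) f) * ?T) ^ ?M"
      using \<sigma>(2) c(1) T by (intro power_mono) auto
    then have "c ^ ?M * ?T ^ (?M * card V) \<le> fps_abs r (mcomp (G \<sigma>) f) ^ ?M * ?T ^ ?M"
      by (simp add: power_mult_distrib power_mult[symmetric] mult.commute[of ?M])
    then have "(c ^ ?M * ?T ^ (?M * card V)) * ?T ^ ?d \<le> (fps_abs r (mcomp (G \<sigma>) f) ^ ?M * ?T ^ ?M) * ?T ^ ?d"
      using T by (intro mult_right_mono) auto
    also have "\<dots> = (fps_abs r (mcomp (G \<sigma>) f) ^ ?M * ?T ^ ?d) * ?T ^ ?M" by (simp add: mult_ac)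
    also have "\<dots> \<le> (C \<sigma> * ?T ^ (?M * card V) * ?Q) * ?T ^ ?M"
      using l(2) T by (intro mult_right_mono) auto
    also have "\<dots> \<le> (C' * ?T ^ (?M * card V) * ?Q) * ?T ^ ?M"
      using C'[OF \<sigma>(1)] T Q by (intro mult_right_mono) auto
    finally have "?T ^ (?M * card V) * (c ^ ?M * ?T ^ ?d) \<le> ?T ^ (?M * card V) * (C' * ?T ^ ?M * ?Q)"
      by (simp add: mult_ac)
    then have "c ^ ?M * ?T ^ ?d \<le> C' * ?T ^ ?M * ?Q" using T by simp
    then have "?T ^ ?d \<le> K * ?T ^ ?M * ?Q" using c(1) by (simp add: K_def field_simps)
    then have "proximity_fun f r (D l) \<le> real ?M * characteristic_fun f r + \<bar>ln K\<bar>"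
      by (rule proximity_le_of_estimate[OF f D(2)[OF l(1)] r K])
    then show ?thesis using l(1) by blast
  qed
  then show ?thesis by (intro exI[of _ "\<bar>ln K\<bar>"]) auto
qed

section \<open>The indices t_m and the final summation\<close>

abbreviation sections_dim_le where
  "sections_dim_le q Q X m t \<equiv>
     \<forall>I. I \<subseteq> {1..q} \<and> card I = t + 1 \<longrightarrow> zdim ((\<Inter>i\<in>I. hypersurface (Q i)) \<inter> X) \<le> m"

lemma sections_dim_le_q: "sections_dim_le q Q X m q"
proof (intro allI impI)
  fix J assume "J \<subseteq> {1..q} \<and> card J = q + 1"
  then have False using card_mono[of "{1..q}" J] by simp
  then show "zdim ((\<Inter>i\<in>J. hypersurface (Q i)) \<inter> X) \<le> m" ..
qed

text \<open>The value \<open>q\<close> always qualifies vacuously, since no subset of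
  \<open>{1..q}\<close> has \<open>q + 1\<close> elements. This settles the default branch and
  provides the witness for \<open>LEAST\<close> in the other one.\<close>

lemma t_index_spec:
  assumes "I \<subseteq> {1..q}" "card I = t_index q Q X m + 1"
  shows "zdim ((\<Inter>i\<in>I. hypersurface (Q i)) \<inter> X) \<le> m"
proof (cases "zdim (X \<inter> (\<Inter>i\<in>{1..q}. hypersurface (Q i))) > m")
  case True
  then have "card I = q + 1" using assms(2) by (simp add: t_index_def)
  moreover have "card I \<le> q" using card_mono[OF _ assms(1)] by simp
  ultimately show ?thesis by simp
next
  case False
  let ?P = "\<lambda>t. sections_dim_le q Q X m t"
  have "?P q" by (rule sections_dim_le_q)
  then have "?P (LEAST t. ?P t)" by (rule LeastI)
  moreover have "t_index q Q X m = (LEAST t. ?P t)" using False by (simp only: t_index_def if_False)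
  ultimately have "?P (t_index q Q X m)" by (simp only:)
  then show ?thesis using assms by blast
qed

lemma t_index_le: "t_index q Q X m \<le> q"
proof -
  let ?P = "\<lambda>t. sections_dim_le q Q X m t"
  have "?P q" by (rule sections_dim_le_q)
  then have "(LEAST t. ?P t) \<le> q" by (rule Least_le)
  then show ?thesis unfolding t_index_def by (simp only: split: if_split) simp
qed

lemma t_index_antimono:
  assumes "m \<le> m'"
  shows "t_index q Q X m' \<le> t_index q Q X m"
proof (cases "zdim (X \<inter> (\<Inter>i\<in>{1..q}. hypersurface (Q i))) > m")
  case True
  then have "t_index q Q X m = q" by (simp only: t_index_def if_True)
  then show ?thesis using t_index_le by metis
next
  case False
  let ?P = "\<lambda>t. sections_dim_le q Q X m' t"
  have "?P (t_index q Q X m)" using order_trans[OF t_index_spec[of _ q Q X m] assms] by blast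
  then have "(LEAST t. ?P t) \<le> t_index q Q X m" by (rule Least_le)
  moreover have "\<not> zdim (X \<inter> (\<Inter>i\<in>{1..q}. hypersurface (Q i))) > m'" using False assms by (simp add: not_less)
  then have "t_index q Q X m' = (LEAST t. ?P t)" by (simp only: t_index_def if_False)
  ultimately show ?thesis by (simp only:)
qed

text \<open>The set \<open>U\<close> plays the role of the \<open>t\<^sub>0\<close> largest values \<open>m j\<close>; the values are compared without
  dividing by \<open>d j\<close>, so that the bound \<open>M T\<close> holds for every \<open>j\<close> outside \<open>U\<close>.\<close>

lemma sum_bound:
  fixes m d :: "nat \<Rightarrow> real"
  assumes A: "finite A" and t: "t0 \<le> t1" "t1 \<le> card A" and d: "\<And>j. j \<in> A \<Longrightarrow> d j \<ge> 1"
    and nonneg: "C \<ge> 0" "T \<ge> 0" "M \<ge> 0"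
    and H1: "\<And>j. j \<in> A \<Longrightarrow> m j / d j \<le> T + C"
    and H2: "\<And>I. I \<subseteq> A \<Longrightarrow> card I = t0 + 1 \<Longrightarrow> \<exists>l\<in>I. m l \<le> M * T + C"
    and H3: "\<And>I. I \<subseteq> A \<Longrightarrow> card I = t1 + 1 \<Longrightarrow> \<exists>l\<in>I. m l \<le> C"
  shows "\<exists>I\<subseteq>A. card I = t1 - t0 \<and>
    (\<Sum>j\<in>A. m j / d j) \<le> (real t0 + (\<Sum>i\<in>I. min (M / d i) 1)) * T + real (card A) * C"
proof -
  \<comment> \<open>\<open>W\<close> collects the indices that exceed the constant bound,
    \<open>U0\<close> those that also exceed the bound with \<open>M\<close>.\<close>
  define W where "W = {j \<in> A. m j > C}"
  define U0 where "U0 = {j \<in> A. m j > M * T + C}"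
  have fin: "finite W" "finite U0" using A by (auto simp: W_def U0_def)
  have MT: "M * T \<ge> 0" using nonneg by simp
  have UW: "U0 \<subseteq> W" using MT by (auto simp: W_def U0_def)
  have cW: "card W \<le> t1"
  proof (rule ccontr)
    assume "\<not> card W \<le> t1"
    then obtain I where I: "I \<subseteq> W" "card I = t1 + 1" using obtain_subset_with_card_n[of "t1 + 1" W] by auto
    then obtain l where "l \<in> I" "m l \<le> C" using H3[of I] by (auto simp: W_def)
    then show False using I by (auto simp: W_def)
  qed
  have cU: "card U0 \<le> t0"
  proof (rule ccontr)
    assume "\<not> card U0 \<le> t0"
    then obtain I where I: "I \<subseteq> U0" "card I = t0 + 1" using obtain_subset_with_card_n[of "t0 + 1" U0] by auto
    then obtain l where "l \<in> I" "m l \<le> M * T + C" using H2[of I] by (auto simp: U0_def)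
    then show False using I by (auto simp: U0_def)
  qed
  have "card U0 \<le> min t0 (card W)" using cU card_mono[OF fin(1) UW] by simp
  \<comment> \<open>With \<open>min t0 (card W)\<close> elements in \<open>U\<close>, at most
    \<open>t1 - t0\<close> elements of \<open>W\<close> remain, and they satisfy the bound with
    \<open>M\<close> because \<open>U\<close> contains \<open>U0\<close>.\<close>
  then obtain U where U: "U0 \<subseteq> U" "U \<subseteq> W" "card U = min t0 (card W)"
    using exists_subset_between[of U0 "min t0 (card W)" W] UW fin(1) by auto
  have finU: "finite U" using U(2) fin(1) by (rule finite_subset)
  have "card (W - U) = card W - card U" using U(2) finU by (simp add: card_Diff_subset)
  then have cWU: "card (W - U) \<le> t1 - t0" using U(3) cW by linarith
  have "W - U \<subseteq> A" by (auto simp: W_def)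
  moreover have "t1 - t0 \<le> card A" using t(2) by simp
  \<comment> \<open>The rest is enlarged to exactly \<open>t1 - t0\<close> indices, because
    \<open>alpha\<close> is a maximum over sets of that size; the added summands are
    nonnegative.\<close>
  ultimately obtain I where I: "W - U \<subseteq> I" "I \<subseteq> A" "card I = t1 - t0"
    using exists_subset_between[of "W - U" "t1 - t0" A] cWU A by blast
  define g where "g j = (if j \<in> U then 1 else if j \<in> W - U then min (M / d j) 1 else 0)" for j
  have "m j / d j \<le> g j * T + C" if j: "j \<in> A" for j
  proof -
    have dj: "d j \<ge> 1" by (rule d[OF j])
    have Cd: "C / d j \<le> C" using dj nonneg(1) by (simp add: field_simps mult_right_mono mult_le_cancel_left1)
    consider "j \<in> U" | "j \<in> W - U" | "j \<notin> W" by blast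
    then show ?thesis
    proof cases
      case 1
      then show ?thesis using H1[OF j] by (simp add: g_def)
    next
      case 2
      then have "m j \<le> M * T + C" using U(1) j by (auto simp: U0_def)
      then have "m j / d j \<le> (M * T + C) / d j" using dj by (intro divide_right_mono) auto
      also have "\<dots> \<le> M / d j * T + C" using Cd by (simp add: add_divide_distrib)
      finally have "m j / d j \<le> M / d j * T + C" .
      then show ?thesis using H1[OF j] 2 by (simp add: g_def min_def)
    next
      case 3
      then have "m j \<le> C" using j by (auto simp: W_def)
      then have "m j / d j \<le> C / d j" using dj by (intro divide_right_mono) auto
      moreover have "j \<notin> U" using 3 U(2) by blast
      ultimately show ?thesis using Cd 3 by (simp add: g_def)
    qed
  qed
  then have "(\<Sum>j\<in>A. m j / d j) \<le> (\<Sum>j\<in>A. g j * T + C)" by (rule sum_mono)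
  also have "\<dots> = (\<Sum>j\<in>A. g j) * T + real (card A) * C"
    by (simp add: sum.distrib sum_distrib_right)
  also have "(\<Sum>j\<in>A. g j) \<le> real t0 + (\<Sum>i\<in>I. min (M / d i) 1)"
  proof -
    have WA: "W \<subseteq> A" by (auto simp: W_def)
    have "(\<Sum>j\<in>A. g j) = (\<Sum>j\<in>W. g j)"
      using A WA U(2) by (intro sum.mono_neutral_right) (auto simp: g_def)
    also have "\<dots> = (\<Sum>j\<in>U. g j) + (\<Sum>j\<in>W - U. g j)"
      using sum.subset_diff[OF U(2) fin(1), of g] by simp
    also have "(\<Sum>j\<in>U. g j) = real (card U)" by (simp add: g_def)
    also have "(\<Sum>j\<in>W - U. g j) = (\<Sum>j\<in>W - U. min (M / d j) 1)" by (intro sum.cong) (auto simp: g_def)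
    also have "\<dots> \<le> (\<Sum>i\<in>I. min (M / d i) 1)"
    proof (rule sum_mono2)
      show "finite I" using I(2) A by (rule finite_subset)
      show "0 \<le> min (M / d b) 1" if "b \<in> I - (W - U)" for b
        using d[of b] that I(2) nonneg(3) by (auto simp: divide_nonneg_nonneg)
    qed (rule I(1))
    finally show ?thesis using U(3) by simp
  qed
  finally show ?thesis using I(2,3) nonneg(2) by (auto simp: mult_right_mono)
qed

lemma finite_uniform_bound:
  fixes P :: "'a \<Rightarrow> real \<Rightarrow> bool"
  assumes "finite A" "\<And>a. a \<in> A \<Longrightarrow> \<exists>C. P a C" "\<And>a C C'. P a C \<Longrightarrow> C \<le> C' \<Longrightarrow> P a C'"
  shows "\<exists>C\<ge>0. \<forall>a\<in>A. P a C"
proof -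
  obtain C where C: "\<And>a. a \<in> A \<Longrightarrow> P a (C a)" using assms(2) by metis
  have "P a (\<Sum>a\<in>A. \<bar>C a\<bar>)" if "a \<in> A" for a
    using member_le_sum[OF that, of "\<lambda>a. \<bar>C a\<bar>"] assms(1) by (intro assms(3)[OF C[OF that]]) auto
  then show ?thesis by (intro exI[of _ "\<Sum>a\<in>A. \<bar>C a\<bar>"]) (auto intro: sum_nonneg)
qed

theorem theorem4:
  fixes X :: "('n::finite \<Rightarrow> 'k::{complete_nonarch_field, alg_closed_field}) set set"
    and n q :: nat
    and D :: "nat \<Rightarrow> ('k, 'n) mpoly"
    and f :: "'n \<Rightarrow> 'k fps"
  assumes "projective_variety X"
    and "zdim X = ereal (real n)" and "n \<ge> 1"
    and "\<And>j. j \<in> {1..q} \<Longrightarrow> hypersurface_poly (D j)"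
    and "\<And>j. j \<in> {1..q} \<Longrightarrow> \<not> X \<subseteq> hypersurface (D j)"
    and "analytic_map f X"
    and "\<exists>z w. map_point f z \<noteq> map_point f w"
    and "\<And>j. j \<in> {1..q} \<Longrightarrow> \<not> range (map_point f) \<subseteq> hypersurface (D j)"
  shows "\<exists>C::real. \<forall>r\<ge>1.
           (\<Sum>j=1..q. proximity_fun f r (D j) / real (total_degree (D j)))
             \<le> (real (t_index q D X 0) + alpha q D X) * characteristic_fun f r + C"
proof -
  let ?A = "{1..q}" and ?t0 = "t_index q D X 0" and ?t1 = "t_index q D X (-1)" and ?M = "M_index q D X"
  note f = assms(6)
  note ent = analytic_map_entire[OF f]
  have X: "zariski_closed X" using assms(1) by (simp add: projective_variety_def irreducible_closed_def)
  have hom: "homogeneous (D j)" and deg: "total_degree (D j) \<ge> 1" if "j \<in> ?A" for j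
    using assms(4)[OF that] by (auto simp: hypersurface_poly_def)
  \<comment> \<open>If the composition were the zero series, every value of \<open>f\<close> would
    lie on the hypersurface.\<close>
  have nz: "mcomp (D j) f \<noteq> 0" if j: "j \<in> ?A" for j
  proof
    assume zero: "mcomp (D j) f = 0"
    have "map_point f z \<in> hypersurface (D j)" for z
    proof -
      have "meval (\<lambda>i. na_eval (f i) z) (D j) = 0"
        using na_eval_mcomp[of f "D j" z, OF ent] zero na_eval_const[of 0 z] by simp
      moreover have "\<exists>i. na_eval (f i) z \<noteq> 0" using f unfolding analytic_map_def by blast
      ultimately show ?thesis
        using proj_zeros_iff[of "{D j}" "\<lambda>i. na_eval (f i) z"] hom[OF j]
        unfolding map_point_def hypersurface_def by auto
    qed
    then show False using assms(8)[OF j] by blast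
  qed
  have finA: "finite {I. I \<subseteq> ?A \<and> P I}" for P by (rule finite_subset[of _ "Pow ?A"]) auto
  \<comment> \<open>The constants depend on \<open>j\<close> or on \<open>I\<close>. Taking common
    ones over these finite families lets the final summation be done at each \<open>r\<close>
    separately.\<close>
  have "\<exists>C\<ge>0. \<forall>j\<in>?A. \<forall>r\<ge>1. proximity_fun f r (D j) / real (total_degree (D j)) \<le> characteristic_fun f r + C"
  proof (rule finite_uniform_bound)
    show "\<exists>C. \<forall>r\<ge>1. proximity_fun f r (D j) / real (total_degree (D j)) \<le> characteristic_fun f r + C" if "j \<in> ?A" for j
      using proximity_le[OF f nz[OF that] deg[OF that]] by blast
  next
    fix j :: nat and C C' :: real
    assume "\<forall>r\<ge>1. proximity_fun f r (D j) / real (total_degree (D j)) \<le> characteristic_fun f r + C" "C \<le> C'"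
    then show "\<forall>r\<ge>1. proximity_fun f r (D j) / real (total_degree (D j)) \<le> characteristic_fun f r + C'"
      by fastforce
  qed simp
  then obtain C1 where C1: "C1 \<ge> 0" "\<And>j r. j \<in> ?A \<Longrightarrow> r \<ge> 1 \<Longrightarrow>
      proximity_fun f r (D j) / real (total_degree (D j)) \<le> characteristic_fun f r + C1" by blast
  have "\<exists>C\<ge>0. \<forall>I\<in>{I. I \<subseteq> ?A \<and> card I = ?t0 + 1}. \<forall>r\<ge>1. \<exists>l\<in>I. proximity_fun f r (D l) \<le> real ?M * characteristic_fun f r + C"
  proof (rule finite_uniform_bound[OF finA])
    fix I assume "I \<in> {I. I \<subseteq> ?A \<and> card I = ?t0 + 1}"
    then have I: "I \<subseteq> ?A" "card I = ?t0 + 1" by auto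
    have "finite ((\<Inter>l\<in>I. hypersurface (D l)) \<inter> X)"
      using t_index_spec[OF I] hom I(1) by (intro finite_zdim_le_0 zariski_closed_section X) auto
    then have "\<exists>C\<ge>0. \<forall>r\<ge>1. \<exists>l\<in>I. proximity_fun f r (D l) \<le> real ?M * characteristic_fun f r + C"
      using hom nz I(1) by (intro finite_section_proximity[OF f assms(7) X I]) auto
    then show "\<exists>C. \<forall>r\<ge>1. \<exists>l\<in>I. proximity_fun f r (D l) \<le> real ?M * characteristic_fun f r + C"
      by blast
  next
    fix I :: "nat set" and C C' :: real
    assume "\<forall>r\<ge>1. \<exists>l\<in>I. proximity_fun f r (D l) \<le> real ?M * characteristic_fun f r + C" and "C \<le> C'"
    moreover have "x \<le> y + C \<Longrightarrow> x \<le> y + C'" for x y using \<open>C \<le> C'\<close> by simp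
    ultimately show "\<forall>r\<ge>1. \<exists>l\<in>I. proximity_fun f r (D l) \<le> real ?M * characteristic_fun f r + C'" by blast
  qed
  then obtain C2 where C2: "C2 \<ge> 0" "\<And>I r. I \<subseteq> ?A \<Longrightarrow> card I = ?t0 + 1 \<Longrightarrow> r \<ge> 1 \<Longrightarrow>
      \<exists>l\<in>I. proximity_fun f r (D l) \<le> real ?M * characteristic_fun f r + C2" by blast
  have "\<exists>C\<ge>0. \<forall>I\<in>{I. I \<subseteq> ?A \<and> card I = ?t1 + 1}. \<forall>r\<ge>1. \<exists>l\<in>I. proximity_fun f r (D l) \<le> C"
  proof (rule finite_uniform_bound[OF finA])
    fix I assume "I \<in> {I. I \<subseteq> ?A \<and> card I = ?t1 + 1}"
    then have I: "I \<subseteq> ?A" "card I = ?t1 + 1" by auto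
    have I': "finite I" "I \<noteq> {}" using I(2) by (auto intro: card_ge_0_finite)
    have "(\<Inter>l\<in>I. hypersurface (D l)) \<inter> X = {}"
      using t_index_spec[OF I] zariski_closed_subset_space[OF X] by (intro empty_zdim_le_minus1) auto
    then have "\<exists>C\<ge>0. \<forall>r\<ge>1. \<exists>l\<in>I. proximity_fun f r (D l) \<le> C"
      using hom nz I(1) by (intro empty_section_proximity[OF f X I']) auto
    then show "\<exists>C. \<forall>r\<ge>1. \<exists>l\<in>I. proximity_fun f r (D l) \<le> C" by blast
  next
    fix I :: "nat set" and C C' :: real
    assume "\<forall>r\<ge>1. \<exists>l\<in>I. proximity_fun f r (D l) \<le> C" and "C \<le> C'"
    moreover have "x \<le> C \<Longrightarrow> x \<le> C'" for x using \<open>C \<le> C'\<close> by simp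
    ultimately show "\<forall>r\<ge>1. \<exists>l\<in>I. proximity_fun f r (D l) \<le> C'" by blast
  qed
  then obtain C3 where C3: "C3 \<ge> 0" "\<And>I r. I \<subseteq> ?A \<Longrightarrow> card I = ?t1 + 1 \<Longrightarrow> r \<ge> 1 \<Longrightarrow>
      \<exists>l\<in>I. proximity_fun f r (D l) \<le> C3" by blast
  \<comment> \<open>The characteristic function may be negative when |f|_1 < 1, while
    \<open>sum_bound\<close> is applied to a nonnegative \<open>T\<close>. The shift by
    \<open>c0\<close> only adds \<open>(t0 + alpha) * c0\<close> to the constant.\<close>
  define c0 where "c0 = \<bar>ln (map_abs 1 f)\<bar>"
  have T: "characteristic_fun f r + c0 \<ge> 0" if r: "r \<ge> 1" for r
  proof -
    have "ln (map_abs 1 f) \<le> ln (map_abs r f)"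
      using map_abs_mono[of f, OF ent r] map_abs_pos[OF f, of 1] by simp
    then show ?thesis by (simp add: characteristic_fun_def c0_def)
  qed
  define C where "C = C1 + C2 + C3"
  have C: "C \<ge> 0" "C1 \<le> C" "C2 \<le> C" "C3 \<le> C" using C1 C2 C3 by (auto simp: C_def)
  have t: "?t0 \<le> ?t1" "?t1 \<le> q" by (auto intro: t_index_antimono t_index_le)
  have main: "(\<Sum>j=1..q. proximity_fun f r (D j) / real (total_degree (D j))) \<le>
      (real ?t0 + alpha q D X) * characteristic_fun f r + ((real ?t0 + alpha q D X) * c0 + real q * C)"
    if r: "r \<ge> 1" for r
  proof -
    let ?T = "characteristic_fun f r + c0"
    have c0: "c0 \<ge> 0" by (simp add: c0_def)
    have "\<exists>I\<subseteq>?A. card I = ?t1 - ?t0 \<and>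
      (\<Sum>j\<in>?A. proximity_fun f r (D j) / real (total_degree (D j))) \<le>
      (real ?t0 + (\<Sum>i\<in>I. min (real ?M / real (total_degree (D i))) 1)) * ?T + real (card ?A) * C"
    proof (rule sum_bound)
      show "1 \<le> real (total_degree (D j))" if "j \<in> ?A" for j using deg[OF that] by simp
      show "proximity_fun f r (D j) / real (total_degree (D j)) \<le> ?T + C" if "j \<in> ?A" for j
        using C1(2)[OF that r] C c0 by linarith
      show "\<exists>l\<in>I. proximity_fun f r (D l) \<le> real ?M * ?T + C" if I: "I \<subseteq> ?A" "card I = ?t0 + 1" for I
      proof -
        obtain l where "l \<in> I" "proximity_fun f r (D l) \<le> real ?M * characteristic_fun f r + C2" using C2(2)[OF I r] by blast
        moreover have "real ?M * characteristic_fun f r \<le> real ?M * ?T" using c0 by (intro mult_left_mono) auto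
        ultimately show ?thesis using C(3) by (meson add_mono order_trans)
      qed
      show "\<exists>l\<in>I. proximity_fun f r (D l) \<le> C" if "I \<subseteq> ?A" "card I = ?t1 + 1" for I
        using C3(2)[OF that r] C(4) order_trans by blast
    qed (use t C T[OF r] in auto)
    then obtain I where I: "I \<subseteq> ?A" "card I = ?t1 - ?t0"
      "(\<Sum>j\<in>?A. proximity_fun f r (D j) / real (total_degree (D j))) \<le>
      (real ?t0 + (\<Sum>i\<in>I. min (real ?M / real (total_degree (D i))) 1)) * ?T + real q * C" by auto
    have "(\<Sum>i\<in>I. min (real ?M / real (total_degree (D i))) 1) \<le> alpha q D X"
      unfolding alpha_def using I finA by (intro Max_ge finite_imageI imageI) auto
    then have "(real ?t0 + (\<Sum>i\<in>I. min (real ?M / real (total_degree (D i))) 1)) * ?T \<le> (real ?t0 + alpha q D X) * ?T"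
      using T[OF r] by (intro mult_right_mono) auto
    then show ?thesis using I(3) by (simp add: algebra_simps)
  qed
  then show ?thesis by blast
qed

end
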